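(* Let $n\ge 2$ be an integer, let $\alpha\in\mathbb{R}$ with $\alpha\notin\{-\tfrac n2,-\tfrac n2-1,\dots\}$, put $\rho=\alpha+\frac{n-1}{2}$, and assume $\rho\neq 0$ and $\rho\neq 1$. Let $s\in\mathbb{R}$. Then for Lebesgue-almost every irrational $\beta\in(0,1)$, with $t=\cos(\beta\pi)$, the operator $(M_t^{\alpha})^{-1}$ is not bounded from $\tilde H^{s+\rho+1}(\mathbb{S}^n)$ into $H^{s}(\mathbb{S}^n)$.
   Context: $\mathbb{S}^n\subset\mathbb{R}^{n+1}$ is the unit sphere, $\mathscr{H}_j$ ($j=0,1,2,\dots$) is the space of spherical harmonics of degree $j$, $P_j$ is the orthogonal projection of $L^2(\mathbb{S}^n)$ onto $\mathscr{H}_j$, and $-\Delta Y=j(j+n-1)Y$ for $Y\in\mathscr{H}_j$, where $\Delta$ is the Laplace--Beltrami operator. For $s\in\mathbb{R}$, $H^s(\mathbb{S}^n)$ is the $L^2$-based Sobolev space with norm $\|f\|_{H^s}=\|(1-\Delta)^{s/2}f\|_{L^2}$, i.e. $\|f\|_{H^s}^2=\sum_j (1+j(j+n-1))^s\|P_jf\|_{L^2}^2$. Generalized Minkowski--Funk transform (Rubin). For $t=\cos\theta\in(-1,1)$ and $\alpha>0$, $$(M_t^\alpha f)(x)=\frac{\kappa}{\Gamma(\alpha)}\int_{\{y\in\mathbb{S}^n:\ x\cdot y>t\}}(x\cdot y-t)^{\alpha-1}f(y)\,dy,$$ where $\kappa=\kappa(n,\alpha,t)\ne0$ is a normalizing constant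 whose value does not affect the claim; for other $\alpha\notin\{-\frac n2,-\frac n2-1,\dots\}$ it is defined by analytic continuation in $\alpha$. Equivalently, $M_t^\alpha$ is the spherical multiplier operator $M_t^\alpha f=\sum_{j\ge0}m_t^\alpha(j)P_jf$ with $$m_t^\alpha(j)=\kappa'\;{}_2F_1\Bigl(j+\tfrac n2,\;1-\tfrac n2-j;\;\alpha+\tfrac n2;\;\tfrac{1-t}{2}\Bigr),$$ where $\kappa'=\kappa'(n,\alpha,t)\neq0$ does not depend on $j$ and ${}_2F_1$ is the Gauss hypergeometric function. $\tilde H^s(\mathbb{S}^n)$ is the closure in $H^s(\mathbb{S}^n)$ of $\{f\in H^s(\mathbb{S}^n): f\perp\ker M_t^\alpha\}$; on it $M_t^\alpha$ is injective. The inverse $(M_t^\alpha)^{-1}$ acts by $(M_t^\alpha)^{-1}g=\sum_{j:\,m_t^\alpha(j)\ne0}m_t^\alpha(j)^{-1}P_jg$, and it is bounded from $\tilde H^{\sigma}(\mathbb{S}^n)$ into $H^s(\mathbb{S}^n)$ if there is $C>0$ with $\|(M_t^\alpha)^{-1}g\|_{H^s}\le C\|g\|_{H^\sigma}$ for all $g\in\tilde H^\sigma(\mathbb{S}^n)$ that are finite sums of spherical harmonics. *)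

theory Defs
  imports "HOL-Analysis.Analysis"
begin

text \<open>
  The ambient space is a Euclidean space \<open>'a\<close> of dimension \<open>n + 1\<close>, so that the unit sphere
  \<open>sphere 0 1\<close> of \<open>'a\<close> is the \<open>n\<close>-sphere.  Functions on the sphere are complex-valued functions
  on \<open>'a\<close> of which only the restriction to the sphere matters.
\<close>

text \<open>
  Surface measure on the unit sphere, as a Borel measure on \<open>'a\<close> concentrated on the sphere:
  the measure of \<open>A\<close> is \<open>n + 1\<close> times the volume of the cone \<open>{r *\<^sub>R x | x \<in> A, 0 < r \<le> 1}\<close>.
  Recall that \<open>sgn x = x /\<^sub>R norm x\<close>.
\<close>

definition sphere_measure :: "'a::euclidean_space measure" where
  "sphere_measure =
     scale_measure (ennreal (real DIM('a))) (distr (restrict_space lborel (cball 0 1)) borel sgn)"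

definition sphere_L2 :: "('a::euclidean_space \<Rightarrow> complex) set" where
  "sphere_L2 = {f \<in> borel_measurable sphere_measure.
                  integrable sphere_measure (\<lambda>x. (norm (f x))\<^sup>2)}"

definition sphere_inner :: "('a::euclidean_space \<Rightarrow> complex) \<Rightarrow> ('a \<Rightarrow> complex) \<Rightarrow> complex" where
  "sphere_inner f g = (LINT x|sphere_measure. f x * cnj (g x))"

definition sphere_norm :: "('a::euclidean_space \<Rightarrow> complex) \<Rightarrow> real" where
  "sphere_norm f = sqrt (LINT x|sphere_measure. (norm (f x))\<^sup>2)"

definition laplacian :: "('a::euclidean_space \<Rightarrow> complex) \<Rightarrow> 'a \<Rightarrow> complex" where
  "laplacian p x =
     (\<Sum>b\<in>Basis. frechet_derivative (\<lambda>y. frechet_derivative p (at y) b) (at x) b)"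

definition solid_harmonics :: "nat \<Rightarrow> ('a::euclidean_space \<Rightarrow> complex) set" where
  "solid_harmonics j =
     {p. polynomial_function p \<and> (\<forall>c x. p (c *\<^sub>R x) = c ^ j *\<^sub>R p x) \<and> (\<forall>x. laplacian p x = 0)}"

text \<open>
  Spherical harmonics of degree \<open>j\<close>.  Extending by \<open>0\<close> off the sphere makes the function on
  \<open>'a\<close> unique.
\<close>

definition spherical_harmonics :: "nat \<Rightarrow> ('a::euclidean_space \<Rightarrow> complex) set" where
  "spherical_harmonics j =
     (\<lambda>p x. if x \<in> sphere 0 1 then p x else 0) ` solid_harmonics j"

definition finite_harmonic_sums :: "('a::euclidean_space \<Rightarrow> complex) set" where
  "finite_harmonic_sums =
     {g. \<exists>N Y. (\<forall>j\<le>N. Y j \<in> spherical_harmonics j) \<and> g = (\<lambda>x. \<Sum>j\<le>N. Y j x)}"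

text \<open>Orthogonal projection of \<open>L\<^sup>2\<close> of the sphere onto the spherical harmonics of degree \<open>j\<close>.\<close>

definition harmonic_proj :: "nat \<Rightarrow> ('a::euclidean_space \<Rightarrow> complex) \<Rightarrow> ('a \<Rightarrow> complex)" where
  "harmonic_proj j f =
     (THE Y. Y \<in> spherical_harmonics j \<and>
             (\<forall>Z\<in>spherical_harmonics j. sphere_inner (\<lambda>x. f x - Y x) Z = 0))"

text \<open>
  For \<open>s < 0\<close> the elements of the Sobolev space of order \<open>s\<close> are distributions.  A distribution on
  the sphere is represented by its spherical harmonic expansion, the sequence \<open>F\<close> whose member
  \<open>F j\<close> is its component of degree \<open>j\<close>; an \<open>L\<^sup>2\<close> function \<open>f\<close> enters through
  \<open>harmonic_expansion f\<close>.
\<close>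

definition harmonic_expansion :: "('a::euclidean_space \<Rightarrow> complex) \<Rightarrow> nat \<Rightarrow> 'a \<Rightarrow> complex" where
  "harmonic_expansion f j = harmonic_proj j f"

text \<open>
  \<open>1 + j (j + n - 1)\<close>, the eigenvalue of \<open>1 - \<Delta>\<close> on spherical harmonics of degree \<open>j\<close>,
  where \<open>n = DIM('a) - 1\<close>.
\<close>

definition sobolev_weight :: "'a::euclidean_space itself \<Rightarrow> nat \<Rightarrow> real" where
  "sobolev_weight _ j = 1 + real j * (real j + (real DIM('a) - 1) - 1)"

definition sobolev_space :: "real \<Rightarrow> (nat \<Rightarrow> 'a::euclidean_space \<Rightarrow> complex) set" where
  "sobolev_space s =
     {F. (\<forall>j. F j \<in> spherical_harmonics j) \<and>
         summable (\<lambda>j. sobolev_weight TYPE('a) j powr s * (sphere_norm (F j))\<^sup>2)}"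

definition sobolev_norm :: "real \<Rightarrow> (nat \<Rightarrow> 'a::euclidean_space \<Rightarrow> complex) \<Rightarrow> real" where
  "sobolev_norm s F = sqrt (\<Sum>j. sobolev_weight TYPE('a) j powr s * (sphere_norm (F j))\<^sup>2)"

definition gauss_hypergeometric :: "real \<Rightarrow> real \<Rightarrow> real \<Rightarrow> real \<Rightarrow> real" where
  "gauss_hypergeometric a b c z = eval_fps (fps_hypergeo [a, b] [c] 1) z"

text \<open>
  The multiplier of the generalized Minkowski--Funk transform on the \<open>n\<close>-sphere, covering all
  admissible \<open>\<alpha>\<close>, also those reached only by analytic continuation of the integral
  \<open>\<integral>\<^bsub>x \<bullet> y > t\<^esub> (x \<bullet> y - t) powr (\<alpha> - 1) * f y dy\<close>.  The nonzero factor \<open>\<kappa>\<close> stands for the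
  normalization, which does not depend on \<open>j\<close>.
\<close>

definition mf_multiplier :: "nat \<Rightarrow> real \<Rightarrow> real \<Rightarrow> real \<Rightarrow> nat \<Rightarrow> real" where
  "mf_multiplier n \<alpha> \<kappa> t j =
     \<kappa> * gauss_hypergeometric (real j + real n / 2) (1 - real n / 2 - real j)
           (\<alpha> + real n / 2) ((1 - t) / 2)"

definition mf_transform ::
    "real \<Rightarrow> real \<Rightarrow> real \<Rightarrow> (nat \<Rightarrow> 'a::euclidean_space \<Rightarrow> complex) \<Rightarrow> nat \<Rightarrow> 'a \<Rightarrow> complex" where
  "mf_transform \<alpha> \<kappa> t F j x = of_real (mf_multiplier (DIM('a) - 1) \<alpha> \<kappa> t j) * F j x"

definition mf_inverse ::
    "real \<Rightarrow> real \<Rightarrow> real \<Rightarrow> (nat \<Rightarrow> 'a::euclidean_space \<Rightarrow> complex) \<Rightarrow> nat \<Rightarrow> 'a \<Rightarrow> complex" where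
  "mf_inverse \<alpha> \<kappa> t F j x =
     (let m = mf_multiplier (DIM('a) - 1) \<alpha> \<kappa> t j
      in if m \<noteq> 0 then of_real (inverse m) * F j x else 0)"

definition mf_kernel :: "real \<Rightarrow> real \<Rightarrow> real \<Rightarrow> ('a::euclidean_space \<Rightarrow> complex) set" where
  "mf_kernel \<alpha> \<kappa> t =
     {f \<in> sphere_L2. mf_transform \<alpha> \<kappa> t (harmonic_expansion f) = (\<lambda>j x. 0)}"

text \<open>
  Orthogonality of a distribution to a function is read off from the expansions; for \<open>F\<close> in
  \<open>L\<^sup>2\<close> the series is the \<open>L\<^sup>2\<close> inner product.
\<close>

definition mf_kernel_perp ::
    "real \<Rightarrow> real \<Rightarrow> real \<Rightarrow> real \<Rightarrow> (nat \<Rightarrow> 'a::euclidean_space \<Rightarrow> complex) set" where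
  "mf_kernel_perp \<alpha> \<kappa> t s =
     {F \<in> sobolev_space s.
        \<forall>f\<in>mf_kernel \<alpha> \<kappa> t. (\<lambda>j. sphere_inner (F j) (harmonic_expansion f j)) sums 0}"

text \<open>The closure of \<open>mf_kernel_perp\<close> in the Sobolev space of order \<open>s\<close>.\<close>

definition mf_sobolev ::
    "real \<Rightarrow> real \<Rightarrow> real \<Rightarrow> real \<Rightarrow> (nat \<Rightarrow> 'a::euclidean_space \<Rightarrow> complex) set" where
  "mf_sobolev \<alpha> \<kappa> t s =
     {G \<in> sobolev_space s.
        \<forall>\<epsilon>>0. \<exists>F\<in>mf_kernel_perp \<alpha> \<kappa> t s. sobolev_norm s (\<lambda>j x. F j x - G j x) < \<epsilon>}"

text \<open>Boundedness of the inverse transform from \<open>mf_sobolev \<alpha> \<kappa> t \<sigma>\<close> into \<open>sobolev_space s\<close>.\<close>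

definition mf_inverse_bounded ::
    "'a::euclidean_space itself \<Rightarrow> real \<Rightarrow> real \<Rightarrow> real \<Rightarrow> real \<Rightarrow> real \<Rightarrow> bool" where
  "mf_inverse_bounded _ \<alpha> \<kappa> t \<sigma> s \<longleftrightarrow>
     (\<exists>C>0. \<forall>g\<in>(finite_harmonic_sums :: ('a \<Rightarrow> complex) set).
        harmonic_expansion g \<in> mf_sobolev \<alpha> \<kappa> t \<sigma> \<longrightarrow>
        sobolev_norm s (mf_inverse \<alpha> \<kappa> t (harmonic_expansion g))
          \<le> C * sobolev_norm \<sigma> (harmonic_expansion g))"

end

theory Submission
  imports Defs "HOL-Real_Asymp.Real_Asymp"
begin

text \<open>
  On spherical harmonics of degree \<open>j\<close> the inverse transform divides by the multiplier \<open>m j\<close>.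
  Testing a bound from \<open>H\<^sup>s\<^sup>+\<^sup>\<rho>\<^sup>+\<^sup>1\<close> into \<open>H\<^sup>s\<close> on one harmonic of each degree therefore gives
  \<open>\<bar>m j\<bar> \<ge> c * j powr (- \<rho> - 1)\<close> for all \<open>j\<close> with \<open>m j \<noteq> 0\<close>
  (\<open>mf_inverse_bounded_imp_multiplier_bound\<close>).  For almost every \<open>\<beta>\<close> no multiplier vanishes and
  every such lower bound fails (\<open>AE_legendre_small_values\<close>).

  Put \<open>N = j + (n - 1) / 2\<close> and \<open>t = \<beta> * pi\<close>.  Up to a factor that does not depend on \<open>j\<close>, the
  multiplier is a solution \<open>u\<close> of \<open>u'' + (N\<^sup>2 - \<rho> (\<rho> - 1) / sin\<^sup>2 t) u = 0\<close>.  On the scale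
  \<open>t \<sim> 1 / N\<close> this equation is a small perturbation of Bessel's equation in the variable \<open>N t\<close>, and
  away from the singular end points the solution oscillates freely up to relative errors \<open>1 / N\<close>.
  So \<open>N powr \<rho> * u t = R cos (N t + \<phi>) + O(1 / N)\<close>, locally uniformly in \<open>t\<close>
  (\<open>legendre_sol_asymptotics\<close>).  The numbers \<open>R > 0\<close> and \<open>\<phi>\<close> are read off from one fixed Bessel
  function; what matters about them is that they are the same for all \<open>N\<close>.

  Consequently \<open>u\<close> has a zero within \<open>O(1 / N\<^sup>2)\<close> of each zero of the cosine, measured in \<open>\<beta>\<close>, and as
  \<open>N powr \<rho> * u'\<close> is \<open>O(N)\<close>, the inequality \<open>\<bar>u\<bar> < \<delta> * N powr (- \<rho> - 1)\<close> holds on an interval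
  about this zero of length proportional to \<open>1 / N\<^sup>2\<close>.  An elementary inhomogeneous approximation
  theorem puts every irrational \<open>\<beta>\<close> within \<open>O(1 / N\<^sup>2)\<close> of a zero of the cosine for infinitely many
  \<open>N\<close>.  The set of \<open>\<beta>\<close> where \<open>\<bar>u\<bar> \<ge> \<delta> * N powr (- \<rho> - 1)\<close> for all large \<open>N\<close> thus has, around each of
  its irrational points and at arbitrarily small scales, holes of a fixed relative size.  Such a
  porous set is a null set by Vitali's covering theorem (\<open>porous_imp_negligible\<close>).  Only the
  existence of the constants matters here, so the badly controlled ones in the approximation
  theorem and in the location of the zeros do no harm, however small \<open>\<delta>\<close> is.

  To evaluate the operator on a single harmonic one needs that harmonics of different degrees are
  orthogonal on the sphere.  This comes from Green's identity on the ambient space with a compactly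
  supported radial weight, followed by integration along rays (\<open>spherical_harmonics_orthogonal\<close>).
\<close>

section \<open>Porous sets and inhomogeneous approximation\<close>

text \<open>
  Cover \<open>S\<close> by disjoint balls of a Vitali family inside an open \<open>U \<supseteq> S\<close>.  The holes in these balls lie
  in \<open>U - S\<close> and make up a fixed proportion of the balls, so the balls are small altogether when
  \<open>U - S\<close> is.
\<close>

lemma porous_imp_negligible:
  fixes S :: "'a::euclidean_space set"
  assumes S: "S \<in> sets lebesgue" and "c > 0"
    and holes: "\<And>x d. \<lbrakk>x \<in> S; 0 < d\<rbrakk> \<Longrightarrow>
      \<exists>r. 0 < r \<and> r < d \<and> c * measure lebesgue (ball x r) \<le> measure lebesgue (ball x r - S)"
  shows "negligible S"
proof (clarsimp simp: negligible_outer_le)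
  fix e :: real
  assume "e > 0"
  let ?\<mu> = "measure lebesgue"
  obtain U where U: "open U" "S \<subseteq> U" "U - S \<in> lmeasurable" "emeasure lebesgue (U - S) < ennreal (c * e)"
    using sets_lebesgue_outer_open[OF S, of "c * e"] \<open>c > 0\<close> \<open>e > 0\<close> by auto
  then have mU: "?\<mu> (U - S) < c * e"
    using \<open>c > 0\<close> \<open>e > 0\<close> by (simp add: emeasure_eq_measure2 ennreal_less_iff)
  let ?K = "{(x, r). x \<in> S \<and> 0 < r \<and> ball x r \<subseteq> U \<and> c * ?\<mu> (ball x r) \<le> ?\<mu> (ball x r - S)}"
  obtain C where C: "countable C" "C \<subseteq> ?K"
    and pw: "pairwise (\<lambda>i j. disjnt (ball (fst i) (snd i)) (ball (fst j) (snd j))) C"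
    and neg: "negligible (S - (\<Union>i \<in> C. ball (fst i) (snd i)))"
  proof (rule Vitali_covering_theorem_balls [of "S" ?K fst snd])
    fix x and d :: real
    assume x: "x \<in> S" and "d > 0"
    obtain k where "k > 0" and k: "ball x k \<subseteq> U"
      using x U by (meson openE subsetD)
    obtain r where r: "0 < r" "r < min d k" "c * ?\<mu> (ball x r) \<le> ?\<mu> (ball x r - S)"
      using holes[OF x, of "min d k"] \<open>d > 0\<close> \<open>k > 0\<close> by auto
    then have "ball x r \<subseteq> U"
      using k by (meson less_imp_le min_less_iff_conj order_trans subset_ball)
    with r x show "\<exists>i. i \<in> ?K \<and> x \<in> ball (fst i) (snd i) \<and> snd i < d"
      by (intro exI[of _ "(x, r)"]) auto
  qed
  let ?B = "\<lambda>i::'a \<times> real. ball (fst i) (snd i)"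
  have finite_bound: "?\<mu> (\<Union>i\<in>I. ?B i) \<le> e" if I: "I \<subseteq> C" "finite I" for I
  proof -
    have meas: "?B i - S \<in> lmeasurable" for i
      using S by (intro fmeasurable_Diff) auto
    have "c * ?\<mu> (\<Union>i\<in>I. ?B i) \<le> c * (\<Sum>i\<in>I. ?\<mu> (?B i))"
      using \<open>c > 0\<close> I by (intro mult_left_mono measure_UNION_le) auto
    also have "\<dots> = (\<Sum>i\<in>I. c * ?\<mu> (?B i))"
      by (rule sum_distrib_left)
    also have "\<dots> \<le> (\<Sum>i\<in>I. ?\<mu> (?B i - S))"
      using I C by (intro sum_mono) auto
    also have "\<dots> = ?\<mu> (\<Union>i\<in>I. ?B i - S)"
    proof (rule measure_UNION'[symmetric])
      show "pairwise (\<lambda>i j. disjnt (?B i - S) (?B j - S)) I"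
        using pairwise_subset[OF pw I(1)] by (rule pairwise_mono) (auto simp: disjnt_def)
    qed (use I meas in auto)
    also have "\<dots> \<le> ?\<mu> (U - S)"
    proof (rule measure_mono_fmeasurable)
      show "(\<Union>i\<in>I. ?B i - S) \<subseteq> U - S"
        using I C by fastforce
      show "(\<Union>i\<in>I. ?B i - S) \<in> sets lebesgue"
        using I meas by (intro sets.finite_UN) auto
    qed (use U in auto)
    also have "\<dots> \<le> c * e"
      using mU by simp
    finally show ?thesis
      using \<open>c > 0\<close> by simp
  qed
  have UC: "(\<Union>i\<in>C. ?B i) \<in> lmeasurable" "?\<mu> (\<Union>i\<in>C. ?B i) \<le> e"
    using finite_bound \<open>e > 0\<close>
    by (auto intro!: fmeasurable_UN_bound [OF C(1)] measure_UN_bound [OF C(1)])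
  let ?T = "(S - (\<Union>i\<in>C. ?B i)) \<union> (\<Union>i\<in>C. ?B i)"
  show "\<exists>T. S \<subseteq> T \<and> T \<in> lmeasurable \<and> ?\<mu> T \<le> e"
  proof (intro exI conjI)
    show "?T \<in> lmeasurable"
      using UC negligible_imp_measurable[OF neg] by (intro fmeasurable.Un)
    have "?\<mu> ?T = ?\<mu> (\<Union>i\<in>C. ?B i)"
      by (rule measure_negligible_symdiff[OF UC(1)]) (auto intro: negligible_subset[OF neg])
    then show "?\<mu> ?T \<le> e"
      using UC by simp
  qed auto
qed

lemma proportional_holes_imp_negligible:
  fixes S :: "'a::euclidean_space set"
  assumes S: "S \<in> sets lebesgue" and "q > 0"
    and holes: "\<And>x d. \<lbrakk>x \<in> S; 0 < d\<rbrakk> \<Longrightarrow>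
      \<exists>r y. 0 < r \<and> r < d \<and> ball y (q * r) \<subseteq> ball x r \<and> ball y (q * r) \<inter> S = {}"
  shows "negligible S"
proof (rule porous_imp_negligible[OF S])
  let ?\<mu> = "measure lebesgue"
  show "q ^ DIM('a) > 0"
    using \<open>q > 0\<close> by simp
  fix x :: 'a and d :: real assume "x \<in> S" "0 < d"
  then obtain r y where r: "0 < r" "r < d" "ball y (q * r) \<subseteq> ball x r" "ball y (q * r) \<inter> S = {}"
    using holes by blast
  have "q ^ DIM('a) * ?\<mu> (ball x r) = ?\<mu> (ball y (q * r))"
    using r \<open>q > 0\<close> by (simp add: content_ball power_mult_distrib)
  also have "\<dots> \<le> ?\<mu> (ball x r - S)"
    using r S by (intro measure_mono_fmeasurable fmeasurable_Diff) auto
  finally show "\<exists>r>0. r < d \<and> q ^ DIM('a) * ?\<mu> (ball x r) \<le> ?\<mu> (ball x r - S)"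
    using r by blast
qed

text \<open>
  Let \<open>p / q\<close> be a fraction in lowest terms with \<open>\<bar>\<beta> - p / q\<bar> < 1 / q\<^sup>2\<close>.  As \<open>j\<close> runs through \<open>q\<close> consecutive
  integers, \<open>j p\<close> meets every residue class modulo \<open>q\<close>, so \<open>j p / q - k\<close> can be brought within
  \<open>1 / (2 q)\<close> of \<open>\<gamma>\<close>; replacing \<open>p / q\<close> by \<open>\<beta>\<close> costs at most \<open>j / q\<^sup>2\<close>.  Taking \<open>j\<close> between \<open>q\<close> and
  \<open>2 q\<close> keeps both errors of order \<open>1 / j\<close> and makes \<open>j\<close> positive and as large as desired.
\<close>

lemma inhomogeneous_approximation:
  fixes \<beta> \<gamma> :: real
  assumes "\<beta> \<notin> \<rat>"
  shows "\<exists>j k. M \<le> j \<and> \<bar>of_nat j * \<beta> - of_int k - \<gamma>\<bar> \<le> 5 / of_nat j"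
proof -
  have "infinite (approx_set \<beta>)"
    using assms rational_iff_finite_approx_set by blast
  then obtain p q :: int where pq: "(p, q) \<in> approx_set \<beta>" and qK: "q > int M"
    using infinite_approx_set by blast
  then have q0: "q > 0" and cop: "coprime p q" and ap: "\<bar>\<beta> - p / q\<bar> < 1 / (of_int q)\<^sup>2"
    by (auto simp: approx_set_def)
  define m where "m = round (of_int q * \<gamma>)"
  have m: "\<bar>of_int m - of_int q * \<gamma>\<bar> \<le> 1/2"
    unfolding m_def by (rule of_int_round_abs_le)
  obtain u v where uv: "u * p + v * q = 1"
    using bezout_int[of p q] cop by auto
  \<comment> \<open>the representative of \<open>u * m\<close> modulo \<open>q\<close> in the interval from \<open>q\<close> to \<open>2 q - 1\<close>\<close>
  define j where "j = q + (u * m) mod q"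
  have jb: "q \<le> j" "j < 2 * q"
    using q0 by (auto simp: j_def pos_mod_bound)
  define t where "t = 1 - (u * m) div q"
  have "j = u * m + q * t"
    using mult_div_mod_eq[of q "u * m"] by (simp add: j_def t_def algebra_simps)
  then have "p * j = (u * p) * m + q * (p * t)"
    by (simp add: algebra_simps)
  also have "u * p = 1 - v * q"
    using uv by simp
  finally have k: "p * j = m + q * k" if "k = p * t - v * m" for k
    unfolding that by (simp add: algebra_simps)
  define k where "k = p * t - v * m"
  note k = k[OF k_def]
  have eq: "j * \<beta> - k - \<gamma> = j * (\<beta> - p / q) + (m - q * \<gamma>) / q"
    using q0 arg_cong[OF k, of real_of_int] by (simp add: field_simps)
  have "\<bar>j * (\<beta> - p / q)\<bar> \<le> (2 * q) * (1 / (of_int q)\<^sup>2)"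
    unfolding abs_mult using jb ap q0 by (intro mult_mono) auto
  also have "\<dots> = 2 / q"
    using q0 by (simp add: power2_eq_square)
  finally have "\<bar>j * (\<beta> - p / q)\<bar> \<le> 2 / q" .
  moreover have "\<bar>(m - q * \<gamma>) / q\<bar> \<le> (1/2) / q"
    using divide_right_mono[OF m, of "of_int q"] q0 by (simp add: abs_divide)
  ultimately have "\<bar>j * \<beta> - k - \<gamma>\<bar> \<le> (5/2) / q"
    unfolding eq using abs_triangle_ineq[of "j * (\<beta> - p / q)" "(m - q * \<gamma>) / q"] by (simp add: add_divide_distrib[symmetric])
  also have "\<dots> \<le> 5 / j"
    using jb q0 by (simp add: field_simps)
  finally have "\<bar>of_nat (nat j) * \<beta> - of_int k - \<gamma>\<bar> \<le> 5 / of_nat (nat j)"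
    using jb q0 by simp
  moreover have "M \<le> nat j"
    using jb qK by simp
  ultimately show ?thesis by blast
qed

section \<open>Amplitudes of oscillating solutions\<close>

text \<open>
  The norm is not differentiable where \<open>z\<close> vanishes, but \<open>sqrt (z \<bullet> z + \<delta>\<^sup>2)\<close> is, and it satisfies the same
  differential inequality; \<open>\<delta>\<close> is then made small.
\<close>

lemma gronwall_norm:
  fixes z :: "real \<Rightarrow> 'a::real_inner"
  assumes "a \<le> b"
    and z: "\<And>t. t \<in> {a..b} \<Longrightarrow> (z has_vector_derivative z' t) (at t)"
    and K: "\<And>t. t \<in> {a..b} \<Longrightarrow> (K has_real_derivative k t) (at t)"
    and M: "\<And>t. t \<in> {a..b} \<Longrightarrow> (M has_real_derivative m t) (at t)"
    and bound: "\<And>t. t \<in> {a..b} \<Longrightarrow> norm (z' t) \<le> k t * norm (z t) + m t"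
    and k0: "\<And>t. t \<in> {a..b} \<Longrightarrow> 0 \<le> k t"
    and m0: "\<And>t. t \<in> {a..b} \<Longrightarrow> 0 \<le> m t"
  shows "norm (z b) \<le> exp (K b - K a) * (norm (z a) + M b - M a)"
proof (rule field_le_epsilon)
  fix e :: real
  assume "e > 0"
  \<comment> \<open>this error is multiplied by \<open>exp (K b - K a)\<close> at the end\<close>
  define \<delta> where "\<delta> = e / exp (K b - K a)"
  have "\<delta> > 0"
    using \<open>e > 0\<close> by (simp add: \<delta>_def)
  define r where "r t = sqrt (z t \<bullet> z t + \<delta>\<^sup>2)" for t
  have r_pos: "r t > 0" for t
    using \<open>\<delta> > 0\<close> by (simp add: r_def add_nonneg_pos)
  have norm_le_r: "norm (z t) \<le> r t" for t
    unfolding r_def norm_eq_sqrt_inner by (intro real_sqrt_le_mono) simp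
  have r_le: "r t \<le> norm (z t) + \<delta>" for t
    using sqrt_add_le_add_sqrt[of "z t \<bullet> z t" "\<delta>\<^sup>2"] \<open>\<delta> > 0\<close>
    by (simp add: r_def norm_eq_sqrt_inner)
  have r_deriv: "(r has_real_derivative (z t \<bullet> z' t) / r t) (at t)" if "t \<in> {a..b}" for t
  proof -
    have "((\<lambda>t. z t \<bullet> z t + \<delta>\<^sup>2) has_real_derivative 2 * (z t \<bullet> z' t)) (at t)"
      using z[OF that] unfolding has_vector_derivative_def has_field_derivative_def
      by (auto intro!: derivative_eq_intros simp: inner_commute)
    moreover have "z t \<bullet> z t + \<delta>\<^sup>2 > 0"
      using r_pos[of t] by (simp add: r_def)
    ultimately have "((\<lambda>t. sqrt (z t \<bullet> z t + \<delta>\<^sup>2)) has_real_derivative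
        inverse (sqrt (z t \<bullet> z t + \<delta>\<^sup>2)) / 2 * (2 * (z t \<bullet> z' t))) (at t)"
      by (intro DERIV_chain2[OF DERIV_real_sqrt])
    then show ?thesis
      by (simp add: r_def[abs_def] field_simps)
  qed
  have r_growth: "(z t \<bullet> z' t) / r t \<le> k t * r t + m t" if "t \<in> {a..b}" for t
  proof -
    have "z t \<bullet> z' t \<le> norm (z t) * norm (z' t)"
      by (rule norm_cauchy_schwarz)
    also have "\<dots> \<le> r t * (k t * r t + m t)"
    proof (intro mult_mono)
      show "norm (z' t) \<le> k t * r t + m t"
        using bound[OF that] mult_left_mono[OF norm_le_r[of t] k0[OF that]] by linarith
    qed (use norm_le_r r_pos less_imp_le in auto)
    finally show ?thesis
      using r_pos[of t] by (simp add: field_simps)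
  qed
  have K_mono: "K a \<le> K t" if "t \<in> {a..b}" for t
    by (rule DERIV_nonneg_imp_nondecreasing) (use that K k0 in force)+
  let ?\<phi> = "\<lambda>t. exp (K a - K t) * r t - M t"
  have "?\<phi> b \<le> ?\<phi> a"
  proof (rule DERIV_nonpos_imp_nonincreasing[OF \<open>a \<le> b\<close>])
    fix t assume "a \<le> t" "t \<le> b"
    then have t: "t \<in> {a..b}" by simp
    have "exp (K a - K t) * ((z t \<bullet> z' t) / r t) \<le> exp (K a - K t) * (k t * r t + m t)"
      by (rule mult_left_mono[OF r_growth[OF t]]) simp
    moreover have "exp (K a - K t) * m t \<le> 1 * m t"
      using K_mono[OF t] m0[OF t] by (intro mult_right_mono) auto
    ultimately have "exp (K a - K t) * (0 - k t) * r t + exp (K a - K t) * ((z t \<bullet> z' t) / r t) - m t \<le> 0"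
      by (simp add: algebra_simps)
    moreover have "(?\<phi> has_real_derivative
        exp (K a - K t) * (0 - k t) * r t + exp (K a - K t) * ((z t \<bullet> z' t) / r t) - m t) (at t)"
      by (auto intro!: derivative_eq_intros K[OF t] M[OF t] r_deriv[OF t])
    ultimately show "\<exists>y. (?\<phi> has_real_derivative y) (at t) \<and> y \<le> 0"
      by blast
  qed
  then have "exp (K a - K b) * r b \<le> r a + M b - M a"
    by simp
  then have "exp (K b - K a) * (exp (K a - K b) * r b) \<le> exp (K b - K a) * (r a + M b - M a)"
    by simp
  moreover have "exp (K b - K a) * (exp (K a - K b) * r b) = r b"
    by (simp flip: exp_add mult.assoc)
  ultimately have "norm (z b) \<le> exp (K b - K a) * (r a + M b - M a)"
    using norm_le_r[of b] by simp
  also have "\<dots> \<le> exp (K b - K a) * ((norm (z a) + \<delta>) + M b - M a)"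
    using r_le[of a] by simp
  also have "\<dots> = exp (K b - K a) * (norm (z a) + M b - M a) + e"
    by (simp add: \<delta>_def algebra_simps)
  finally show "norm (z b) \<le> exp (K b - K a) * (norm (z a) + M b - M a) + e" .
qed

text \<open>
  The forward estimate along reversed time.  In particular a solution of a linear equation that
  vanishes at \<open>b\<close> vanishes at every earlier time.
\<close>

lemma gronwall_norm_backward:
  fixes z :: "real \<Rightarrow> 'a::real_inner"
  assumes "a \<le> b"
    and z: "\<And>t. t \<in> {a..b} \<Longrightarrow> (z has_vector_derivative z' t) (at t)"
    and K: "\<And>t. t \<in> {a..b} \<Longrightarrow> (K has_real_derivative k t) (at t)"
    and bound: "\<And>t. t \<in> {a..b} \<Longrightarrow> norm (z' t) \<le> k t * norm (z t)"
    and k0: "\<And>t. t \<in> {a..b} \<Longrightarrow> 0 \<le> k t"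
  shows "norm (z a) \<le> exp (K b - K a) * norm (z b)"
proof -
  have "norm (z (- (- a))) \<le> exp (- K (- (- a)) - (- K (- (- b)))) * (norm (z (- (- b))) + 0 - 0)"
  proof (rule gronwall_norm[where z' = "\<lambda>t. - z' (- t)" and k = "\<lambda>t. k (- t)" and M = "\<lambda>_. 0" and m = "\<lambda>_. 0"
        and z = "\<lambda>t. z (- t)" and K = "\<lambda>t. - K (- t)"])
    fix t assume "t \<in> {- b..- a}"
    then have t: "- t \<in> {a..b}" by auto
    have "((\<lambda>t. z (- t)) has_vector_derivative (- 1) *\<^sub>R z' (- t)) (at t)"
      by (rule vector_diff_chain_at[where f = uminus and g = z, unfolded o_def])
        (auto intro!: derivative_eq_intros z[OF t] simp: has_vector_derivative_minus)
    then show "((\<lambda>t. z (- t)) has_vector_derivative - z' (- t)) (at t)"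
      by simp
    have "((\<lambda>t. K (- t)) has_real_derivative k (- t) * (- 1)) (at t)"
      by (rule DERIV_chain2[where f = K and g = uminus, OF K[OF t]]) (auto intro!: derivative_eq_intros)
    from DERIV_minus[OF this] show "((\<lambda>t. - K (- t)) has_real_derivative k (- t)) (at t)"
      by simp
  qed (use assms in auto)
  then show ?thesis by simp
qed

text \<open>
  The variation-of-constants amplitude of \<open>u\<close>: the oscillation \<open>exp (\<i> N t)\<close> of the solutions of \<open>u'' = - N\<^sup>2 u\<close> is
  divided out, so its derivative only sees the deviation of \<open>u''\<close> from \<open>- N\<^sup>2 u\<close>, and \<open>u\<close> is the real part of
  \<open>exp (\<i> N t)\<close> times the amplitude.
\<close>

definition phase_amplitude :: "real \<Rightarrow> (real \<Rightarrow> real) \<Rightarrow> (real \<Rightarrow> real) \<Rightarrow> real \<Rightarrow> complex" where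
  "phase_amplitude N u u' t = cis (- N * t) * Complex (u t) (- u' t / N)"

lemma norm_phase_amplitude: "norm (phase_amplitude N u u' t) = sqrt ((u t)\<^sup>2 + (u' t / N)\<^sup>2)"
  by (simp add: phase_amplitude_def norm_mult complex_norm)

lemma abs_le_phase_amplitude: "\<bar>u t\<bar> \<le> norm (phase_amplitude N u u' t)"
  by (simp add: norm_phase_amplitude real_le_rsqrt)

lemma abs_deriv_le_phase_amplitude:
  "N > 0 \<Longrightarrow> \<bar>u' t\<bar> \<le> N * norm (phase_amplitude N u u' t)"
proof -
  assume "N > 0"
  have "\<bar>u' t / N\<bar> \<le> norm (phase_amplitude N u u' t)"
    unfolding norm_phase_amplitude by (rule real_le_rsqrt) (simp only: power2_abs, simp)
  then show ?thesis
    using \<open>N > 0\<close> by (simp add: field_simps)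
qed

lemma Re_phase_amplitude: "Re (cis (N * t) * phase_amplitude N u u' t) = u t"
  by (simp add: phase_amplitude_def cis_mult flip: mult.assoc)

lemma phase_amplitude_diff:
  "phase_amplitude N u u' t - phase_amplitude N v v' t =
    phase_amplitude N (\<lambda>t. u t - v t) (\<lambda>t. u' t - v' t) t"
  by (simp add: phase_amplitude_def complex_eq_iff algebra_simps diff_divide_distrib)

lemma phase_amplitude_has_vector_derivative:
  assumes "N > 0" and u: "(u has_real_derivative u' t) (at t)"
    and u': "(u' has_real_derivative g - N\<^sup>2 * u t) (at t)"
  shows "(phase_amplitude N u u' has_vector_derivative cis (- N * t) * Complex 0 (- g / N)) (at t)"
proof -
  have "((\<lambda>t. cos (N * t) * u t - sin (N * t) * (u' t / N)) has_real_derivative - sin (N * t) * g / N) (at t)"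
    using assms by (auto intro!: derivative_eq_intros simp: field_simps power2_eq_square)
  moreover have "((\<lambda>t. - (u t * sin (N * t)) - u' t * cos (N * t) / N) has_real_derivative - cos (N * t) * g / N) (at t)"
    using assms by (auto intro!: derivative_eq_intros simp: field_simps power2_eq_square)
  ultimately show ?thesis
    by (auto simp: has_vector_derivative_complex_iff has_real_derivative_iff_has_vector_derivative phase_amplitude_def[abs_def] algebra_simps)
qed

lemma norm_phase_amplitude_derivative:
  "N > 0 \<Longrightarrow> norm (cis (- N * t) * Complex 0 (- g / N)) = \<bar>g\<bar> / N"
  by (simp add: norm_mult complex_norm)

text \<open>
  The perturbation \<open>\<mu> / x\<^sup>2\<close> is integrable at infinity, so the amplitude stays bounded and converges; the
  tail of the integral gives the rate \<open>1 / x\<close>.  The backward estimate bounds the amplitude at \<open>x0\<close> by a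
  multiple of the limit, which is therefore nonzero for a nontrivial solution.
\<close>

lemma asymptotic_amplitude:
  fixes w w' q :: "real \<Rightarrow> real"
  assumes w: "\<And>x. x > 0 \<Longrightarrow> (w has_real_derivative w' x) (at x)"
    and w': "\<And>x. x > 0 \<Longrightarrow> (w' has_real_derivative (q x - 1) * w x) (at x)"
    and q: "\<And>x. x > 0 \<Longrightarrow> \<bar>q x\<bar> \<le> \<mu> / x\<^sup>2"
    and "x0 > 0" "w x0 \<noteq> 0"
  obtains A C where "A \<noteq> 0" "\<And>x. x \<ge> 1 \<Longrightarrow> norm (phase_amplitude 1 w w' x - A) \<le> C / x"
proof -
  let ?z = "phase_amplitude 1 w w'"
  let ?z' = "\<lambda>x. cis (- 1 * x) * Complex 0 (- (q x * w x) / 1)"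
  have "\<mu> \<ge> 0"
    using q[of 1] by simp
  have z: "(?z has_vector_derivative ?z' x) (at x)" if "x > 0" for x
    using phase_amplitude_has_vector_derivative[of 1 w w' x "q x * w x"] w[OF that] w'[OF that]
    by (simp add: algebra_simps)
  have isCont_z: "isCont ?z x" if "x > 0" for x
    by (rule has_vector_derivative_continuous[OF z[OF that]])
  have nz: "norm (?z' x) \<le> \<mu> / x\<^sup>2 * norm (?z x)" if "x > 0" for x
  proof -
    have "norm (?z' x) = \<bar>q x\<bar> * \<bar>w x\<bar>"
      by (simp add: norm_mult complex_norm abs_mult)
    also have "\<dots> \<le> \<mu> / x\<^sup>2 * norm (?z x)"
      using q[OF that] abs_le_phase_amplitude[of w x 1 w'] \<open>\<mu> \<ge> 0\<close> by (intro mult_mono) auto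
    finally show ?thesis .
  qed
  have K: "((\<lambda>x. - \<mu> / x) has_real_derivative \<mu> / x\<^sup>2) (at x)" if "x > 0" for x
    using that by (auto intro!: derivative_eq_intros simp: power2_eq_square)
  define B where "B = exp \<mu> * norm (?z 1)"
  have bounded: "norm (?z x) \<le> B" if "x \<ge> 1" for x
  proof -
    have "norm (?z x) \<le> exp ((- \<mu> / x) - (- \<mu> / 1)) * (norm (?z 1) + 0 - 0)"
      by (rule gronwall_norm[where M = "\<lambda>_. 0" and m = "\<lambda>_. 0" and z' = ?z' and k = "\<lambda>x. \<mu> / x\<^sup>2"])
        (use that K z nz \<open>\<mu> \<ge> 0\<close> in auto)
    also have "\<dots> \<le> B"
      unfolding B_def using that \<open>\<mu> \<ge> 0\<close> by (intro mult_mono) auto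
    finally show ?thesis .
  qed
  have "B \<ge> 0"
    by (simp add: B_def)
  have cauchy_rate: "norm (?z y - ?z x) \<le> \<mu> * B / x" if "1 \<le> x" "x < y" for x y
  proof -
    have "norm (?z y - ?z x) \<le> B * (- \<mu> / y) - B * (- \<mu> / x)"
    proof (rule differentiable_bound_general[where f' = ?z' and \<phi>' = "\<lambda>x. B * (\<mu> / x\<^sup>2)"])
      show "continuous_on {x..y} ?z"
        using that by (intro continuous_at_imp_continuous_on ballI isCont_z) auto
      show "continuous_on {x..y} (\<lambda>x. B * (- \<mu> / x))"
        using that by (intro continuous_intros) auto
      fix t assume t: "x < t" "t < y"
      show "(?z has_vector_derivative ?z' t) (at t)"
        by (rule z) (use t that in linarith)
      have "((\<lambda>x. B * (- \<mu> / x)) has_real_derivative B * (\<mu> / t\<^sup>2)) (at t)"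
        using t that by (intro DERIV_cmult K) auto
      then show "((\<lambda>x. B * (- \<mu> / x)) has_vector_derivative B * (\<mu> / t\<^sup>2)) (at t)"
        by (simp add: has_real_derivative_iff_has_vector_derivative)
      have "norm (?z' t) \<le> \<mu> / t\<^sup>2 * norm (?z t)"
        by (rule nz) (use t that in linarith)
      also have "\<dots> \<le> \<mu> / t\<^sup>2 * B"
        using bounded[of t] t that \<open>\<mu> \<ge> 0\<close> by (intro mult_left_mono) auto
      finally show "norm (?z' t) \<le> B * (\<mu> / t\<^sup>2)"
        by (simp add: mult.commute)
    qed (use that in auto)
    also have "\<dots> \<le> \<mu> * B / x"
      using that \<open>\<mu> \<ge> 0\<close> \<open>B \<ge> 0\<close> by (simp add: mult.commute)
    finally show ?thesis .
  qed
  have "Cauchy (\<lambda>n. ?z (real (Suc n)))"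
  proof (rule CauchyI')
    fix e :: real assume "e > 0"
    obtain n0 :: nat where n0: "\<mu> * B / e < n0"
      using reals_Archimedean2 by blast
    have "norm (?z (real (Suc n)) - ?z (real (Suc m))) < e" if "m \<ge> n0" "m < n" for m n
    proof -
      have "norm (?z (real (Suc n)) - ?z (real (Suc m))) \<le> \<mu> * B / real (Suc m)"
        using that by (intro cauchy_rate) auto
      also have "\<dots> < e"
      proof -
        have "\<mu> * B / e < real (Suc m)"
          using n0 that by linarith
        then show ?thesis
          using \<open>e > 0\<close> by (simp add: field_simps)
      qed
      finally show ?thesis .
    qed
    then show "\<exists>M. \<forall>m\<ge>M. \<forall>n>m. dist (?z (real (Suc m))) (?z (real (Suc n))) < e"
      by (metis dist_norm dist_commute)
  qed
  then obtain A where A: "(\<lambda>n. ?z (real (Suc n))) \<longlonglongrightarrow> A"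
    using Cauchy_convergent convergent_def by blast
  have evt: "eventually (\<lambda>n. x < real (Suc n)) sequentially" for x
    by real_asymp
  have rate: "norm (?z x - A) \<le> \<mu> * B / x" if "x \<ge> 1" for x
  proof (rule tendsto_upperbound)
    show "(\<lambda>n. norm (?z x - ?z (real (Suc n)))) \<longlonglongrightarrow> norm (?z x - A)"
      by (intro tendsto_intros A)
    show "eventually (\<lambda>n. norm (?z x - ?z (real (Suc n))) \<le> \<mu> * B / x) sequentially"
      using evt[of x] by eventually_elim (use cauchy_rate that in \<open>auto simp: norm_minus_commute\<close>)
  qed simp
  have "norm (?z x0) \<le> exp (\<mu> / x0) * norm A"
  proof (rule tendsto_lowerbound)
    show "(\<lambda>n. exp (\<mu> / x0) * norm (?z (real (Suc n)))) \<longlonglongrightarrow> exp (\<mu> / x0) * norm A"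
      by (intro tendsto_intros A)
    show "eventually (\<lambda>n. norm (?z x0) \<le> exp (\<mu> / x0) * norm (?z (real (Suc n)))) sequentially"
      using evt[of x0]
    proof eventually_elim
      case (elim n)
      have "norm (?z x0) \<le> exp (- \<mu> / real (Suc n) - (- \<mu> / x0)) * norm (?z (real (Suc n)))"
        by (rule gronwall_norm_backward[where k = "\<lambda>x. \<mu> / x\<^sup>2" and z' = ?z'])
          (use elim K z nz \<open>x0 > 0\<close> \<open>\<mu> \<ge> 0\<close> in auto)
      also have "\<dots> \<le> exp (\<mu> / x0) * norm (?z (real (Suc n)))"
        using \<open>\<mu> \<ge> 0\<close> by (intro mult_right_mono) auto
      finally show ?case .
    qed
  qed simp
  moreover have "norm (?z x0) > 0"
    using abs_le_phase_amplitude[of w x0 1 w'] \<open>w x0 \<noteq> 0\<close> by linarith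
  ultimately have "A \<noteq> 0"
    by auto
  with rate show thesis
    using that by blast
qed

section \<open>Comparison with an inverse square potential\<close>

lemma sin_ge_linear:
  fixes b :: real
  assumes "0 < b" "b < pi"
  obtains c where "c > 0" "\<And>x. 0 < x \<Longrightarrow> x \<le> b \<Longrightarrow> c * x \<le> sin x"
proof -
  define c where "c = min (1/2) (min (sin 1) (sin b) / b)"
  have "sin 1 > (0::real)" "sin b > 0"
    using assms pi_gt3 by (auto intro!: sin_gt_zero)
  then have "c > 0"
    using assms by (simp add: c_def)
  moreover have "c * x \<le> sin x" if x: "0 < x" "x \<le> b" for x
  proof (cases "x \<le> 1")
    case True
    have "\<bar>sin x - (\<Sum>m<3. sin_coeff m * x ^ m)\<bar> \<le> inverse (fact 3) * \<bar>x\<bar> ^ 3"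
      by (rule Maclaurin_sin_bound)
    then have "\<bar>sin x - x\<bar> \<le> x ^ 3 / 6"
      using x by (simp add: sin_coeff_def eval_nat_numeral fact_reduce)
    then have "x - sin x \<le> x ^ 3 / 6"
      by linarith
    moreover have "x ^ 3 \<le> x"
      using x True power_decreasing[of 1 3 x] by simp
    moreover have "c * x \<le> 1/2 * x"
      using x unfolding c_def by (intro mult_right_mono min.cobounded1) auto
    ultimately show ?thesis
      using x by linarith
  next
    case False
    have "min (sin 1) (sin b) \<le> sin x"
    proof (cases "x \<le> pi/2")
      case True
      then have "sin 1 \<le> sin x"
        using False by (intro sin_monotone_2pi_le) auto
      then show ?thesis by simp
    next
      case h: False
      have "sin (pi - b) \<le> sin (pi - x)"
        using h x assms by (intro sin_monotone_2pi_le) auto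
      then show ?thesis by simp
    qed
    moreover have "c * x \<le> (min (sin 1) (sin b) / b) * b"
      using x assms \<open>sin 1 > 0\<close> \<open>sin b > 0\<close> \<open>c > 0\<close> by (intro mult_mono) (auto simp: c_def)
    moreover have "(min (sin 1) (sin b) / b) * b = min (sin 1) (sin b)"
      using assms by simp
    ultimately show ?thesis
      by linarith
  qed
  ultimately show thesis
    using that by blast
qed

text \<open>
  As \<open>sin x = x + O(x\<^sup>3)\<close>, the singularities of \<open>1 / sin\<^sup>2 x\<close> and \<open>1 / x\<^sup>2\<close> at \<open>0\<close> cancel.  This is what makes
  Bessel's equation an adequate model up to the singular end point.
\<close>

lemma inverse_sin_squared_bounds:
  fixes b :: real
  assumes "0 < b" "b < pi"
  obtains C where "C \<ge> 0" "\<And>x. 0 < x \<Longrightarrow> x \<le> b \<Longrightarrow> 1 / (sin x)\<^sup>2 \<le> C / x\<^sup>2"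
    "\<And>x. 0 < x \<Longrightarrow> x \<le> b \<Longrightarrow> \<bar>1 / (sin x)\<^sup>2 - 1 / x\<^sup>2\<bar> \<le> C"
proof -
  obtain c where c: "c > 0" "\<And>x. 0 < x \<Longrightarrow> x \<le> b \<Longrightarrow> c * x \<le> sin x"
    using sin_ge_linear[OF assms] by blast
  have "1 / (sin x)\<^sup>2 \<le> (1 / c\<^sup>2) / x\<^sup>2" "\<bar>1 / (sin x)\<^sup>2 - 1 / x\<^sup>2\<bar> \<le> 1 / c\<^sup>2"
    if x: "0 < x" "x \<le> b" for x
  proof -
    have s: "0 < c * x" "c * x \<le> sin x"
      using c x by auto
    then have sq: "(c * x)\<^sup>2 \<le> (sin x)\<^sup>2"
      by (intro power_mono) auto
    then show "1 / (sin x)\<^sup>2 \<le> (1 / c\<^sup>2) / x\<^sup>2"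
      using c(1) x frac_le[of 1 1 "(c * x)\<^sup>2" "(sin x)\<^sup>2"] by (simp add: power_mult_distrib)
    have le: "sin x \<le> x"
      using x by (simp add: sin_x_le_x)
    have "\<bar>sin x - (\<Sum>m<3. sin_coeff m * x ^ m)\<bar> \<le> inverse (fact 3) * \<bar>x\<bar> ^ 3"
      by (rule Maclaurin_sin_bound)
    then have "\<bar>sin x - x\<bar> \<le> x ^ 3 / 6"
      using x by (simp add: sin_coeff_def eval_nat_numeral fact_reduce)
    then have "x - sin x \<le> x ^ 3 / 6"
      by linarith
    then have "(x - sin x) * (x + sin x) \<le> (x ^ 3 / 6) * (2 * x)"
      using le x s by (intro mult_mono) auto
    also have "\<dots> \<le> x\<^sup>2 * x\<^sup>2"
      using x by (simp add: eval_nat_numeral)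
    finally have num: "x\<^sup>2 - (sin x)\<^sup>2 \<le> x\<^sup>2 * x\<^sup>2"
      by (simp add: power2_eq_square algebra_simps)
    have "1 / (sin x)\<^sup>2 - 1 / x\<^sup>2 = (x\<^sup>2 - (sin x)\<^sup>2) / ((sin x)\<^sup>2 * x\<^sup>2)"
      using s x by (simp add: field_simps)
    also have "\<dots> \<le> (x\<^sup>2 * x\<^sup>2) / ((c * x)\<^sup>2 * x\<^sup>2)"
      using num sq s x by (intro frac_le mult_right_mono mult_pos_pos) (auto simp: power2_eq_square)
    also have "\<dots> = 1 / c\<^sup>2"
      using x c(1) by (simp add: power_mult_distrib field_simps)
    finally have "1 / (sin x)\<^sup>2 - 1 / x\<^sup>2 \<le> 1 / c\<^sup>2" .
    moreover have "1 / x\<^sup>2 \<le> 1 / (sin x)\<^sup>2"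
      using le s x by (intro frac_le power_mono) auto
    ultimately show "\<bar>1 / (sin x)\<^sup>2 - 1 / x\<^sup>2\<bar> \<le> 1 / c\<^sup>2"
      by simp
  qed
  then show thesis
    using that[of "1 / c\<^sup>2"] by simp
qed

lemma phase_amplitude_scaled:
  assumes "N > 0"
  shows "phase_amplitude N (\<lambda>t. w (N * t)) (\<lambda>t. N * w' (N * t)) t = phase_amplitude 1 w w' (N * t)"
  using assms by (simp add: phase_amplitude_def)

text \<open>
  The difference of the two amplitudes is driven by itself, with the weight \<open>1 / (N x\<^sup>2)\<close>, and by the
  bounded difference of the potentials, with the weight \<open>1 / N\<close>.  The first weight has an integral over
  \<open>1 / N \<le> x \<le> b\<close> that is bounded independently of \<open>N\<close>.  It would diverge from \<open>0\<close> on, which is why the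
  comparison starts at \<open>1 / N\<close>, where the Bessel variable \<open>N x\<close> equals \<open>1\<close>.
\<close>

lemma amplitude_comparison:
  fixes U U' w w' :: "real \<Rightarrow> real"
  assumes b: "0 < b" "b < pi" and "N > 0" and Nb: "1 \<le> N * b" and t: "1 \<le> N * t" "t \<le> b"
    and C1: "\<And>x. 0 < x \<Longrightarrow> x \<le> b \<Longrightarrow> 1 / (sin x)\<^sup>2 \<le> C1 / x\<^sup>2"
      "\<And>x. 0 < x \<Longrightarrow> x \<le> b \<Longrightarrow> \<bar>1 / (sin x)\<^sup>2 - 1 / x\<^sup>2\<bar> \<le> C1" "C1 \<ge> 0"
    and w: "\<And>x. x > 0 \<Longrightarrow> (w has_real_derivative w' x) (at x)"
    and w': "\<And>x. x > 0 \<Longrightarrow> (w' has_real_derivative (\<mu> / x\<^sup>2 - 1) * w x) (at x)"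
    and wC: "\<And>x. x \<ge> 1 \<Longrightarrow> \<bar>w x\<bar> \<le> Cw" "Cw \<ge> 0"
    and U: "\<And>x. 0 < x \<Longrightarrow> x < pi \<Longrightarrow> (U has_real_derivative U' x) (at x)"
    and U': "\<And>x. 0 < x \<Longrightarrow> x < pi \<Longrightarrow> (U' has_real_derivative (\<mu> / (sin x)\<^sup>2 - N\<^sup>2) * U x) (at x)"
  shows "norm (phase_amplitude N U U' t - phase_amplitude 1 w w' (N * t))
    \<le> exp (\<bar>\<mu>\<bar> * C1) * (norm (phase_amplitude N U U' (1 / N) - phase_amplitude 1 w w' 1) + \<bar>\<mu>\<bar> * C1 * Cw * b / N)"
proof -
  let ?W = "\<lambda>t. w (N * t)" and ?W' = "\<lambda>t. N * w' (N * t)"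
  let ?z = "phase_amplitude N (\<lambda>t. U t - ?W t) (\<lambda>t. U' t - ?W' t)"
  let ?g = "\<lambda>t. \<mu> / (sin t)\<^sup>2 * U t - \<mu> / t\<^sup>2 * ?W t"
  let ?z' = "\<lambda>t. cis (- N * t) * Complex 0 (- ?g t / N)"
  let ?K = "\<lambda>t. - \<bar>\<mu>\<bar> * C1 / (N * t)" and ?k = "\<lambda>t. \<bar>\<mu>\<bar> * C1 / (N * t\<^sup>2)"
  let ?m = "\<bar>\<mu>\<bar> * C1 * Cw / N"
  have eq: "?z t = phase_amplitude N U U' t - phase_amplitude 1 w w' (N * t)" for t
    using phase_amplitude_diff[of N U U' t ?W ?W'] phase_amplitude_scaled[OF \<open>N > 0\<close>, of w w' t] by simp
  have range: "0 < x" "x < pi" "x \<le> b" "1 \<le> N * x" if "x \<in> {1 / N..t}" for x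
    using that t b \<open>N > 0\<close> by (auto simp: field_simps intro: less_le_trans[of 0 "1 / N"])
  have "norm (?z t) \<le> exp (?K t - ?K (1 / N)) * (norm (?z (1 / N)) + ?m * t - ?m * (1 / N))"
  proof (rule gronwall_norm[where z' = ?z' and k = ?k and m = "\<lambda>_. ?m" and K = ?K])
    show "1 / N \<le> t"
      using t \<open>N > 0\<close> by (simp add: field_simps)
    fix x assume x: "x \<in> {1 / N..t}"
    note r = range[OF x]
    have Nx: "N * x > 0" using r \<open>N > 0\<close> by simp
    have lin: "((\<lambda>t. N * t) has_real_derivative N) (at x)"
      by (auto intro!: derivative_eq_intros)
    have dW: "(?W has_real_derivative ?W' x) (at x)"
      using DERIV_chain2[where f = w, OF w[OF Nx] lin] by (simp add: mult.commute)
    have dW': "(?W' has_real_derivative (\<mu> / x\<^sup>2 - N\<^sup>2) * ?W x) (at x)"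
    proof -
      have "((\<lambda>t. w' (N * t)) has_real_derivative ((\<mu> / (N * x)\<^sup>2 - 1) * w (N * x)) * N) (at x)"
        using DERIV_chain2[where f = w', OF w'[OF Nx] lin] by simp
      from DERIV_cmult[OF this, of N] show ?thesis
        using r \<open>N > 0\<close> by (elim DERIV_cong) (simp add: field_simps power2_eq_square)
    qed
    show "(?z has_vector_derivative ?z' x) (at x)"
    proof (rule phase_amplitude_has_vector_derivative[OF \<open>N > 0\<close>])
      show "((\<lambda>t. U t - ?W t) has_real_derivative U' x - ?W' x) (at x)"
        using U[OF r(1,2)] dW by (rule DERIV_diff)
      show "((\<lambda>t. U' t - ?W' t) has_real_derivative ?g x - N\<^sup>2 * (U x - ?W x)) (at x)"
        using DERIV_diff[OF U'[OF r(1,2)] dW'] by (simp add: algebra_simps)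
    qed
    show "(?K has_real_derivative ?k x) (at x)"
      using r \<open>N > 0\<close> by (auto intro!: derivative_eq_intros simp: power2_eq_square field_simps)
    show "((\<lambda>t. ?m * t) has_real_derivative ?m) (at x)"
      by (rule DERIV_cmult_Id)
    show "0 \<le> ?k x" "0 \<le> ?m"
      using C1 wC \<open>N > 0\<close> by auto
    have "?g x = \<mu> * (1 / (sin x)\<^sup>2 * (U x - ?W x) + (1 / (sin x)\<^sup>2 - 1 / x\<^sup>2) * ?W x)"
      by (simp add: algebra_simps add_divide_distrib diff_divide_distrib)
    then have "\<bar>?g x\<bar> = \<bar>\<mu>\<bar> * \<bar>1 / (sin x)\<^sup>2 * (U x - ?W x) + (1 / (sin x)\<^sup>2 - 1 / x\<^sup>2) * ?W x\<bar>"
      by (simp only: abs_mult)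
    also have "\<dots> \<le> \<bar>\<mu>\<bar> * (C1 / x\<^sup>2 * norm (?z x) + C1 * Cw)"
    proof (intro mult_left_mono order_trans[OF abs_triangle_ineq] add_mono)
      show "\<bar>1 / (sin x)\<^sup>2 * (U x - ?W x)\<bar> \<le> C1 / x\<^sup>2 * norm (?z x)"
        unfolding abs_mult using C1 r abs_le_phase_amplitude[of "\<lambda>t. U t - ?W t" x]
        by (intro mult_mono) auto
      show "\<bar>(1 / (sin x)\<^sup>2 - 1 / x\<^sup>2) * ?W x\<bar> \<le> C1 * Cw"
        unfolding abs_mult using C1 r wC by (intro mult_mono) auto
    qed auto
    finally have "\<bar>?g x\<bar> / N \<le> (\<bar>\<mu>\<bar> * (C1 / x\<^sup>2 * norm (?z x) + C1 * Cw)) / N"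
      using \<open>N > 0\<close> by (simp add: divide_right_mono)
    also have "\<dots> = ?k x * norm (?z x) + ?m"
      using \<open>N > 0\<close> r by (simp add: field_simps)
    finally show "norm (?z' x) \<le> ?k x * norm (?z x) + ?m"
      by (simp only: norm_phase_amplitude_derivative[OF \<open>N > 0\<close>])
  qed
  also have "\<dots> \<le> exp (\<bar>\<mu>\<bar> * C1) * (norm (?z (1 / N)) + ?m * b)"
  proof (rule mult_mono)
    have "0 \<le> \<bar>\<mu>\<bar> * C1 / (N * t)"
      using t C1 by simp
    then show "exp (?K t - ?K (1 / N)) \<le> exp (\<bar>\<mu>\<bar> * C1)"
      using \<open>N > 0\<close> by simp
    have m0: "?m \<ge> 0"
      using C1 wC \<open>N > 0\<close> by auto
    have "0 \<le> ?m * (1 / N)"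
      by (rule mult_nonneg_nonneg[OF m0]) (use \<open>N > 0\<close> in simp)
    moreover have "?m * t \<le> ?m * b"
      by (rule mult_left_mono[OF t(2) m0])
    ultimately show "norm (?z (1 / N)) + ?m * t - ?m * (1 / N) \<le> norm (?z (1 / N)) + ?m * b"
      by linarith
    have "?m * (1 / N) \<le> ?m * t"
      by (rule mult_left_mono[OF _ m0]) (use t \<open>N > 0\<close> in \<open>simp add: field_simps\<close>)
    then show "0 \<le> norm (?z (1 / N)) + ?m * t - ?m * (1 / N)"
      by (smt (verit) norm_ge_zero)
  qed auto
  finally show ?thesis
    using \<open>N > 0\<close> by (simp add: eq)
qed

section \<open>The hypergeometric series and its Bessel limit\<close>

text \<open>
  The ratio is given by a recursion and not as a quotient, so that terminating series are included.
\<close>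

lemma summable_ratio_limit:
  fixes f R :: "nat \<Rightarrow> real"
  assumes rec: "\<And>k. f (Suc k) = R k * f k" and lim: "R \<longlonglongrightarrow> L" and "\<bar>L\<bar> * \<bar>r\<bar> < 1"
  shows "summable (\<lambda>k. f k * r ^ k)"
proof -
  obtain q where q: "\<bar>L\<bar> * \<bar>r\<bar> < q" "q < 1"
    using assms(3) dense by blast
  have "(\<lambda>k. \<bar>R k\<bar> * \<bar>r\<bar>) \<longlonglongrightarrow> \<bar>L\<bar> * \<bar>r\<bar>"
    by (intro tendsto_intros lim)
  then have "eventually (\<lambda>k. \<bar>R k\<bar> * \<bar>r\<bar> < q) sequentially"
    using q by (simp add: order_tendstoD)
  then obtain K where K: "\<And>k. k \<ge> K \<Longrightarrow> \<bar>R k\<bar> * \<bar>r\<bar> < q"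
    by (auto simp: eventually_sequentially)
  show ?thesis
  proof (rule summable_ratio_test[OF q(2)])
    fix k assume "K \<le> k"
    have "norm (f (Suc k) * r ^ Suc k) = (\<bar>R k\<bar> * \<bar>r\<bar>) * norm (f k * r ^ k)"
      by (simp add: rec abs_mult)
    also have "\<dots> \<le> q * norm (f k * r ^ k)"
      using K[OF \<open>K \<le> k\<close>] by (intro mult_right_mono) auto
    finally show "norm (f (Suc k) * r ^ Suc k) \<le> q * norm (f k * r ^ k)" .
  qed
qed

lemma fps_conv_radius_ratio_limit:
  fixes F :: "real fps"
  assumes rec: "\<And>k. fps_nth F (Suc k) = R k * fps_nth F k" and lim: "R \<longlonglongrightarrow> L"
    and r: "\<And>r. r > 0 \<Longrightarrow> ereal r < \<rho> \<Longrightarrow> \<bar>L\<bar> * r < 1"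
  shows "fps_conv_radius F \<ge> \<rho>"
  unfolding fps_conv_radius_def
proof (rule conv_radius_geI_ex)
  fix s :: real assume "0 < s" "ereal s < \<rho>"
  then have "summable (\<lambda>k. fps_nth F k * s ^ k)"
    using r by (intro summable_ratio_limit[of "fps_nth F" R, OF rec lim]) auto
  then show "\<exists>z. norm z = s \<and> summable (\<lambda>n. fps_nth F n * z ^ n)"
    using \<open>0 < s\<close> by (intro exI[of _ s]) auto
qed

text \<open>
  At \<open>z = sin\<^sup>2 (t / 2)\<close> this is, up to elementary factors, the associated Legendre function of degree
  \<open>N - 1/2\<close> and order \<open>1 - c\<close> at \<open>cos t\<close>.
\<close>

definition legendre_fps :: "real \<Rightarrow> real \<Rightarrow> real fps" where
  "legendre_fps c N = fps_hypergeo [1/2 + N, 1/2 - N] [c] 1"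

text \<open>
  At \<open>x\<^sup>2 / 4\<close> this is the Bessel function of order \<open>c - 1\<close> at \<open>x\<close>, up to a power of \<open>x\<close> and a constant.
\<close>

definition bessel_fps :: "real \<Rightarrow> real fps" where
  "bessel_fps c = fps_hypergeo [] [c] (- 1)"

lemma legendre_fps_0: "fps_nth (legendre_fps c N) 0 = 1"
  by (simp add: legendre_fps_def)

lemma bessel_fps_0: "fps_nth (bessel_fps c) 0 = 1"
  by (simp add: bessel_fps_def)

lemma legendre_fps_Suc:
  "fps_nth (legendre_fps c N) (Suc k) =
    ((real k + 1/2)\<^sup>2 - N\<^sup>2) / ((real k + 1) * (c + real k)) * fps_nth (legendre_fps c N) k"
proof -
  have "(1/2 + N + real k) * (1/2 - N + real k) = (real k + 1/2)\<^sup>2 - N\<^sup>2"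
    by (simp add: power2_eq_square algebra_simps)
  then show ?thesis
    unfolding legendre_fps_def fps_hypergeo_rec
    by (simp del: fps_hypergeo_nth)
qed

lemma bessel_fps_Suc:
  "fps_nth (bessel_fps c) (Suc k) = - 1 / ((real k + 1) * (c + real k)) * fps_nth (bessel_fps c) k"
  unfolding bessel_fps_def fps_hypergeo_rec by (simp add: algebra_simps del: fps_hypergeo_nth)

lemma fps_conv_radius_legendre: "fps_conv_radius (legendre_fps c N) \<ge> 1"
proof (rule fps_conv_radius_ratio_limit[OF legendre_fps_Suc])
  show "(\<lambda>k. ((real k + 1/2)\<^sup>2 - N\<^sup>2) / ((real k + 1) * (c + real k))) \<longlonglongrightarrow> 1"
    by real_asymp
qed simp

lemma fps_conv_radius_bessel: "fps_conv_radius (bessel_fps c) = \<infinity>"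
proof -
  have "fps_conv_radius (bessel_fps c) \<ge> \<infinity>"
  proof (rule fps_conv_radius_ratio_limit[OF bessel_fps_Suc])
    show "(\<lambda>k. - 1 / ((real k + 1) * (c + real k))) \<longlonglongrightarrow> 0"
      by real_asymp
  qed simp
  then show ?thesis by simp
qed

lemma legendre_conv_radius_less:
  fixes z :: real
  assumes "\<bar>z\<bar> < 1"
  shows "norm z < fps_conv_radius (legendre_fps c N)"
    "norm z < fps_conv_radius (fps_deriv (legendre_fps c N))"
    "norm z < fps_conv_radius (fps_deriv (fps_deriv (legendre_fps c N)))"
proof -
  have 1: "norm z < (1::ereal)"
    using assms by (simp add: one_ereal_def)
  then show a: "norm z < fps_conv_radius (legendre_fps c N)"
    using fps_conv_radius_legendre less_le_trans by blast
  then show b: "norm z < fps_conv_radius (fps_deriv (legendre_fps c N))"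
    using fps_conv_radius_deriv less_le_trans by blast
  then show "norm z < fps_conv_radius (fps_deriv (fps_deriv (legendre_fps c N)))"
    using fps_conv_radius_deriv less_le_trans by blast
qed

lemma bessel_conv_radius_less:
  fixes z :: real
  shows "norm z < fps_conv_radius (bessel_fps c)"
    "norm z < fps_conv_radius (fps_deriv (bessel_fps c))"
    "norm z < fps_conv_radius (fps_deriv (fps_deriv (bessel_fps c)))"
proof -
  show a: "norm z < fps_conv_radius (bessel_fps c)"
    by (simp add: fps_conv_radius_bessel)
  then show b: "norm z < fps_conv_radius (fps_deriv (bessel_fps c))"
    using fps_conv_radius_deriv less_le_trans by blast
  then show "norm z < fps_conv_radius (fps_deriv (fps_deriv (bessel_fps c)))"
    using fps_conv_radius_deriv less_le_trans by blast
qed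

lemma legendre_fps_ode:
  assumes c: "\<And>k::nat. c + real k \<noteq> 0"
  shows "fps_X * fps_deriv (fps_deriv (legendre_fps c N)) + fps_const c * fps_deriv (legendre_fps c N) =
    fps_X * (fps_X * fps_deriv (fps_deriv (legendre_fps c N))) + fps_const 2 * (fps_X * fps_deriv (legendre_fps c N))
    + fps_const (1/4 - N\<^sup>2) * legendre_fps c N"
    (is "?L = ?R")
proof (rule fps_ext)
  fix k
  let ?f = "\<lambda>k. fps_nth (legendre_fps c N) k"
  have L: "fps_nth ?L k = (real k + 1) * (c + real k) * ?f (Suc k)"
    by (cases k) (auto simp: algebra_simps)
  have R: "fps_nth ?R k = ((real k + 1/2)\<^sup>2 - N\<^sup>2) * ?f k"
    by (cases k rule: nat.exhaust; cases "k - 1") (auto simp: algebra_simps power2_eq_square)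
  show "fps_nth ?L k = fps_nth ?R k"
    unfolding L R legendre_fps_Suc using c[of k] by (simp add: divide_simps)
qed

lemma bessel_fps_ode:
  assumes c: "\<And>k::nat. c + real k \<noteq> 0"
  shows "fps_X * fps_deriv (fps_deriv (bessel_fps c)) + fps_const c * fps_deriv (bessel_fps c) + bessel_fps c = 0"
    (is "?L = 0")
proof (rule fps_ext)
  fix k
  have L: "fps_nth ?L k = (real k + 1) * (c + real k) * fps_nth (bessel_fps c) (Suc k) + fps_nth (bessel_fps c) k"
    by (cases k) (auto simp: algebra_simps)
  show "fps_nth ?L k = fps_nth 0 k"
    unfolding L bessel_fps_Suc using c[of k] by (simp add: divide_simps)
qed

lemma eval_fps_X_mult:
  "norm z < fps_conv_radius f \<Longrightarrow> eval_fps (fps_X * f) z = z * eval_fps f z" for z :: real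
  by (subst eval_fps_mult) auto

lemma eval_fps_const_mult:
  "norm z < fps_conv_radius f \<Longrightarrow> eval_fps (fps_const a * f) z = a * eval_fps f z" for z :: real
  by (subst eval_fps_mult) auto

lemma less_fps_conv_radius_mult:
  fixes z :: real and f g :: "real fps"
  shows "\<lbrakk>norm z < fps_conv_radius f; norm z < fps_conv_radius g\<rbrakk> \<Longrightarrow> norm z < fps_conv_radius (f * g)"
  using fps_conv_radius_mult[of f g] by (metis less_le_trans min_less_iff_conj)

lemma less_fps_conv_radius_add:
  fixes z :: real and f g :: "real fps"
  shows "\<lbrakk>norm z < fps_conv_radius f; norm z < fps_conv_radius g\<rbrakk> \<Longrightarrow> norm z < fps_conv_radius (f + g)"
  using fps_conv_radius_add[of f g] by (metis less_le_trans min_less_iff_conj)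

lemma legendre_ode:
  fixes c N z :: real
  assumes c: "\<And>k::nat. c + real k \<noteq> 0" and z: "\<bar>z\<bar> < 1"
  defines "F \<equiv> legendre_fps c N"
  shows "z * (1 - z) * eval_fps (fps_deriv (fps_deriv F)) z + (c - 2 * z) * eval_fps (fps_deriv F) z
    = (1/4 - N\<^sup>2) * eval_fps F z"
proof -
  note conv = legendre_conv_radius_less[OF z, of c N, folded F_def]
  have cr: "ereal (norm z) < fps_conv_radius fps_X" "\<And>a. ereal (norm z) < fps_conv_radius (fps_const a)"
    by simp_all
  have "eval_fps (fps_X * fps_deriv (fps_deriv F) + fps_const c * fps_deriv F) z =
      eval_fps (fps_X * (fps_X * fps_deriv (fps_deriv F)) + fps_const 2 * (fps_X * fps_deriv F)
      + fps_const (1/4 - N\<^sup>2) * F) z"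
    unfolding F_def by (rule arg_cong[where f = "\<lambda>f. eval_fps f z", OF legendre_fps_ode[OF c]])
  then show ?thesis
    by (simp only: eval_fps_add eval_fps_X_mult eval_fps_const_mult less_fps_conv_radius_mult
        less_fps_conv_radius_add conv cr) (simp add: algebra_simps)
qed

lemma bessel_ode:
  fixes c z :: real
  assumes c: "\<And>k::nat. c + real k \<noteq> 0"
  defines "F \<equiv> bessel_fps c"
  shows "z * eval_fps (fps_deriv (fps_deriv F)) z + c * eval_fps (fps_deriv F) z + eval_fps F z = 0"
proof -
  note conv = bessel_conv_radius_less[of z c, folded F_def]
  have cr: "ereal (norm z) < fps_conv_radius fps_X" "\<And>a. ereal (norm z) < fps_conv_radius (fps_const a)"
    by simp_all
  have "eval_fps (fps_X * fps_deriv (fps_deriv F) + fps_const c * fps_deriv F + F) z = eval_fps 0 z"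
    unfolding F_def by (rule arg_cong[where f = "\<lambda>f. eval_fps f z", OF bessel_fps_ode[OF c]])
  then show ?thesis
    by (simp only: eval_fps_add eval_fps_X_mult eval_fps_const_mult less_fps_conv_radius_mult
        less_fps_conv_radius_add conv cr eval_fps_0)
qed

text \<open>
  Every term of the expanded first product except \<open>1\<close> carries a power of \<open>e \<le> 1\<close>.  With \<open>e = 1 / N\<^sup>2\<close> this separates \<open>N\<close>
  from the rest and yields a majorant that serves all \<open>N\<close>.
\<close>

lemma abs_prod_one_minus_le:
  fixes v :: "nat \<Rightarrow> real"
  assumes v: "\<And>i. v i \<ge> 0" and e: "0 \<le> e" "e \<le> 1"
  shows "\<bar>(\<Prod>i<k. 1 - e * v i) - 1\<bar> \<le> e * ((\<Prod>i<k. 1 + v i) - 1)"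
proof (induction k)
  case (Suc k)
  let ?p = "\<Prod>i<k. 1 - e * v i" and ?P = "\<Prod>i<k. 1 + v i"
  have P1: "?P \<ge> 1"
    using v by (intro prod_ge_1) auto
  have "\<bar>?p\<bar> \<le> 1 + e * (?P - 1)"
    using Suc.IH by linarith
  also have "\<dots> \<le> 1 + 1 * (?P - 1)"
    using P1 e by (intro add_left_mono mult_right_mono) auto
  finally have "e * v k * \<bar>?p\<bar> \<le> e * v k * ?P"
    using v e by (intro mult_left_mono) auto
  moreover have "\<bar>?p * (1 - e * v k) - 1\<bar> \<le> \<bar>?p - 1\<bar> + e * v k * \<bar>?p\<bar>"
  proof -
    have "?p * (1 - e * v k) - 1 = (?p - 1) - e * v k * ?p"
      by (simp add: algebra_simps)
    then show ?thesis
      using abs_triangle_ineq4[of "?p - 1" "e * v k * ?p"] v[of k] e by (simp add: abs_mult)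
  qed
  ultimately have "\<bar>?p * (1 - e * v k) - 1\<bar> \<le> e * (?P - 1) + e * v k * ?P"
    using Suc.IH by linarith
  then show ?case
    by (simp add: algebra_simps)
qed simp

text \<open>
  Both factors \<open>k + 1/2 \<plusminus> N\<close> combine to \<open>(k + 1/2)\<^sup>2 - N\<^sup>2\<close>; for fixed \<open>k\<close> and large \<open>N\<close> this is \<open>- N\<^sup>2\<close>, and the
  series in \<open>z\<close> turns into the Bessel series in \<open>N\<^sup>2 z\<close>.
\<close>

lemma legendre_fps_eq_bessel_fps:
  assumes "N \<noteq> 0"
  shows "fps_nth (legendre_fps c N) k =
    N ^ (2 * k) * (\<Prod>i<k. 1 - 1 / N\<^sup>2 * (real i + 1/2)\<^sup>2) * fps_nth (bessel_fps c) k"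
proof (induction k)
  case 0
  then show ?case by (simp add: legendre_fps_0 bessel_fps_0)
next
  case (Suc k)
  have "(real k + 1/2)\<^sup>2 - N\<^sup>2 = - (N\<^sup>2 * (1 - 1 / N\<^sup>2 * (real k + 1/2)\<^sup>2))"
    using assms by (simp add: algebra_simps)
  then show ?case
    unfolding legendre_fps_Suc bessel_fps_Suc Suc.IH
    by (simp add: power_add power2_eq_square mult_ac)
qed

text \<open>
  These dominate \<open>N\<^sup>2\<close> times the differences between the coefficients of the rescaled Legendre series and
  the Bessel series, for every \<open>N \<ge> 1\<close>.
\<close>

definition bessel_majorant :: "real \<Rightarrow> nat \<Rightarrow> real" where
  "bessel_majorant c k = (\<Prod>i<k. 1 + (real i + 1/2)\<^sup>2) * \<bar>fps_nth (bessel_fps c) k\<bar>"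

lemma bessel_majorant_nonneg: "bessel_majorant c k \<ge> 0"
  unfolding bessel_majorant_def by (intro mult_nonneg_nonneg prod_nonneg) auto

lemma bessel_majorant_Suc:
  "bessel_majorant c (Suc k) = (1 + (real k + 1/2)\<^sup>2) / ((real k + 1) * \<bar>c + real k\<bar>) * bessel_majorant c k"
  unfolding bessel_majorant_def bessel_fps_Suc by (simp add: abs_mult)

lemma summable_bessel_majorant: "summable (\<lambda>k. bessel_majorant c k * (1/3) ^ k)"
proof (rule summable_ratio_limit[where f = "bessel_majorant c", OF bessel_majorant_Suc])
  show "(\<lambda>k. (1 + (real k + 1/2)\<^sup>2) / ((real k + 1) * \<bar>c + real k\<bar>)) \<longlonglongrightarrow> 1"
    by real_asymp
qed simp

lemma summable_bessel_majorant_deriv: "summable (\<lambda>k. (real k + 1) * bessel_majorant c (Suc k) * (1/3) ^ k)"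
proof (rule summable_ratio_limit[where f = "\<lambda>k. (real k + 1) * bessel_majorant c (Suc k)"])
  have "q * (x * m) = (q / p * x) * (p * m)" if "p \<noteq> 0" for p q x m :: real
    using that by simp
  then show "(real (Suc k) + 1) * bessel_majorant c (Suc (Suc k)) =
      ((real (Suc k) + 1) / (real k + 1) * ((1 + (real (Suc k) + 1/2)\<^sup>2) / ((real (Suc k) + 1) * \<bar>c + real (Suc k)\<bar>)))
      * ((real k + 1) * bessel_majorant c (Suc k))" for k
    unfolding bessel_majorant_Suc[of c "Suc k"] by simp
  show "(\<lambda>k. (real (Suc k) + 1) / (real k + 1) * ((1 + (real (Suc k) + 1/2)\<^sup>2) / ((real (Suc k) + 1) * \<bar>c + real (Suc k)\<bar>))) \<longlonglongrightarrow> 1"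
    by real_asymp
qed simp

lemma legendre_bessel_coeff_diff:
  assumes "N \<ge> 1"
  shows "\<bar>fps_nth (legendre_fps c N) k / N ^ (2 * k) - fps_nth (bessel_fps c) k\<bar> \<le> bessel_majorant c k / N\<^sup>2"
proof -
  let ?p = "\<Prod>i<k. 1 - 1 / N\<^sup>2 * (real i + 1/2)\<^sup>2" and ?P = "\<Prod>i<k. 1 + (real i + 1/2)\<^sup>2"
  have "fps_nth (legendre_fps c N) k / N ^ (2 * k) - fps_nth (bessel_fps c) k = (?p - 1) * fps_nth (bessel_fps c) k"
    using assms by (subst legendre_fps_eq_bessel_fps) (auto simp: algebra_simps)
  then have "\<bar>fps_nth (legendre_fps c N) k / N ^ (2 * k) - fps_nth (bessel_fps c) k\<bar> = \<bar>?p - 1\<bar> * \<bar>fps_nth (bessel_fps c) k\<bar>"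
    by (simp only: abs_mult)
  also have "\<dots> \<le> (1 / N\<^sup>2 * ?P) * \<bar>fps_nth (bessel_fps c) k\<bar>"
  proof (rule mult_right_mono)
    have "\<bar>?p - 1\<bar> \<le> 1 / N\<^sup>2 * (?P - 1)"
      using assms by (intro abs_prod_one_minus_le) auto
    also have "\<dots> \<le> 1 / N\<^sup>2 * ?P"
      by (intro mult_left_mono) auto
    finally show "\<bar>?p - 1\<bar> \<le> 1 / N\<^sup>2 * ?P" .
  qed auto
  finally show ?thesis
    by (simp add: bessel_majorant_def)
qed

text \<open>
  The majorant series has radius of convergence \<open>1\<close>; the number \<open>1/3\<close> stands for any bound between \<open>1/4\<close>,
  the limit of \<open>N\<^sup>2 sin\<^sup>2 (1 / (2 N))\<close>, and \<open>1\<close>.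
\<close>

lemma legendre_bessel_eval_diff:
  fixes c :: real
  obtains C where
    "\<And>N y. N \<ge> 1 \<Longrightarrow> 0 \<le> y \<Longrightarrow> y \<le> 1/3 \<Longrightarrow>
      \<bar>eval_fps (legendre_fps c N) (y / N\<^sup>2) - eval_fps (bessel_fps c) y\<bar> \<le> C / N\<^sup>2"
    "\<And>N y. N \<ge> 1 \<Longrightarrow> 0 \<le> y \<Longrightarrow> y \<le> 1/3 \<Longrightarrow>
      \<bar>eval_fps (fps_deriv (legendre_fps c N)) (y / N\<^sup>2) / N\<^sup>2 - eval_fps (fps_deriv (bessel_fps c)) y\<bar> \<le> C / N\<^sup>2"
proof -
  define C0 where "C0 = (\<Sum>k. bessel_majorant c k * (1/3) ^ k)"
  define C1 where "C1 = (\<Sum>k. (real k + 1) * bessel_majorant c (Suc k) * (1/3) ^ k)"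
  let ?l = "\<lambda>N. fps_nth (legendre_fps c N)" and ?b = "fps_nth (bessel_fps c)"
  have main: "\<bar>eval_fps (legendre_fps c N) (y / N\<^sup>2) - eval_fps (bessel_fps c) y\<bar> \<le> C0 / N\<^sup>2"
    "\<bar>eval_fps (fps_deriv (legendre_fps c N)) (y / N\<^sup>2) / N\<^sup>2 - eval_fps (fps_deriv (bessel_fps c)) y\<bar> \<le> C1 / N\<^sup>2"
    if N: "N \<ge> 1" and y: "0 \<le> y" "y \<le> 1/3" for N y :: real
  proof -
    have z: "\<bar>y / N\<^sup>2\<bar> < 1"
    proof -
      have "y / N\<^sup>2 \<le> (1/3) / 1"
        using N y by (intro frac_le) auto
      moreover have "0 \<le> y / N\<^sup>2"
        using y by simp
      ultimately show ?thesis
        by linarith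
    qed
    have scale: "a * (y / N\<^sup>2) ^ k = a / N ^ (2 * k) * y ^ k" for a k
      using N by (simp add: power_divide power_mult)
    have pow: "y ^ k \<le> (1/3) ^ k" for k
      using y by (intro power_mono) auto
    have "(\<lambda>k. ?l N k * (y / N\<^sup>2) ^ k - ?b k * y ^ k) sums (eval_fps (legendre_fps c N) (y / N\<^sup>2) - eval_fps (bessel_fps c) y)"
      using legendre_conv_radius_less(1)[OF z] bessel_conv_radius_less(1) by (intro sums_diff sums_eval_fps) auto
    then have s: "(\<lambda>k. (?l N k / N ^ (2 * k) - ?b k) * y ^ k) sums (eval_fps (legendre_fps c N) (y / N\<^sup>2) - eval_fps (bessel_fps c) y)"
      by (simp only: scale left_diff_distrib)
    have "norm (\<Sum>k. (?l N k / N ^ (2 * k) - ?b k) * y ^ k) \<le> (\<Sum>k. bessel_majorant c k * (1/3) ^ k / N\<^sup>2)"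
    proof (rule norm_suminf_le)
      fix k
      have "norm ((?l N k / N ^ (2 * k) - ?b k) * y ^ k) \<le> (bessel_majorant c k / N\<^sup>2) * (1/3) ^ k"
        unfolding real_norm_def abs_mult using legendre_bessel_coeff_diff[OF N] pow y bessel_majorant_nonneg
        by (intro mult_mono) auto
      then show "norm ((?l N k / N ^ (2 * k) - ?b k) * y ^ k) \<le> bessel_majorant c k * (1/3) ^ k / N\<^sup>2"
        by simp
    qed (intro summable_divide summable_bessel_majorant)
    then show "\<bar>eval_fps (legendre_fps c N) (y / N\<^sup>2) - eval_fps (bessel_fps c) y\<bar> \<le> C0 / N\<^sup>2"
      using sums_unique[OF s] suminf_divide[OF summable_bessel_majorant, of c "N\<^sup>2"] by (simp add: C0_def)
    have "(\<lambda>k. fps_nth (fps_deriv (legendre_fps c N)) k * (y / N\<^sup>2) ^ k / N\<^sup>2 - fps_nth (fps_deriv (bessel_fps c)) k * y ^ k)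
        sums (eval_fps (fps_deriv (legendre_fps c N)) (y / N\<^sup>2) / N\<^sup>2 - eval_fps (fps_deriv (bessel_fps c)) y)"
      using legendre_conv_radius_less(2)[OF z] bessel_conv_radius_less(2) by (intro sums_diff sums_divide sums_eval_fps) auto
    moreover have "fps_nth (fps_deriv (legendre_fps c N)) k * (y / N\<^sup>2) ^ k / N\<^sup>2 - fps_nth (fps_deriv (bessel_fps c)) k * y ^ k
        = (real k + 1) * (?l N (Suc k) / N ^ (2 * Suc k) - ?b (Suc k)) * y ^ k" for k
      unfolding scale by (simp add: algebra_simps power2_eq_square)
    ultimately have s: "(\<lambda>k. (real k + 1) * (?l N (Suc k) / N ^ (2 * Suc k) - ?b (Suc k)) * y ^ k)
        sums (eval_fps (fps_deriv (legendre_fps c N)) (y / N\<^sup>2) / N\<^sup>2 - eval_fps (fps_deriv (bessel_fps c)) y)"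
      by simp
    have "norm (\<Sum>k. (real k + 1) * (?l N (Suc k) / N ^ (2 * Suc k) - ?b (Suc k)) * y ^ k)
        \<le> (\<Sum>k. (real k + 1) * bessel_majorant c (Suc k) * (1/3) ^ k / N\<^sup>2)"
    proof (rule norm_suminf_le)
      fix k
      have "norm ((real k + 1) * (?l N (Suc k) / N ^ (2 * Suc k) - ?b (Suc k)) * y ^ k)
          \<le> (real k + 1) * (bessel_majorant c (Suc k) / N\<^sup>2) * (1/3) ^ k"
        unfolding real_norm_def abs_mult using legendre_bessel_coeff_diff[OF N, of c "Suc k"] pow y bessel_majorant_nonneg
        by (intro mult_mono mult_nonneg_nonneg) auto
      then show "norm ((real k + 1) * (?l N (Suc k) / N ^ (2 * Suc k) - ?b (Suc k)) * y ^ k)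
          \<le> (real k + 1) * bessel_majorant c (Suc k) * (1/3) ^ k / N\<^sup>2"
        by simp
    qed (intro summable_divide summable_bessel_majorant_deriv)
    then show "\<bar>eval_fps (fps_deriv (legendre_fps c N)) (y / N\<^sup>2) / N\<^sup>2 - eval_fps (fps_deriv (bessel_fps c)) y\<bar> \<le> C1 / N\<^sup>2"
      using sums_unique[OF s] suminf_divide[OF summable_bessel_majorant_deriv, of c "N\<^sup>2"] by (simp add: C1_def)
  qed
  have "a \<le> C0 / N\<^sup>2 \<Longrightarrow> a \<le> max C0 C1 / N\<^sup>2" "a \<le> C1 / N\<^sup>2 \<Longrightarrow> a \<le> max C0 C1 / N\<^sup>2" for a N :: real
    by (smt (verit) divide_right_mono max.cobounded1 max.cobounded2 zero_le_power2)+
  with main show thesis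
    using that[of "max C0 C1"] by blast
qed

section \<open>Liouville normal forms\<close>

text \<open>
  The function \<open>sqrt x * J x\<close> with the Bessel function \<open>J\<close> of order \<open>\<rho> - 1/2\<close>, normalized to behave like
  \<open>(x / 2) powr \<rho>\<close> at \<open>0\<close>; it solves \<open>w'' = (\<rho> (\<rho> - 1) / x\<^sup>2 - 1) w\<close>.
\<close>

definition bessel_sol :: "real \<Rightarrow> real \<Rightarrow> real" where
  "bessel_sol \<rho> x = (x / 2) powr \<rho> * eval_fps (bessel_fps (\<rho> + 1/2)) ((x / 2)\<^sup>2)"

definition bessel_sol_deriv :: "real \<Rightarrow> real \<Rightarrow> real" where
  "bessel_sol_deriv \<rho> x = (x / 2) powr \<rho> *
    (\<rho> / x * eval_fps (bessel_fps (\<rho> + 1/2)) ((x / 2)\<^sup>2)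
      + x / 2 * eval_fps (fps_deriv (bessel_fps (\<rho> + 1/2))) ((x / 2)\<^sup>2))"

lemma eval_bessel_has_derivative:
  fixes x :: real
  shows "((\<lambda>x. eval_fps (bessel_fps c) ((x / 2)\<^sup>2)) has_real_derivative
      x / 2 * eval_fps (fps_deriv (bessel_fps c)) ((x / 2)\<^sup>2)) (at x)"
    "((\<lambda>x. eval_fps (fps_deriv (bessel_fps c)) ((x / 2)\<^sup>2)) has_real_derivative
      x / 2 * eval_fps (fps_deriv (fps_deriv (bessel_fps c))) ((x / 2)\<^sup>2)) (at x)"
proof -
  have sq: "((\<lambda>x. (x / 2)\<^sup>2) has_real_derivative x / 2) (at x)"
    by (auto intro!: derivative_eq_intros)
  show "((\<lambda>x. eval_fps (bessel_fps c) ((x / 2)\<^sup>2)) has_real_derivative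
      x / 2 * eval_fps (fps_deriv (bessel_fps c)) ((x / 2)\<^sup>2)) (at x)"
    using DERIV_chain2[OF has_field_derivative_eval_fps[OF bessel_conv_radius_less(1)] sq, of c]
    by (simp add: mult.commute)
  show "((\<lambda>x. eval_fps (fps_deriv (bessel_fps c)) ((x / 2)\<^sup>2)) has_real_derivative
      x / 2 * eval_fps (fps_deriv (fps_deriv (bessel_fps c))) ((x / 2)\<^sup>2)) (at x)"
    using DERIV_chain2[OF has_field_derivative_eval_fps[OF bessel_conv_radius_less(2)] sq, of c]
    by (simp add: mult.commute)
qed

lemma half_powr_has_derivative:
  fixes x :: real
  assumes "x > 0"
  shows "((\<lambda>x. (x / 2) powr \<rho>) has_real_derivative \<rho> / x * (x / 2) powr \<rho>) (at x)"
  using assms by (auto intro!: derivative_eq_intros simp: powr_diff field_simps)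

lemma bessel_sol_has_derivative:
  assumes "x > 0"
  shows "(bessel_sol \<rho> has_real_derivative bessel_sol_deriv \<rho> x) (at x)"
  unfolding bessel_sol_def[abs_def] bessel_sol_deriv_def
  by (rule DERIV_cong[OF DERIV_mult[OF half_powr_has_derivative[OF assms] eval_bessel_has_derivative(1)]])
    (simp add: algebra_simps)

lemma bessel_sol_deriv_has_derivative:
  assumes x: "x > 0" and c: "\<And>k::nat. \<rho> + 1/2 + real k \<noteq> 0"
  shows "(bessel_sol_deriv \<rho> has_real_derivative (\<rho> * (\<rho> - 1) / x\<^sup>2 - 1) * bessel_sol \<rho> x) (at x)"
proof -
  let ?F = "bessel_fps (\<rho> + 1/2)"
  define y where "y = (x / 2)\<^sup>2"
  define B0 where "B0 = eval_fps ?F y"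
  define B1 where "B1 = eval_fps (fps_deriv ?F) y"
  define B2 where "B2 = eval_fps (fps_deriv (fps_deriv ?F)) y"
  have ode: "y * B2 = - (\<rho> + 1/2) * B1 - B0"
    using bessel_ode[OF c, of y] unfolding B0_def B1_def B2_def by (simp add: algebra_simps)
  have inner: "((\<lambda>x. \<rho> / x * eval_fps ?F ((x / 2)\<^sup>2) + x / 2 * eval_fps (fps_deriv ?F) ((x / 2)\<^sup>2)) has_real_derivative
      - \<rho> / x\<^sup>2 * B0 + \<rho> / x * (x / 2 * B1) + (1/2 * B1 + x / 2 * (x / 2 * B2))) (at x)"
  proof -
    have d1: "((\<lambda>x. \<rho> / x) has_real_derivative - \<rho> / x\<^sup>2) (at x)"
      using x by (auto intro!: derivative_eq_intros simp: power2_eq_square)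
    have d2: "((\<lambda>x. x / 2) has_real_derivative 1/2) (at x)"
      by (auto intro!: derivative_eq_intros)
    show ?thesis
      by (rule DERIV_cong[OF DERIV_add[OF DERIV_mult[OF d1 eval_bessel_has_derivative(1)]
              DERIV_mult[OF d2 eval_bessel_has_derivative(2)]]])
        (simp add: B0_def B1_def B2_def y_def algebra_simps)
  qed
  have "x / 2 * (x / 2 * B2) = y * B2"
    by (simp add: y_def power2_eq_square)
  then have e1: "x / 2 * (x / 2 * B2) = - (\<rho> + 1/2) * B1 - B0"
    using ode by simp
  have "(\<rho> / x * (x / 2) powr \<rho>) * (\<rho> / x * B0 + x / 2 * B1) +
      (- \<rho> / x\<^sup>2 * B0 + \<rho> / x * (x / 2 * B1) + (1/2 * B1 + x / 2 * (x / 2 * B2))) * (x / 2) powr \<rho>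
    = (\<rho> * (\<rho> - 1) / x\<^sup>2 - 1) * ((x / 2) powr \<rho> * B0)"
    unfolding e1 using x by (simp add: field_simps power2_eq_square)
  with DERIV_mult[OF half_powr_has_derivative[OF x, of \<rho>] inner] show ?thesis
    unfolding bessel_sol_def bessel_sol_deriv_def[abs_def] B0_def[symmetric] B1_def[symmetric] y_def[symmetric]
    by (simp add: y_def B0_def B1_def B2_def)
qed

text \<open>
  Near \<open>0\<close> the power series is close to its constant term \<open>1\<close>.
\<close>

lemma bessel_sol_nonzero: obtains x where "x > 0" "bessel_sol \<rho> x \<noteq> 0"
proof -
  let ?g = "\<lambda>x::real. eval_fps (bessel_fps (\<rho> + 1/2)) ((x / 2)\<^sup>2)"
  have "isCont ?g 0"
    using eval_bessel_has_derivative(1)[of _ 0] by (rule DERIV_isCont)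
  moreover have "?g 0 = 1"
    by (simp add: eval_fps_at_0 bessel_fps_0)
  ultimately have "(?g \<longlongrightarrow> 1) (at_right 0)"
    unfolding isCont_def by (metis filterlim_at_split)
  then have "eventually (\<lambda>x. ?g x > 0) (at_right 0)"
    by (rule order_tendstoD) simp
  then obtain b where b: "b > 0" "\<And>x. 0 < x \<Longrightarrow> x < b \<Longrightarrow> ?g x > 0"
    unfolding eventually_at_right_field by auto
  have "?g (b / 2) > 0" "(b / 2 / 2) powr \<rho> > 0"
    using b(1) b(2)[of "b / 2"] by auto
  then show thesis
    using that[of "b / 2"] b(1) by (simp add: bessel_sol_def)
qed

text \<open>
  The prefactor removes the first-order term of the hypergeometric equation in the variable \<open>t\<close>.
\<close>

definition legendre_sol :: "real \<Rightarrow> real \<Rightarrow> real \<Rightarrow> real" where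
  "legendre_sol \<rho> N t = sin (t / 2) powr \<rho> * cos (t / 2) powr (1 - \<rho>) *
    eval_fps (legendre_fps (\<rho> + 1/2) N) ((sin (t / 2))\<^sup>2)"

definition legendre_sol_deriv :: "real \<Rightarrow> real \<Rightarrow> real \<Rightarrow> real" where
  "legendre_sol_deriv \<rho> N t = sin (t / 2) powr \<rho> * cos (t / 2) powr (1 - \<rho>) *
    ((\<rho> * cos (t / 2) / sin (t / 2) - (1 - \<rho>) * sin (t / 2) / cos (t / 2)) / 2 *
        eval_fps (legendre_fps (\<rho> + 1/2) N) ((sin (t / 2))\<^sup>2)
      + sin (t / 2) * cos (t / 2) * eval_fps (fps_deriv (legendre_fps (\<rho> + 1/2) N)) ((sin (t / 2))\<^sup>2))"

lemma half_angle_pos: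
  fixes t :: real
  assumes "0 < t" "t < pi"
  shows "sin (t / 2) > 0" "cos (t / 2) > 0" "\<bar>(sin (t / 2))\<^sup>2\<bar> < 1"
proof -
  show s: "sin (t / 2) > 0" and c: "cos (t / 2) > 0"
    using assms by (auto intro!: sin_gt_zero cos_gt_zero)
  have "(sin (t / 2))\<^sup>2 = 1 - (cos (t / 2))\<^sup>2"
    by (simp add: sin_squared_eq)
  moreover have "(cos (t / 2))\<^sup>2 > 0"
    using c by simp
  ultimately have "(sin (t / 2))\<^sup>2 < 1"
    by linarith
  then show "\<bar>(sin (t / 2))\<^sup>2\<bar> < 1"
    by simp
qed

lemma eval_legendre_has_derivative:
  fixes t :: real
  assumes "0 < t" "t < pi"
  shows "((\<lambda>t. eval_fps (legendre_fps c N) ((sin (t / 2))\<^sup>2)) has_real_derivative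
      sin (t / 2) * cos (t / 2) * eval_fps (fps_deriv (legendre_fps c N)) ((sin (t / 2))\<^sup>2)) (at t)"
    "((\<lambda>t. eval_fps (fps_deriv (legendre_fps c N)) ((sin (t / 2))\<^sup>2)) has_real_derivative
      sin (t / 2) * cos (t / 2) * eval_fps (fps_deriv (fps_deriv (legendre_fps c N))) ((sin (t / 2))\<^sup>2)) (at t)"
proof -
  note z = half_angle_pos(3)[OF assms]
  have sq: "((\<lambda>t. (sin (t / 2))\<^sup>2) has_real_derivative sin (t / 2) * cos (t / 2)) (at t)"
    by (auto intro!: derivative_eq_intros)
  show "((\<lambda>t. eval_fps (legendre_fps c N) ((sin (t / 2))\<^sup>2)) has_real_derivative
      sin (t / 2) * cos (t / 2) * eval_fps (fps_deriv (legendre_fps c N)) ((sin (t / 2))\<^sup>2)) (at t)"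
    using DERIV_chain2[OF has_field_derivative_eval_fps[OF legendre_conv_radius_less(1)[OF z]] sq]
    by (simp add: mult.commute)
  show "((\<lambda>t. eval_fps (fps_deriv (legendre_fps c N)) ((sin (t / 2))\<^sup>2)) has_real_derivative
      sin (t / 2) * cos (t / 2) * eval_fps (fps_deriv (fps_deriv (legendre_fps c N))) ((sin (t / 2))\<^sup>2)) (at t)"
    using DERIV_chain2[OF has_field_derivative_eval_fps[OF legendre_conv_radius_less(2)[OF z]] sq]
    by (simp add: mult.commute)
qed

lemma sin_cos_powr_has_derivative:
  fixes t :: real
  assumes "0 < t" "t < pi"
  shows "((\<lambda>t. sin (t / 2) powr \<rho> * cos (t / 2) powr (1 - \<rho>)) has_real_derivative
    (\<rho> * cos (t / 2) / sin (t / 2) - (1 - \<rho>) * sin (t / 2) / cos (t / 2)) / 2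
      * (sin (t / 2) powr \<rho> * cos (t / 2) powr (1 - \<rho>))) (at t)"
proof -
  note pos = half_angle_pos(1,2)[OF assms]
  have "sin (t / 2) powr (\<rho> - 1) = sin (t / 2) powr \<rho> / sin (t / 2)"
    using pos by (simp add: powr_diff)
  then have "((\<lambda>t. sin (t / 2) powr \<rho>) has_real_derivative
      \<rho> * (sin (t / 2) powr \<rho> / sin (t / 2)) * (cos (t / 2) / 2)) (at t)"
    using pos by (auto intro!: derivative_eq_intros)
  moreover have "cos (t / 2) powr (1 - \<rho> - 1) = cos (t / 2) powr (1 - \<rho>) / cos (t / 2)"
    using pos powr_diff[of "cos (t / 2)" "1 - \<rho>" 1] by simp
  then have "((\<lambda>t. cos (t / 2) powr (1 - \<rho>)) has_real_derivative
      (1 - \<rho>) * (cos (t / 2) powr (1 - \<rho>) / cos (t / 2)) * (- sin (t / 2) / 2)) (at t)"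
    using pos by (auto intro!: derivative_eq_intros)
  ultimately show ?thesis
    by (rule DERIV_cong[OF DERIV_mult]) (use pos in \<open>simp add: field_simps\<close>)
qed

lemma legendre_sol_has_derivative:
  assumes "0 < t" "t < pi"
  shows "(legendre_sol \<rho> N has_real_derivative legendre_sol_deriv \<rho> N t) (at t)"
  unfolding legendre_sol_def[abs_def] legendre_sol_deriv_def
  by (rule DERIV_cong[OF DERIV_mult[OF sin_cos_powr_has_derivative[OF assms] eval_legendre_has_derivative(1)[OF assms]]])
    (simp add: algebra_simps)

text \<open>
  The algebra of the Liouville substitution, with \<open>s = sin (t / 2)\<close> and \<open>co = cos (t / 2)\<close>: \<open>P\<close> is the
  logarithmic derivative of \<open>s powr \<rho> * co powr (1 - \<rho>)\<close>.  These exponents make the first-order terms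
  cancel, and \<open>1 / s\<^sup>2 + 1 / co\<^sup>2 = 4 / sin\<^sup>2 t\<close> merges the two singular potentials into one.
\<close>

lemma normal_form_identity:
  fixes s co F0 F1 F2 \<rho> N :: real
  assumes pos: "s > 0" "co > 0" and sc: "s\<^sup>2 + co\<^sup>2 = 1"
    and ode: "s\<^sup>2 * (1 - s\<^sup>2) * F2 + (\<rho> + 1/2 - 2 * s\<^sup>2) * F1 = (1/4 - N\<^sup>2) * F0"
  defines "P \<equiv> (\<rho> * co / s - (1 - \<rho>) * s / co) / 2"
  shows "P * (P * F0 + s * co * F1) +
    ((- \<rho> / s\<^sup>2 - (1 - \<rho>) / co\<^sup>2) / 4 * F0 + P * (s * co * F1) + ((co\<^sup>2 - s\<^sup>2) / 2 * F1 + s * co * (s * co * F2)))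
    = (\<rho> * (\<rho> - 1) / (2 * s * co)\<^sup>2 - N\<^sup>2) * F0"
proof -
  have co2: "co\<^sup>2 = 1 - s\<^sup>2"
    using sc by simp
  have Psc: "P * (s * co) = (\<rho> * co\<^sup>2 - (1 - \<rho>) * s\<^sup>2) / 2"
    using pos by (simp add: P_def field_simps power2_eq_square)
  have P2: "P\<^sup>2 = (\<rho>\<^sup>2 * (co\<^sup>2 / s\<^sup>2) + (1 - \<rho>)\<^sup>2 * (s\<^sup>2 / co\<^sup>2) - 2 * (\<rho> * (1 - \<rho>))) / 4"
  proof -
    have "\<rho> * (1 - \<rho>) = (\<rho> * co / s) * ((1 - \<rho>) * s / co)"
      using pos by simp
    then show ?thesis
      by (simp only: P_def power_divide power2_diff power_mult_distrib) simp
  qed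
  have F2: "s * co * (s * co * F2) = (1/4 - N\<^sup>2) * F0 - (\<rho> + 1/2 - 2 * s\<^sup>2) * F1"
  proof -
    have "s * co * (s * co * F2) = s\<^sup>2 * co\<^sup>2 * F2"
      by (simp add: power2_eq_square)
    also have "\<dots> = s\<^sup>2 * (1 - s\<^sup>2) * F2"
      by (simp only: co2)
    finally show ?thesis
      using ode by linarith
  qed
  have F0_coeff: "P\<^sup>2 + (- \<rho> / s\<^sup>2 - (1 - \<rho>) / co\<^sup>2) / 4 + 1/4 = \<rho> * (\<rho> - 1) / (2 * s * co)\<^sup>2"
  proof -
    have "1 / (s\<^sup>2 * co\<^sup>2) = (s\<^sup>2 + co\<^sup>2) / (s\<^sup>2 * co\<^sup>2)"
      by (simp add: sc)
    also have "\<dots> = 1 / s\<^sup>2 + 1 / co\<^sup>2"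
      using pos by (simp add: field_simps)
    finally have inv: "1 / (s\<^sup>2 * co\<^sup>2) = 1 / s\<^sup>2 + 1 / co\<^sup>2" .
    have a: "co\<^sup>2 / s\<^sup>2 = 1 / s\<^sup>2 - 1" "s\<^sup>2 / co\<^sup>2 = 1 / co\<^sup>2 - 1"
      using pos sc by (simp_all add: field_simps)
    have "\<rho> * (\<rho> - 1) / (2 * s * co)\<^sup>2 = \<rho> * (\<rho> - 1) / 4 * (1 / (s\<^sup>2 * co\<^sup>2))"
      by (simp add: power_mult_distrib)
    also have "\<dots> = \<rho> * (\<rho> - 1) / 4 * (1 / s\<^sup>2) + \<rho> * (\<rho> - 1) / 4 * (1 / co\<^sup>2)"
      unfolding inv by (rule distrib_left)
    finally show ?thesis
      unfolding P2 a by (simp add: power2_eq_square algebra_simps add_divide_distrib diff_divide_distrib)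
  qed
  have F1_coeff: "2 * (P * (s * co)) + (co\<^sup>2 - s\<^sup>2) / 2 = \<rho> + 1/2 - 2 * s\<^sup>2"
    unfolding Psc co2 by (simp add: algebra_simps add_divide_distrib diff_divide_distrib)
  have "P * (P * F0 + s * co * F1) +
    ((- \<rho> / s\<^sup>2 - (1 - \<rho>) / co\<^sup>2) / 4 * F0 + P * (s * co * F1) + ((co\<^sup>2 - s\<^sup>2) / 2 * F1 + s * co * (s * co * F2)))
    = (P\<^sup>2 + (- \<rho> / s\<^sup>2 - (1 - \<rho>) / co\<^sup>2) / 4) * F0 + (2 * (P * (s * co)) + (co\<^sup>2 - s\<^sup>2) / 2) * F1 + s * co * (s * co * F2)"
    by (simp add: power2_eq_square algebra_simps)
  also have "\<dots> = (P\<^sup>2 + (- \<rho> / s\<^sup>2 - (1 - \<rho>) / co\<^sup>2) / 4 + 1/4 - N\<^sup>2) * F0"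
    unfolding F1_coeff F2 by (simp add: algebra_simps)
  finally show ?thesis
    unfolding F0_coeff .
qed

lemma legendre_sol_deriv_has_derivative:
  assumes t: "0 < t" "t < pi" and c: "\<And>k::nat. \<rho> + 1/2 + real k \<noteq> 0"
  shows "(legendre_sol_deriv \<rho> N has_real_derivative (\<rho> * (\<rho> - 1) / (sin t)\<^sup>2 - N\<^sup>2) * legendre_sol \<rho> N t) (at t)"
proof -
  note pos = half_angle_pos(1,2)[OF t]
  let ?F = "legendre_fps (\<rho> + 1/2) N"
  define s where "s = sin (t / 2)"
  define co where "co = cos (t / 2)"
  define F0 where "F0 = eval_fps ?F (s\<^sup>2)"
  define F1 where "F1 = eval_fps (fps_deriv ?F) (s\<^sup>2)"
  define F2 where "F2 = eval_fps (fps_deriv (fps_deriv ?F)) (s\<^sup>2)"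
  define E where "E = s powr \<rho> * co powr (1 - \<rho>)"
  define P where "P = (\<rho> * co / s - (1 - \<rho>) * s / co) / 2"
  have sc: "s\<^sup>2 + co\<^sup>2 = 1" and pos': "s > 0" "co > 0"
    using pos by (simp_all add: s_def co_def)
  have ode: "s\<^sup>2 * (1 - s\<^sup>2) * F2 + (\<rho> + 1/2 - 2 * s\<^sup>2) * F1 = (1/4 - N\<^sup>2) * F0"
    using legendre_ode[OF c half_angle_pos(3)[OF t]] by (simp add: s_def F0_def F1_def F2_def)
  have dP: "((\<lambda>t. (\<rho> * cos (t / 2) / sin (t / 2) - (1 - \<rho>) * sin (t / 2) / cos (t / 2)) / 2)
      has_real_derivative (- \<rho> / s\<^sup>2 - (1 - \<rho>) / co\<^sup>2) / 4) (at t)"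
  proof -
    have d1: "((\<lambda>t. cos (t / 2) / sin (t / 2)) has_real_derivative (- 1 / s\<^sup>2) / 2) (at t)"
      using pos sc unfolding s_def co_def
      by (auto intro!: derivative_eq_intros simp: divide_simps power2_eq_square)
    have d2: "((\<lambda>t. sin (t / 2) / cos (t / 2)) has_real_derivative (1 / co\<^sup>2) / 2) (at t)"
      using pos sc unfolding s_def co_def
      by (auto intro!: derivative_eq_intros simp: divide_simps power2_eq_square)
    have "(\<lambda>t. (\<rho> * cos (t / 2) / sin (t / 2) - (1 - \<rho>) * sin (t / 2) / cos (t / 2)) / 2)
      = (\<lambda>t. (\<rho> * (cos (t / 2) / sin (t / 2)) - (1 - \<rho>) * (sin (t / 2) / cos (t / 2))) / 2)"
      by simp
    then show ?thesis
      using pos'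
      by (simp only:) (rule DERIV_cong[OF DERIV_cdivide[OF DERIV_diff[OF DERIV_cmult[OF d1] DERIV_cmult[OF d2]]]],
          simp add: field_simps)
  qed
  have dsc: "((\<lambda>t. sin (t / 2) * cos (t / 2)) has_real_derivative (co\<^sup>2 - s\<^sup>2) / 2) (at t)"
    unfolding s_def co_def by (auto intro!: derivative_eq_intros simp: power2_eq_square algebra_simps)
  note dF0 = eval_legendre_has_derivative(1)[OF t, of "\<rho> + 1/2" N, folded s_def co_def, folded F1_def]
  note dF1 = eval_legendre_has_derivative(2)[OF t, of "\<rho> + 1/2" N, folded s_def co_def, folded F2_def]
  note inner = DERIV_add[OF DERIV_mult[OF dP dF0] DERIV_mult[OF dsc dF1]]
  have sin_t: "sin t = 2 * s * co"
    using sin_double[of "t / 2"] by (simp add: s_def co_def)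
  note dE = sin_cos_powr_has_derivative[OF t, of \<rho>, folded s_def co_def, folded P_def E_def]
  show ?thesis
    unfolding legendre_sol_deriv_def[abs_def]
  proof (rule DERIV_cong[OF DERIV_mult[OF dE inner]])
    have "E * (P * (P * F0 + s * co * F1) +
        ((- \<rho> / s\<^sup>2 - (1 - \<rho>) / co\<^sup>2) / 4 * F0 + P * (s * co * F1) + ((co\<^sup>2 - s\<^sup>2) / 2 * F1 + s * co * (s * co * F2))))
      = E * ((\<rho> * (\<rho> - 1) / (2 * s * co)\<^sup>2 - N\<^sup>2) * F0)"
      unfolding P_def by (rule arg_cong[OF normal_form_identity[OF pos' sc ode]])
    then show "P * E * ((\<rho> * cos (t / 2) / sin (t / 2) - (1 - \<rho>) * sin (t / 2) / cos (t / 2)) / 2 *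
          eval_fps ?F ((sin (t / 2))\<^sup>2) + sin (t / 2) * cos (t / 2) * eval_fps (fps_deriv ?F) ((sin (t / 2))\<^sup>2)) +
        ((- \<rho> / s\<^sup>2 - (1 - \<rho>) / co\<^sup>2) / 4 * eval_fps ?F ((sin (t / 2))\<^sup>2) +
          s * co * F1 * ((\<rho> * cos (t / 2) / sin (t / 2) - (1 - \<rho>) * sin (t / 2) / cos (t / 2)) / 2) +
          ((co\<^sup>2 - s\<^sup>2) / 2 * eval_fps (fps_deriv ?F) ((sin (t / 2))\<^sup>2) + s * co * F2 * (sin (t / 2) * cos (t / 2))))
        * (sin (t / 2) powr \<rho> * cos (t / 2) powr (1 - \<rho>))
      = (\<rho> * (\<rho> - 1) / (sin t)\<^sup>2 - N\<^sup>2) * legendre_sol \<rho> N t"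
      unfolding legendre_sol_def sin_t s_def[symmetric] co_def[symmetric] F0_def[symmetric] F1_def[symmetric]
        P_def[symmetric] E_def[symmetric]
      by (simp add: algebra_simps)
  qed
qed

section \<open>Asymptotics for large degree\<close>

lemma bigo_add_diff:
  fixes f g :: "real \<Rightarrow> real"
  assumes "(\<lambda>N. f N - a) \<in> O(\<lambda>N. 1 / N)" "(\<lambda>N. g N - b) \<in> O(\<lambda>N. 1 / N)"
  shows "(\<lambda>N. (f N + g N) - (a + b)) \<in> O(\<lambda>N. 1 / N)"
  using sum_in_bigo(1)[OF assms] by (simp add: algebra_simps)

lemma bigo_mult_diff:
  fixes f g :: "real \<Rightarrow> real"
  assumes f: "(\<lambda>N. f N - a) \<in> O(\<lambda>N. 1 / N)" and g: "(\<lambda>N. g N - b) \<in> O(\<lambda>N. 1 / N)"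
  shows "(\<lambda>N. f N * g N - a * b) \<in> O(\<lambda>N. 1 / N)"
proof -
  have 1: "(\<lambda>N. 1 / N) \<in> O(\<lambda>_. 1::real)"
    by real_asymp
  have "(\<lambda>N. (f N - a) * (g N - b)) \<in> O(\<lambda>N. 1 / N * 1)"
    using f landau_o.big_trans[OF g 1] by (rule landau_o.big.mult)
  moreover have "(\<lambda>N. (f N - a) * b) \<in> O(\<lambda>N. 1 / N)" "(\<lambda>N. a * (g N - b)) \<in> O(\<lambda>N. 1 / N)"
    using f g by (auto intro: landau_o.big.cmult_in_iff' simp: mult.commute[of _ b])
  ultimately have "(\<lambda>N. (f N - a) * (g N - b) + ((f N - a) * b + a * (g N - b))) \<in> O(\<lambda>N. 1 / N)"
    by (intro sum_in_bigo) auto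
  then show ?thesis
    by (simp add: algebra_simps)
qed

lemma bigo_compose_diff:
  fixes h f :: "real \<Rightarrow> real"
  assumes h: "(h has_real_derivative h') (at a)" and f: "(\<lambda>N. f N - a) \<in> O(\<lambda>N. 1 / N)"
  shows "(\<lambda>N. h (f N) - h a) \<in> O(\<lambda>N. 1 / N)"
proof -
  obtain g where g: "\<And>z. h z - h a = g z * (z - a)" "isCont g a"
    using h unfolding CARAT_DERIV by blast
  have "(\<lambda>N. 1 / N) \<in> o(\<lambda>_. 1::real)"
    by real_asymp
  from landau_o.big_small_trans[OF f this] have "((\<lambda>N. f N - a) \<longlongrightarrow> 0) at_top"
    using smalloD_tendsto by fastforce
  then have lim: "(f \<longlongrightarrow> a) at_top"
    by (rule LIM_zero_cancel)
  have "((\<lambda>N. g (f N)) \<longlongrightarrow> g a) at_top"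
    by (rule isCont_tendsto_compose[OF g(2) lim])
  then have "(\<lambda>N. g (f N)) \<in> O(\<lambda>_. 1)"
    by (intro bigoI_tendsto[where c = "g a"]) auto
  from landau_o.big.mult[OF this f] show ?thesis
    by (simp add: g(1))
qed

lemma bigo_inverse_of_bound:
  fixes f :: "real \<Rightarrow> real"
  assumes "\<And>N. N \<ge> 1 \<Longrightarrow> \<bar>f N\<bar> \<le> C / N\<^sup>2"
  shows "f \<in> O(\<lambda>N. 1 / N)"
proof -
  have "f \<in> O(\<lambda>N. 1 / N\<^sup>2)"
  proof (rule bigoI)
    show "eventually (\<lambda>N. norm (f N) \<le> C * norm (1 / N\<^sup>2)) at_top"
      using eventually_ge_at_top[of 1] by eventually_elim (use assms in auto)
  qed
  also have "(\<lambda>N. 1 / N\<^sup>2) \<in> O(\<lambda>N. 1 / N :: real)"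
    by real_asymp
  finally show ?thesis .
qed

text \<open>
  The initial values for the comparison with Bessel's equation.  At \<open>t = 1 / N\<close> the power series are
  evaluated at \<open>sin\<^sup>2 (1 / (2 N))\<close>, that is at \<open>y / N\<^sup>2\<close> with \<open>y\<close> close to \<open>1/4\<close>, where the Legendre series
  differs from the Bessel series by \<open>O(1 / N\<^sup>2)\<close>; the elementary factors converge at rate \<open>1 / N\<close>.
\<close>

lemma legendre_bessel_initial:
  fixes \<rho> :: real
  shows "(\<lambda>N. N powr \<rho> * legendre_sol \<rho> N (1 / N) - bessel_sol \<rho> 1) \<in> O(\<lambda>N. 1 / N)" (is ?L0)
    and "(\<lambda>N. N powr \<rho> * legendre_sol_deriv \<rho> N (1 / N) / N - bessel_sol_deriv \<rho> 1) \<in> O(\<lambda>N. 1 / N)" (is ?L1)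
proof -
  let ?c = "\<rho> + 1/2"
  define s where "s N = N * sin (1 / N / 2)" for N :: real
  define co where "co N = cos (1 / N / 2)" for N :: real
  define F0 where "F0 N = eval_fps (legendre_fps ?c N) ((s N)\<^sup>2 / N\<^sup>2)" for N
  define F1 where "F1 N = eval_fps (fps_deriv (legendre_fps ?c N)) ((s N)\<^sup>2 / N\<^sup>2) / N\<^sup>2" for N
  have s: "(\<lambda>N. s N - 1/2) \<in> O(\<lambda>N. 1 / N)"
    unfolding s_def by real_asymp
  have co: "(\<lambda>N. co N - 1) \<in> O(\<lambda>N. 1 / N)"
    unfolding co_def by real_asymp
  have s2: "(\<lambda>N. (s N)\<^sup>2 - (1/2)\<^sup>2) \<in> O(\<lambda>N. 1 / N)"
    unfolding s_def by real_asymp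
  have s_range: "0 < s N" "(s N)\<^sup>2 \<le> 1/3" "0 < co N" if "N \<ge> 1" for N
  proof -
    have "1 / N \<le> 1" "0 < 1 / N"
      using that by auto
    moreover from this have "1 / N < pi"
      using pi_gt3 by linarith
    then have "1 / N / 2 < pi / 2"
      by (rule divide_strict_right_mono) simp
    ultimately have N: "0 < 1 / N / 2" "1 / N / 2 < pi / 2"
      by auto
    have "sin (1 / N / 2) > 0"
      using N by (intro sin_gt_zero order.strict_trans[OF N(2)]) auto
    moreover have "cos (1 / N / 2) > 0"
      by (rule cos_gt_zero[OF N])
    ultimately show "0 < s N" "0 < co N"
      using that by (auto simp: s_def co_def)
    have "s N \<le> N * (1 / N / 2)"
      unfolding s_def using that N by (intro mult_left_mono sin_x_le_x) auto
    then have "s N \<le> 1/2"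
      using that by simp
    with \<open>0 < s N\<close> have "(s N)\<^sup>2 \<le> (1/2)\<^sup>2"
      by (intro power_mono) auto
    then show "(s N)\<^sup>2 \<le> 1/3"
      by (simp add: power2_eq_square)
  qed
  obtain C where C: "\<And>N y. N \<ge> 1 \<Longrightarrow> 0 \<le> y \<Longrightarrow> y \<le> 1/3 \<Longrightarrow>
      \<bar>eval_fps (legendre_fps ?c N) (y / N\<^sup>2) - eval_fps (bessel_fps ?c) y\<bar> \<le> C / N\<^sup>2"
    "\<And>N y. N \<ge> 1 \<Longrightarrow> 0 \<le> y \<Longrightarrow> y \<le> 1/3 \<Longrightarrow>
      \<bar>eval_fps (fps_deriv (legendre_fps ?c N)) (y / N\<^sup>2) / N\<^sup>2 - eval_fps (fps_deriv (bessel_fps ?c)) y\<bar> \<le> C / N\<^sup>2"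
    using legendre_bessel_eval_diff by metis
  have F0: "(\<lambda>N. F0 N - eval_fps (bessel_fps ?c) ((1/2)\<^sup>2)) \<in> O(\<lambda>N. 1 / N)"
  proof -
    have "(\<lambda>N. F0 N - eval_fps (bessel_fps ?c) ((s N)\<^sup>2)) \<in> O(\<lambda>N. 1 / N)"
      unfolding F0_def by (rule bigo_inverse_of_bound[OF C(1)[OF _ zero_le_power2 s_range(2)]])
    moreover have "(\<lambda>N. eval_fps (bessel_fps ?c) ((s N)\<^sup>2) - eval_fps (bessel_fps ?c) ((1/2)\<^sup>2)) \<in> O(\<lambda>N. 1 / N)"
      by (rule bigo_compose_diff[OF has_field_derivative_eval_fps[OF bessel_conv_radius_less(1)] s2])
    ultimately show ?thesis
      using sum_in_bigo(1) by fastforce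
  qed
  have F1: "(\<lambda>N. F1 N - eval_fps (fps_deriv (bessel_fps ?c)) ((1/2)\<^sup>2)) \<in> O(\<lambda>N. 1 / N)"
  proof -
    have "(\<lambda>N. F1 N - eval_fps (fps_deriv (bessel_fps ?c)) ((s N)\<^sup>2)) \<in> O(\<lambda>N. 1 / N)"
      unfolding F1_def by (rule bigo_inverse_of_bound[OF C(2)[OF _ zero_le_power2 s_range(2)]])
    moreover have "(\<lambda>N. eval_fps (fps_deriv (bessel_fps ?c)) ((s N)\<^sup>2) - eval_fps (fps_deriv (bessel_fps ?c)) ((1/2)\<^sup>2)) \<in> O(\<lambda>N. 1 / N)"
      by (rule bigo_compose_diff[OF has_field_derivative_eval_fps[OF bessel_conv_radius_less(2)] s2])
    ultimately show ?thesis
      using sum_in_bigo(1) by fastforce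
  qed
  have "((\<lambda>x. x powr \<rho>) has_real_derivative \<rho> * (1/2) powr (\<rho> - 1)) (at (1/2))"
    by (auto intro!: derivative_eq_intros)
  then have sp: "(\<lambda>N. s N powr \<rho> - (1/2) powr \<rho>) \<in> O(\<lambda>N. 1 / N)"
    by (rule bigo_compose_diff[OF _ s])
  have "((\<lambda>x. x powr (1 - \<rho>)) has_real_derivative (1 - \<rho>) * 1 powr (1 - \<rho> - 1)) (at 1)"
    by (auto intro!: derivative_eq_intros)
  then have cp: "(\<lambda>N. co N powr (1 - \<rho>) - 1 powr (1 - \<rho>)) \<in> O(\<lambda>N. 1 / N)"
    by (rule bigo_compose_diff[OF _ co])
  note E = bigo_mult_diff[OF sp cp]
  have prefactor: "N powr \<rho> * (sin (1 / N / 2) powr \<rho> * cos (1 / N / 2) powr (1 - \<rho>)) = s N powr \<rho> * co N powr (1 - \<rho>)"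
    if "N \<ge> 1" for N
    using that s_range[OF that] by (simp add: s_def co_def powr_mult zero_less_mult_iff)
  have arg: "(sin (1 / N / 2))\<^sup>2 = (s N)\<^sup>2 / N\<^sup>2" if "N \<ge> 1" for N
    using that by (simp add: s_def power_mult_distrib)
  show ?L0
  proof (rule landau_o.big.in_cong[THEN iffD1, OF _ bigo_mult_diff[OF E F0]])
    show "eventually (\<lambda>N. s N powr \<rho> * co N powr (1 - \<rho>) * F0 N - (1/2) powr \<rho> * 1 powr (1 - \<rho>) * eval_fps (bessel_fps ?c) ((1/2)\<^sup>2)
        = N powr \<rho> * legendre_sol \<rho> N (1 / N) - bessel_sol \<rho> 1) at_top"
      using eventually_ge_at_top[of 1]
    proof eventually_elim
      case (elim N)
      have "N powr \<rho> * legendre_sol \<rho> N (1 / N)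
        = N powr \<rho> * (sin (1 / N / 2) powr \<rho> * cos (1 / N / 2) powr (1 - \<rho>)) *
          eval_fps (legendre_fps ?c N) ((sin (1 / N / 2))\<^sup>2)"
        unfolding legendre_sol_def by (simp only: mult.assoc)
      also have "\<dots> = s N powr \<rho> * co N powr (1 - \<rho>) * F0 N"
        unfolding prefactor[OF elim] unfolding arg[OF elim] F0_def ..
      finally show ?case
        by (simp add: bessel_sol_def)
    qed
  qed
  let ?q = "\<lambda>N. \<rho> * (co N * (1 / (2 * s N))) + (\<rho> - 1) * (sin (1 / N / 2) / (2 * N) * (1 / co N))"
  have inv_s: "(\<lambda>N. 1 / (2 * s N) - 1) \<in> O(\<lambda>N. 1 / N)"
    unfolding s_def by real_asymp
  have small: "(\<lambda>N. sin (1 / N / 2) / (2 * N) * (1 / co N) - 0) \<in> O(\<lambda>N. 1 / N)"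
    unfolding co_def by real_asymp
  have const: "(\<lambda>N::real. a - a) \<in> O(\<lambda>N. 1 / N)" for a :: real
    by simp
  have q: "(\<lambda>N. ?q N - (\<rho> * (1 * 1) + (\<rho> - 1) * 0)) \<in> O(\<lambda>N. 1 / N)"
    by (intro bigo_add_diff bigo_mult_diff const co inv_s small)
  have L1: "(\<lambda>N. s N powr \<rho> * co N powr (1 - \<rho>) * (?q N * F0 N + s N * co N * F1 N)
      - (1/2) powr \<rho> * 1 powr (1 - \<rho>) * ((\<rho> * (1 * 1) + (\<rho> - 1) * 0) * eval_fps (bessel_fps ?c) ((1/2)\<^sup>2)
        + 1/2 * 1 * eval_fps (fps_deriv (bessel_fps ?c)) ((1/2)\<^sup>2))) \<in> O(\<lambda>N. 1 / N)"
    by (intro bigo_add_diff bigo_mult_diff E q F0 F1 s co)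
  show ?L1
  proof (rule landau_o.big.in_cong[THEN iffD1, OF _ L1])
    show "eventually (\<lambda>N. s N powr \<rho> * co N powr (1 - \<rho>) * (?q N * F0 N + s N * co N * F1 N)
      - (1/2) powr \<rho> * 1 powr (1 - \<rho>) * ((\<rho> * (1 * 1) + (\<rho> - 1) * 0) * eval_fps (bessel_fps ?c) ((1/2)\<^sup>2)
        + 1/2 * 1 * eval_fps (fps_deriv (bessel_fps ?c)) ((1/2)\<^sup>2))
      = N powr \<rho> * legendre_sol_deriv \<rho> N (1 / N) / N - bessel_sol_deriv \<rho> 1) at_top"
      using eventually_ge_at_top[of 1]
    proof eventually_elim
      case (elim N)
      have q: "(\<rho> * cos (1 / N / 2) / sin (1 / N / 2) - (1 - \<rho>) * sin (1 / N / 2) / cos (1 / N / 2)) / 2 / N = ?q N"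
        using elim s_range[OF elim] by (simp add: s_def co_def field_simps zero_less_mult_iff)
      have F1': "sin (1 / N / 2) * cos (1 / N / 2) * eval_fps (fps_deriv (legendre_fps ?c N)) ((sin (1 / N / 2))\<^sup>2) / N = s N * co N * F1 N"
        unfolding arg[OF elim] F1_def using elim by (simp add: s_def co_def power2_eq_square)
      have "N powr \<rho> * legendre_sol_deriv \<rho> N (1 / N) / N
        = N powr \<rho> * (sin (1 / N / 2) powr \<rho> * cos (1 / N / 2) powr (1 - \<rho>)) *
          ((\<rho> * cos (1 / N / 2) / sin (1 / N / 2) - (1 - \<rho>) * sin (1 / N / 2) / cos (1 / N / 2)) / 2 / N *
            eval_fps (legendre_fps ?c N) ((sin (1 / N / 2))\<^sup>2) +
           sin (1 / N / 2) * cos (1 / N / 2) * eval_fps (fps_deriv (legendre_fps ?c N)) ((sin (1 / N / 2))\<^sup>2) / N)"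
      proof -
        have "x * (E * (p * f + g)) / N = x * E * (p / N * f + g / N)" for x E p f g :: real
          by (simp add: add_divide_distrib distrib_left mult.assoc)
        then show ?thesis
          unfolding legendre_sol_deriv_def .
      qed
      also have "\<dots> = s N powr \<rho> * co N powr (1 - \<rho>) * (?q N * F0 N + s N * co N * F1 N)"
        unfolding q F1' prefactor[OF elim] unfolding arg[OF elim] F0_def ..
      finally show ?case
        by (simp add: bessel_sol_deriv_def)
    qed
  qed
qed

lemma norm_phase_amplitude_diff_initial:
  assumes "N > 0"
  shows "norm (phase_amplitude N U U' (1 / N) - phase_amplitude 1 w w' 1)
    \<le> \<bar>U (1 / N) - w 1\<bar> + \<bar>U' (1 / N) / N - w' 1\<bar>"
proof -
  have "phase_amplitude N U U' (1 / N) - phase_amplitude 1 w w' 1 =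
      cis (- 1) * Complex (U (1 / N) - w 1) (- (U' (1 / N) / N - w' 1))"
    using assms by (simp add: phase_amplitude_def complex_eq_iff algebra_simps)
  then have "norm (phase_amplitude N U U' (1 / N) - phase_amplitude 1 w w' 1) =
      norm (Complex (U (1 / N) - w 1) (- (U' (1 / N) / N - w' 1)))"
    by (simp only: norm_mult norm_cis mult_1)
  also have "\<dots> \<le> \<bar>U (1 / N) - w 1\<bar> + \<bar>U' (1 / N) / N - w' 1\<bar>"
    using cmod_le[of "Complex (U (1 / N) - w 1) (- (U' (1 / N) / N - w' 1))"] by simp
  finally show ?thesis .
qed

text \<open>
  Followed from \<open>t = 1 / N\<close> on, the amplitude of \<open>N powr \<rho> * legendre_sol \<rho> N\<close> stays within \<open>O(1 / N)\<close> of that of the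
  Bessel solution at \<open>N t\<close>, which for \<open>t \<ge> a\<close> is within \<open>O(1 / (N a))\<close> of its limit \<open>A\<close> at infinity.  As \<open>A\<close>
  belongs to the Bessel solution, it depends neither on \<open>N\<close> nor on the interval.
\<close>

theorem legendre_sol_asymptotics:
  fixes \<rho> :: real
  assumes c: "\<And>k::nat. \<rho> + 1/2 + real k \<noteq> 0"
  obtains A where "A \<noteq> 0"
    "\<And>a b. 0 < a \<Longrightarrow> a < b \<Longrightarrow> b < pi \<Longrightarrow> \<exists>C N0. \<forall>N\<ge>N0. \<forall>t\<in>{a..b}.
      \<bar>N powr \<rho> * legendre_sol \<rho> N t - Re (cis (N * t) * A)\<bar> \<le> C / N \<and>
      \<bar>N powr \<rho> * legendre_sol_deriv \<rho> N t\<bar> \<le> C * N"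
proof -
  let ?\<mu> = "\<rho> * (\<rho> - 1)" and ?w = "bessel_sol \<rho>" and ?w' = "bessel_sol_deriv \<rho>"
  obtain x0 where x0: "x0 > 0" "?w x0 \<noteq> 0"
    using bessel_sol_nonzero by blast
  obtain A C0 where A: "A \<noteq> 0" and rate: "\<And>x. x \<ge> 1 \<Longrightarrow> norm (phase_amplitude 1 ?w ?w' x - A) \<le> C0 / x"
  proof (rule asymptotic_amplitude[of ?w ?w' "\<lambda>x. ?\<mu> / x\<^sup>2" "\<bar>?\<mu>\<bar>" x0])
    show "\<bar>?\<mu> / x\<^sup>2\<bar> \<le> \<bar>?\<mu>\<bar> / x\<^sup>2" for x
      by simp
  qed (use x0 bessel_sol_has_derivative bessel_sol_deriv_has_derivative[OF _ c] in auto)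
  have C0: "C0 \<ge> 0"
    using order_trans[OF norm_ge_zero rate[of 1]] by simp
  define Cw where "Cw = norm A + C0"
  have w_bound: "\<bar>?w x\<bar> \<le> Cw" if "x \<ge> 1" for x
  proof -
    have "\<bar>?w x\<bar> \<le> norm (phase_amplitude 1 ?w ?w' x)"
      by (rule abs_le_phase_amplitude)
    also have "\<dots> \<le> norm A + norm (phase_amplitude 1 ?w ?w' x - A)"
      by (metis norm_triangle_sub)
    also have "norm (phase_amplitude 1 ?w ?w' x - A) \<le> C0 / x"
      by (rule rate[OF that])
    also have "C0 / x \<le> C0"
      using that C0 divide_left_mono[of 1 x C0] by simp
    finally show ?thesis
      by (simp add: Cw_def)
  qed
  have "Cw \<ge> 0"
    using C0 by (simp add: Cw_def)
  obtain C1 where C1: "eventually (\<lambda>N. \<bar>N powr \<rho> * legendre_sol \<rho> N (1 / N) - ?w 1\<bar> \<le> C1 * \<bar>1 / N\<bar>) at_top"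
    using landau_o.bigE[OF legendre_bessel_initial(1)[of \<rho>]] by auto
  obtain C2 where C2: "eventually (\<lambda>N. \<bar>N powr \<rho> * legendre_sol_deriv \<rho> N (1 / N) / N - ?w' 1\<bar> \<le> C2 * \<bar>1 / N\<bar>) at_top"
    using landau_o.bigE[OF legendre_bessel_initial(2)[of \<rho>]] by auto
  have main: "\<exists>C N0. \<forall>N\<ge>N0. \<forall>t\<in>{a..b}.
      \<bar>N powr \<rho> * legendre_sol \<rho> N t - Re (cis (N * t) * A)\<bar> \<le> C / N \<and>
      \<bar>N powr \<rho> * legendre_sol_deriv \<rho> N t\<bar> \<le> C * N"
    if ab: "0 < a" "a < b" "b < pi" for a b
  proof -
    have b: "0 < b" "b < pi"
      using ab by auto
    obtain S where S: "S \<ge> 0" "\<And>x. 0 < x \<Longrightarrow> x \<le> b \<Longrightarrow> 1 / (sin x)\<^sup>2 \<le> S / x\<^sup>2"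
      "\<And>x. 0 < x \<Longrightarrow> x \<le> b \<Longrightarrow> \<bar>1 / (sin x)\<^sup>2 - 1 / x\<^sup>2\<bar> \<le> S"
      using inverse_sin_squared_bounds[OF b] by blast
    define E where "E = exp (\<bar>?\<mu>\<bar> * S) * (C1 + C2 + \<bar>?\<mu>\<bar> * S * Cw * b) + C0 / a"
    have "eventually (\<lambda>N. \<forall>t\<in>{a..b}.
      \<bar>N powr \<rho> * legendre_sol \<rho> N t - Re (cis (N * t) * A)\<bar> \<le> (norm A + \<bar>E\<bar>) / N \<and>
      \<bar>N powr \<rho> * legendre_sol_deriv \<rho> N t\<bar> \<le> (norm A + \<bar>E\<bar>) * N) at_top"
      using C1 C2 eventually_ge_at_top[of 1] eventually_ge_at_top[of "1 / a"]
    proof eventually_elim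
      case (elim N)
      have N: "N \<ge> 1" "N * a \<ge> 1"
        using elim ab by (auto simp: field_simps)
      let ?U = "\<lambda>t. N powr \<rho> * legendre_sol \<rho> N t" and ?U' = "\<lambda>t. N powr \<rho> * legendre_sol_deriv \<rho> N t"
      show ?case
      proof
        fix t assume t: "t \<in> {a..b}"
        have Nt: "1 \<le> N * a" "N * a \<le> N * t"
          using t N by auto
        have Nt': "1 \<le> N * t"
          using Nt by linarith
        have Nb: "1 \<le> N * b"
          using N ab mult_left_mono[of a b N] by linarith
        let ?Z = "phase_amplitude N ?U ?U' t"
        have "norm (?Z - phase_amplitude 1 ?w ?w' (N * t))
          \<le> exp (\<bar>?\<mu>\<bar> * S) * (norm (phase_amplitude N ?U ?U' (1 / N) - phase_amplitude 1 ?w ?w' 1) + \<bar>?\<mu>\<bar> * S * Cw * b / N)"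
        proof (rule amplitude_comparison[OF b _ Nb])
          show "(?U has_real_derivative ?U' x) (at x)" if "0 < x" "x < pi" for x
            by (rule DERIV_cmult[OF legendre_sol_has_derivative[OF that]])
          show "(?U' has_real_derivative (?\<mu> / (sin x)\<^sup>2 - N\<^sup>2) * ?U x) (at x)" if "0 < x" "x < pi" for x
            using DERIV_cmult[OF legendre_sol_deriv_has_derivative[OF that c], of "N powr \<rho>" N]
            by (simp add: mult_ac)
        qed (use N Nt' t S w_bound \<open>Cw \<ge> 0\<close> bessel_sol_has_derivative bessel_sol_deriv_has_derivative[OF _ c] in auto)
        also have "\<dots> \<le> exp (\<bar>?\<mu>\<bar> * S) * ((C1 + C2) / N + \<bar>?\<mu>\<bar> * S * Cw * b / N)"
        proof (intro mult_left_mono add_right_mono)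
          have "norm (phase_amplitude N ?U ?U' (1 / N) - phase_amplitude 1 ?w ?w' 1)
            \<le> \<bar>?U (1 / N) - ?w 1\<bar> + \<bar>?U' (1 / N) / N - ?w' 1\<bar>"
            using N by (intro norm_phase_amplitude_diff_initial) auto
          also have "\<dots> \<le> C1 * \<bar>1 / N\<bar> + C2 * \<bar>1 / N\<bar>"
            using elim by (intro add_mono) auto
          also have "\<dots> = (C1 + C2) / N"
            using N by (simp add: add_divide_distrib)
          finally show "norm (phase_amplitude N ?U ?U' (1 / N) - phase_amplitude 1 ?w ?w' 1) \<le> (C1 + C2) / N" .
        qed auto
        finally have 1: "norm (?Z - phase_amplitude 1 ?w ?w' (N * t))
            \<le> exp (\<bar>?\<mu>\<bar> * S) * ((C1 + C2) / N + \<bar>?\<mu>\<bar> * S * Cw * b / N)" .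
        have "norm (phase_amplitude 1 ?w ?w' (N * t) - A) \<le> C0 / (N * t)"
          using Nt by (intro rate) auto
        also have "\<dots> \<le> C0 / (N * a)"
          using Nt C0 by (intro divide_left_mono) auto
        finally have 2: "norm (phase_amplitude 1 ?w ?w' (N * t) - A) \<le> C0 / (N * a)" .
        have "norm (?Z - A) \<le> norm (?Z - phase_amplitude 1 ?w ?w' (N * t)) + norm (phase_amplitude 1 ?w ?w' (N * t) - A)"
          using norm_triangle_ineq[of "?Z - phase_amplitude 1 ?w ?w' (N * t)" "phase_amplitude 1 ?w ?w' (N * t) - A"] by simp
        also have "\<dots> \<le> exp (\<bar>?\<mu>\<bar> * S) * ((C1 + C2) / N + \<bar>?\<mu>\<bar> * S * Cw * b / N) + C0 / (N * a)"
          using 1 2 by (rule add_mono)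
        also have "\<dots> = E / N"
          using N ab by (simp add: E_def field_simps)
        finally have ZA: "norm (?Z - A) \<le> \<bar>E\<bar> / N"
          using N by (smt (verit) divide_right_mono)
        have "?U t - Re (cis (N * t) * A) = Re (cis (N * t) * (?Z - A))"
          using Re_phase_amplitude[of N t ?U ?U'] by (simp add: right_diff_distrib)
        then have "\<bar>?U t - Re (cis (N * t) * A)\<bar> \<le> norm (?Z - A)"
          using abs_Re_le_cmod[of "cis (N * t) * (?Z - A)"] by (simp add: norm_mult)
        also have "\<dots> \<le> \<bar>E\<bar> / N"
          by (rule ZA)
        also have "\<dots> \<le> (norm A + \<bar>E\<bar>) / N"
          using N by (intro divide_right_mono) auto
        finally have first: "\<bar>?U t - Re (cis (N * t) * A)\<bar> \<le> (norm A + \<bar>E\<bar>) / N" .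
        have "norm ?Z \<le> norm A + norm (?Z - A)"
          by (metis norm_triangle_sub)
        also have "norm (?Z - A) \<le> \<bar>E\<bar>"
          using ZA N divide_left_mono[of 1 N "\<bar>E\<bar>"] by simp
        finally have Z: "norm ?Z \<le> norm A + \<bar>E\<bar>" by simp
        have "\<bar>?U' t\<bar> \<le> N * norm ?Z"
          using N by (intro abs_deriv_le_phase_amplitude) auto
        also have "\<dots> \<le> N * (norm A + \<bar>E\<bar>)"
          using Z N by (intro mult_left_mono) auto
        finally have "\<bar>?U' t\<bar> \<le> (norm A + \<bar>E\<bar>) * N"
          by (simp only: mult.commute)
        with first show "\<bar>?U t - Re (cis (N * t) * A)\<bar> \<le> (norm A + \<bar>E\<bar>) / N \<and> \<bar>?U' t\<bar> \<le> (norm A + \<bar>E\<bar>) * N"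
          by blast
      qed
    qed
    then show ?thesis
      unfolding eventually_at_top_linorder by blast
  qed
  show thesis
    by (rule that[OF A main])
qed

section \<open>Zeros and small values\<close>

lemma legendre_sol_eq_0_iff:
  assumes "0 < t" "t < pi"
  shows "legendre_sol \<rho> N t = 0 \<longleftrightarrow> eval_fps (legendre_fps (\<rho> + 1/2) N) ((sin (t / 2))\<^sup>2) = 0"
  using half_angle_pos[OF assms] by (simp add: legendre_sol_def)

text \<open>
  A solution with a double zero would vanish identically to the left of it, but the hypergeometric
  series takes the value \<open>1\<close> at \<open>0\<close>.
\<close>

lemma legendre_sol_simple_zero:
  assumes c: "\<And>k::nat. \<rho> + 1/2 + real k \<noteq> 0" and N: "N > 0" and t: "0 < t" "t < pi"
    and zero: "legendre_sol \<rho> N t = 0"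
  shows "legendre_sol_deriv \<rho> N t \<noteq> 0"
proof
  assume zero': "legendre_sol_deriv \<rho> N t = 0"
  let ?z = "phase_amplitude N (legendre_sol \<rho> N) (legendre_sol_deriv \<rho> N)"
  let ?\<mu> = "\<rho> * (\<rho> - 1)"
  let ?K = "\<lambda>x. - (\<bar>?\<mu>\<bar> / N) * (cos x / sin x)" and ?k = "\<lambda>x. \<bar>?\<mu>\<bar> / N * (1 / (sin x)\<^sup>2)"
  let ?g = "\<lambda>x. ?\<mu> / (sin x)\<^sup>2 * legendre_sol \<rho> N x"
  have vanish: "legendre_sol \<rho> N x = 0" if x: "0 < x" "x \<le> t" for x
  proof -
    have "norm (?z x) \<le> exp (?K t - ?K x) * norm (?z t)"
    proof (rule gronwall_norm_backward[OF x(2), where k = ?k and z' = "\<lambda>x. cis (- N * x) * Complex 0 (- ?g x / N)"])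
      fix y assume "y \<in> {x..t}"
      then have y: "0 < y" "y < pi"
        using x t by auto
      then have sin_y: "sin y > 0"
        by (rule sin_gt_zero)
      show "(?z has_vector_derivative cis (- N * y) * Complex 0 (- ?g y / N)) (at y)"
        using legendre_sol_deriv_has_derivative[OF y c, of N]
        by (intro phase_amplitude_has_vector_derivative[where u = "legendre_sol \<rho> N" and u' = "legendre_sol_deriv \<rho> N",
              OF N legendre_sol_has_derivative[OF y]])
          (simp add: left_diff_distrib)
      have "((\<lambda>x. cos x / sin x) has_real_derivative - (1 / (sin y)\<^sup>2)) (at y)"
        using sin_y sin_cos_squared_add[of y]
        by (auto intro!: derivative_eq_intros simp: divide_simps power2_eq_square)
      from DERIV_cmult[OF this, of "- (\<bar>?\<mu>\<bar> / N)"] show "(?K has_real_derivative ?k y) (at y)"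
        by simp
      show "0 \<le> ?k y"
        using N by simp
      have "norm (cis (- N * y) * Complex 0 (- ?g y / N)) = ?k y * \<bar>legendre_sol \<rho> N y\<bar>"
        unfolding norm_phase_amplitude_derivative[OF N] by (simp add: abs_mult)
      also have "\<dots> \<le> ?k y * norm (?z y)"
        using N by (intro mult_left_mono abs_le_phase_amplitude) auto
      finally show "norm (cis (- N * y) * Complex 0 (- ?g y / N)) \<le> ?k y * norm (?z y)" .
    qed
    also have "norm (?z t) = 0"
      by (simp add: norm_phase_amplitude zero zero')
    finally show ?thesis
      using abs_le_phase_amplitude[of "legendre_sol \<rho> N" x N "legendre_sol_deriv \<rho> N"] by simp
  qed
  let ?F = "\<lambda>x. eval_fps (legendre_fps (\<rho> + 1/2) N) ((sin (x / 2))\<^sup>2)"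
  have "isCont (eval_fps (legendre_fps (\<rho> + 1/2) N)) 0"
    using has_field_derivative_eval_fps[OF legendre_conv_radius_less(1), of 0]
    by (intro DERIV_isCont) auto
  moreover have "isCont (\<lambda>x::real. (sin (x / 2))\<^sup>2) 0"
    by (intro continuous_intros) auto
  ultimately have "isCont ?F 0"
    using isCont_o2[of 0 "\<lambda>x::real. (sin (x / 2))\<^sup>2" "eval_fps (legendre_fps (\<rho> + 1/2) N)"] by simp
  moreover have "?F 0 = 1"
    by (simp add: eval_fps_at_0 legendre_fps_0)
  ultimately have "(?F \<longlongrightarrow> 1) (at_right 0)"
    unfolding isCont_def by (metis filterlim_at_split)
  then have "eventually (\<lambda>x. ?F x > 0) (at_right 0)"
    by (rule order_tendstoD) simp
  then obtain b where b: "b > 0" "\<And>x. 0 < x \<Longrightarrow> x < b \<Longrightarrow> ?F x > 0"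
    unfolding eventually_at_right_field by auto
  define x where "x = min (b / 2) t"
  have x: "0 < x" "x < b" "x \<le> t"
    using b(1) t by (auto simp: x_def)
  have "?F x = 0"
    using vanish[OF x(1,3)] legendre_sol_eq_0_iff[of x \<rho> N] x t by simp
  with b(2)[OF x(1,2)] show False
    by simp
qed

lemma scaled_legendre_has_derivative:
  assumes "\<beta> \<in> {0<..<1}"
  shows "((\<lambda>\<beta>. legendre_sol \<rho> N (pi * \<beta>)) has_real_derivative pi * legendre_sol_deriv \<rho> N (pi * \<beta>)) (at \<beta>)"
proof -
  have t: "0 < pi * \<beta>" "pi * \<beta> < pi"
    using assms by auto
  have lin: "((\<lambda>\<beta>. pi * \<beta>) has_real_derivative pi) (at \<beta>)"
    by (auto intro!: derivative_eq_intros)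
  show ?thesis
    using DERIV_chain2[where f = "legendre_sol \<rho> N", OF legendre_sol_has_derivative[OF t] lin] by (simp add: mult.commute)
qed

lemma continuous_on_scaled_legendre:
  "continuous_on {0<..<1} (\<lambda>\<beta>. legendre_sol \<rho> N (pi * \<beta>))"
  by (rule DERIV_continuous_on[OF has_field_derivative_at_within[OF scaled_legendre_has_derivative]])

text \<open>
  Simple zeros are isolated, and a discrete set is porous.
\<close>

lemma negligible_legendre_zeros:
  assumes c: "\<And>k::nat. \<rho> + 1/2 + real k \<noteq> 0" and N: "N > 0"
  shows "negligible {\<beta> \<in> {0<..<1}. legendre_sol \<rho> N (pi * \<beta>) = 0}" (is "negligible ?Z")
proof (rule proportional_holes_imp_negligible[where q = "1/4"])
  let ?g = "\<lambda>\<beta>. legendre_sol \<rho> N (pi * \<beta>)"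
  obtain T where T: "open T" "?g -` (- {0}) \<inter> {0<..<1} = T \<inter> {0<..<1}"
    using continuous_on_open_invariant[of "{0<..<1}" ?g] continuous_on_scaled_legendre by (metis open_Compl closed_singleton)
  have "?Z = {0<..<1} - T"
    using T(2) by auto
  then show "?Z \<in> sets lebesgue"
    using T(1) by auto
  fix x d :: real assume "x \<in> ?Z" "0 < d"
  then have x: "x \<in> {0<..<1}" "?g x = 0"
    by auto
  have "0 < pi * x" "pi * x < pi"
    using x by auto
  then have nz: "pi * legendre_sol_deriv \<rho> N (pi * x) \<noteq> 0"
    using legendre_sol_simple_zero[OF c N] x by simp
  obtain h where h: "\<And>z. ?g z - ?g x = h z * (z - x)" "isCont h x" "h x = pi * legendre_sol_deriv \<rho> N (pi * x)"
    using scaled_legendre_has_derivative[OF x(1), of \<rho> N] unfolding CARAT_DERIV by blast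
  have "\<bar>h x\<bar> > 0"
    using nz h(3) by simp
  then obtain e where e: "e > 0" "\<And>z. dist z x < e \<Longrightarrow> dist (h z) (h x) < \<bar>h x\<bar>"
    using h(2) unfolding continuous_at_eps_delta by blast
  then have e': "h z \<noteq> 0" if "dist z x < e" for z
    using e(2)[OF that] by (auto simp: dist_real_def)
  define r where "r = min e d / 2"
  have r: "0 < r" "r < e" "r < d"
    using e(1) \<open>0 < d\<close> by (auto simp: r_def)
  show "\<exists>r y. 0 < r \<and> r < d \<and> ball y (1/4 * r) \<subseteq> ball x r \<and> ball y (1/4 * r) \<inter> ?Z = {}"
  proof (intro exI conjI)
    show "ball (x + r / 2) (1/4 * r) \<subseteq> ball x r"
    proof
      fix z assume "z \<in> ball (x + r / 2) (1/4 * r)"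
      then have "\<bar>(x + r / 2) - z\<bar> < 1/4 * r"
        by (simp add: dist_real_def)
      then have "\<bar>x - z\<bar> < r"
        using r(1) by linarith
      then show "z \<in> ball x r"
        by (simp add: dist_real_def)
    qed
    have "?g z \<noteq> 0" if "z \<in> ball (x + r / 2) (1/4 * r)" for z
    proof -
      have "\<bar>(x + r / 2) - z\<bar> < 1/4 * r"
        using that by (simp add: dist_real_def)
      then have "\<bar>z - x\<bar> < e" "z \<noteq> x"
        using r(1,2) by linarith+
      then have "dist z x < e" "z \<noteq> x"
        by (simp_all add: dist_real_def)
      with e' h(1)[of z] x(2) show ?thesis
        by simp
    qed
    then show "ball (x + r / 2) (1/4 * r) \<inter> ?Z = {}"
      by auto
  qed (use r in auto)
qed simp

lemma cos_shift_half_pi: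
  fixes k :: int
  shows "cos (pi * of_int k + pi / 2 + e) = - (if even k then 1 else - 1) * sin e"
proof -
  have "cos (pi * of_int k + pi / 2 + e) = cos (pi * of_int k) * cos (pi / 2 + e) - sin (pi * of_int k) * sin (pi / 2 + e)"
    by (simp only: cos_add add.assoc)
  also have "sin (pi * of_int k) = 0"
    by (simp add: sin_npi_int)
  also have "cos (pi * of_int k) = (if even k then 1 else - 1)"
    by (simp add: cos_npi_int)
  also have "cos (pi / 2 + e) = - sin e"
    by (simp add: cos_add)
  finally show ?thesis by simp
qed

text \<open>
  If \<open>N \<beta>\<close> is within \<open>O(1 / N)\<close> of \<open>\<gamma>\<close> modulo \<open>1\<close>, then \<open>\<beta>\<close> is within \<open>O(1 / N\<^sup>2)\<close> of a zero \<open>x0\<close> of the cosine in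
  the asymptotic formula.  The formula forces opposite signs at two points \<open>x0 \<plusminus> s / N\<^sup>2\<close>, hence a zero \<open>z\<close>
  between them, and the bound on the derivative keeps the function small in a radius \<open>\<eta> / N\<^sup>2\<close>
  about \<open>z\<close>.  The ball about \<open>\<beta>\<close> and the hole in it shrink at the same rate \<open>1 / N\<^sup>2\<close>.
\<close>

lemma scaled_legendre_small_interval:
  fixes \<rho> a :: real
  assumes c: "\<And>k::nat. \<rho> + 1/2 + real k \<noteq> 0" and a: "0 < a" "a < 1/2" and "\<delta> > 0"
  obtains \<gamma> q D N0 where "q > 0" "D > 0" "N0 \<ge> 1"
    "\<And>N k \<beta>. \<lbrakk>N \<ge> N0; \<beta> \<in> {2 * a..1 - 2 * a}; \<bar>N * \<beta> - of_int k - \<gamma>\<bar> \<le> 10 / N\<rbrakk> \<Longrightarrow>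
      \<exists>y. ball y (q * (D / N\<^sup>2)) \<subseteq> ball \<beta> (D / N\<^sup>2) \<and>
          (\<forall>x\<in>ball y (q * (D / N\<^sup>2)). \<bar>legendre_sol \<rho> N (pi * x)\<bar> < \<delta> / N powr (\<rho> + 1))"
proof -
  obtain A where A: "A \<noteq> 0"
    and asym: "\<And>a b. 0 < a \<Longrightarrow> a < b \<Longrightarrow> b < pi \<Longrightarrow> \<exists>C N0. \<forall>N\<ge>N0. \<forall>t\<in>{a..b}.
      \<bar>N powr \<rho> * legendre_sol \<rho> N t - Re (cis (N * t) * A)\<bar> \<le> C / N \<and>
      \<bar>N powr \<rho> * legendre_sol_deriv \<rho> N t\<bar> \<le> C * N"
    using legendre_sol_asymptotics[OF c] by blast
  define R where "R = cmod A"
  define \<phi> where "\<phi> = Arg A"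
  have R: "R > 0" and A_eq: "A = of_real R * cis \<phi>"
    using A rcis_cmod_Arg[of A] by (simp_all add: R_def \<phi>_def rcis_def)
  have Re_A: "Re (cis x * A) = R * cos (x + \<phi>)" for x
    by (simp add: A_eq cos_add algebra_simps)
  have "0 < pi * a" "pi * a < pi * (1 - a)" "pi * (1 - a) < pi"
    using a by (auto intro!: mult_strict_left_mono)
  then obtain C' N' where "\<forall>N\<ge>N'. \<forall>t\<in>{pi * a..pi * (1 - a)}.
      \<bar>N powr \<rho> * legendre_sol \<rho> N t - Re (cis (N * t) * A)\<bar> \<le> C' / N \<and>
      \<bar>N powr \<rho> * legendre_sol_deriv \<rho> N t\<bar> \<le> C' * N"
    using asym by meson
  then have asym': "\<bar>N powr \<rho> * legendre_sol \<rho> N (pi * x) - R * cos (N * (pi * x) + \<phi>)\<bar> \<le> C' / N"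
    "\<bar>N powr \<rho> * legendre_sol_deriv \<rho> N (pi * x)\<bar> \<le> C' * N"
    if "N \<ge> N'" "x \<in> {a..1 - a}" for N x
    using that unfolding Re_A by auto
  define C where "C = max C' 0"
  have C: "C \<ge> 0" "C' \<le> C"
    by (auto simp: C_def)
  obtain c1 :: real where c1: "c1 > 0" "\<And>x. 0 < x \<Longrightarrow> x \<le> 1 \<Longrightarrow> c1 * x \<le> sin x"
    using sin_ge_linear[of 1] pi_gt3 by auto
  \<comment> \<open>large enough for \<open>R * sin (pi * s / N)\<close> to exceed the error \<open>C / N\<close> of the asymptotic formula\<close>
  define s where "s = (C + 1) / (R * c1 * pi)"
  have s: "s > 0" "R * (c1 * (pi * s)) > C"
    using C R c1 by (auto simp: s_def field_simps)
  \<comment> \<open>small enough for the Lipschitz constant \<open>pi * C * N\<close> to give less than \<open>\<delta> / N\<close> on a radius \<open>\<eta> / N\<^sup>2\<close>\<close>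
  define \<eta> where "\<eta> = \<delta> / (pi * C + 1)"
  have \<eta>: "\<eta> > 0" "pi * C * \<eta> < \<delta>"
  proof -
    have "pi * C + 1 > 0"
      using C by (simp add: add_nonneg_pos)
    then show "\<eta> > 0"
      using \<open>\<delta> > 0\<close> by (simp add: \<eta>_def)
    have "pi * C * \<delta> < \<delta> * (pi * C + 1)"
      using \<open>\<delta> > 0\<close> by (simp add: algebra_simps)
    then show "pi * C * \<eta> < \<delta>"
      using \<open>pi * C + 1 > 0\<close> by (simp add: \<eta>_def field_simps)
  qed
  \<comment> \<open>bounds for the distance from \<open>\<beta>\<close> to \<open>x0\<close>, from \<open>x0\<close> to the zero, and the radius of the hole, in units of \<open>1 / N\<^sup>2\<close>\<close>
  define D where "D = 10 + s + \<eta>"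
  have D: "D > 0"
    using s \<eta> by (simp add: D_def)
  define N0 where "N0 = max (max N' 1) (max (pi * s) (D / a))"
  \<comment> \<open>\<open>cos (N * pi * x + \<phi>)\<close> vanishes exactly when \<open>N * x - \<gamma>\<close> is an integer\<close>
  define \<gamma> where "\<gamma> = 1/2 - \<phi> / pi"
  show thesis
  proof (rule that[of "\<eta> / D" D N0 \<gamma>])
    show "\<eta> / D > 0" "D > 0" "N0 \<ge> 1"
      using \<eta> D by (auto simp: N0_def)
    fix N k \<beta> assume N_ge: "N \<ge> N0" and \<beta>: "\<beta> \<in> {2 * a..1 - 2 * a}" and approx: "\<bar>N * \<beta> - of_int k - \<gamma>\<bar> \<le> 10 / N"
    have N: "N \<ge> N'" "N \<ge> 1" "pi * s \<le> N" "D / a \<le> N"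
      using N_ge by (auto simp: N0_def)
    have qD: "\<eta> / D * (D / N\<^sup>2) = \<eta> / N\<^sup>2"
      using D by simp
    have DN: "D / N\<^sup>2 \<le> a"
    proof -
      have "D \<le> a * N"
        using N a by (simp add: field_simps)
      also have "\<dots> \<le> a * N\<^sup>2"
        using N a by (simp add: power2_eq_square)
      finally show ?thesis
        using N by (simp add: field_simps)
    qed
    have inside: "x \<in> {a..1 - a}" if "\<bar>x - \<beta>\<bar> \<le> D / N\<^sup>2" for x
      using that DN \<beta> by auto
    let ?g = "\<lambda>x. N powr \<rho> * legendre_sol \<rho> N (pi * x)"
    define x0 where "x0 = (of_int k + \<gamma>) / N"
    have x0: "\<bar>x0 - \<beta>\<bar> \<le> 10 / N\<^sup>2"
    proof -
      have "x0 - \<beta> = - (N * \<beta> - of_int k - \<gamma>) / N"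
        using N by (simp add: x0_def field_simps)
      then have "\<bar>x0 - \<beta>\<bar> = \<bar>N * \<beta> - of_int k - \<gamma>\<bar> / N"
        using N by (simp add: abs_divide)
      also have "\<dots> \<le> (10 / N) / N"
        using approx N by (intro divide_right_mono) auto
      finally show ?thesis
        by (simp add: power2_eq_square)
    qed
    define \<sigma> :: real where "\<sigma> = (if even k then 1 else - 1)"
    have near_x0: "\<bar>?g (x0 + e) + R * \<sigma> * sin (N * pi * e)\<bar> \<le> C / N" if "\<bar>e\<bar> \<le> s / N\<^sup>2" for e
    proof -
      have "\<bar>x0 + e - \<beta>\<bar> \<le> \<bar>x0 - \<beta>\<bar> + \<bar>e\<bar>"
        by simp
      also have "\<dots> \<le> 10 / N\<^sup>2 + s / N\<^sup>2"
        using x0 that by simp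
      also have "\<dots> \<le> D / N\<^sup>2"
        using \<eta> by (simp add: D_def add_divide_distrib)
      finally have x: "x0 + e \<in> {a..1 - a}"
        by (rule inside)
      have "N * (pi * (x0 + e)) + \<phi> = pi * of_int k + pi / 2 + N * pi * e"
        using N by (simp add: x0_def \<gamma>_def field_simps)
      then have "R * cos (N * (pi * (x0 + e)) + \<phi>) = - (R * \<sigma> * sin (N * pi * e))"
        by (simp only: cos_shift_half_pi \<sigma>_def)
      then have "\<bar>?g (x0 + e) + R * \<sigma> * sin (N * pi * e)\<bar> \<le> C' / N"
        using asym'(1)[OF N(1) x] by simp
      also have "\<dots> \<le> C / N"
        using C N by (intro divide_right_mono) auto
      finally show ?thesis .
    qed
    let ?e = "s / N\<^sup>2"
    have e_pos: "0 < ?e"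
      using s N by simp
    have big: "R * sin (N * pi * ?e) > C / N"
    proof -
      have eq: "N * pi * ?e = pi * s / N"
        using N by (simp add: power2_eq_square)
      have "c1 * (pi * s / N) \<le> sin (pi * s / N)"
        using N s by (intro c1(2)) (auto simp: field_simps)
      then have "R * (c1 * (pi * s / N)) \<le> R * sin (N * pi * ?e)"
        unfolding eq using R by (intro mult_left_mono) auto
      moreover have "R * (c1 * (pi * s / N)) = R * (c1 * (pi * s)) / N"
        by simp
      moreover have "\<dots> > C / N"
        using s N by (intro divide_strict_right_mono) auto
      ultimately show ?thesis
        by linarith
    qed
    have "\<exists>z. x0 - ?e \<le> z \<and> z \<le> x0 + ?e \<and> ?g z = 0"
    proof -
      have cont: "\<forall>x. x0 - ?e \<le> x \<and> x \<le> x0 + ?e \<longrightarrow> isCont (\<lambda>x. \<sigma> * ?g x) x"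
      proof (intro allI impI)
        fix x assume x: "x0 - ?e \<le> x \<and> x \<le> x0 + ?e"
        have "\<bar>x - \<beta>\<bar> \<le> 10 / N\<^sup>2 + s / N\<^sup>2"
          using x x0 by linarith
        also have "\<dots> \<le> D / N\<^sup>2"
          using \<eta> by (simp add: D_def add_divide_distrib)
        finally have "x \<in> {a..1 - a}"
          by (rule inside)
        then have "x \<in> {0<..<1}"
          using a by auto
        then show "isCont (\<lambda>x. \<sigma> * ?g x) x"
          by (intro isCont_mult continuous_const DERIV_isCont[OF scaled_legendre_has_derivative])
      qed
      have \<sigma>2: "\<sigma> * \<sigma> = 1" "\<bar>\<sigma>\<bar> = 1"
        by (auto simp: \<sigma>_def)
      have v: "\<bar>\<sigma> * ?g (x0 + e) + R * sin (N * pi * e)\<bar> \<le> C / N" if "\<bar>e\<bar> \<le> s / N\<^sup>2" for e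
      proof -
        have "\<sigma> * ?g (x0 + e) + R * sin (N * pi * e) = \<sigma> * (?g (x0 + e) + R * \<sigma> * sin (N * pi * e))"
          using \<sigma>2(1) by (simp add: distrib_left mult.left_commute[of \<sigma>] mult.assoc[symmetric])
        then show ?thesis
          using near_x0[OF that] \<sigma>2(2) by (simp add: abs_mult)
      qed
      have "\<bar>\<sigma> * ?g (x0 + ?e) + R * sin (N * pi * ?e)\<bar> \<le> C / N"
        by (rule v) (simp only: abs_of_pos[OF e_pos])
      then have "\<sigma> * ?g (x0 + ?e) \<le> 0"
        using big by linarith
      moreover have "\<bar>\<sigma> * ?g (x0 + - ?e) + R * sin (N * pi * - ?e)\<bar> \<le> C / N"
        by (rule v) (simp only: abs_minus_cancel abs_of_pos[OF e_pos])
      then have "0 \<le> \<sigma> * ?g (x0 - ?e)"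
        using big by (simp only: mult_minus_right sin_minus add_uminus_conv_diff)
      ultimately obtain z where "x0 - ?e \<le> z" "z \<le> x0 + ?e" "\<sigma> * ?g z = 0"
        using IVT2[of "\<lambda>x. \<sigma> * ?g x" "x0 + ?e" 0 "x0 - ?e"] cont e_pos by auto
      then show ?thesis
        using \<sigma>2 by (intro exI[of _ z]) auto
    qed
    then obtain z where z: "x0 - ?e \<le> z" "z \<le> x0 + ?e" "?g z = 0"
      by blast
    have z_near: "\<bar>z - \<beta>\<bar> \<le> 10 / N\<^sup>2 + s / N\<^sup>2"
      using z x0 by linarith
    have D_split: "D / N\<^sup>2 = 10 / N\<^sup>2 + s / N\<^sup>2 + \<eta> / N\<^sup>2"
      by (simp add: D_def add_divide_distrib)
    have near: "\<bar>x - \<beta>\<bar> < D / N\<^sup>2" if "\<bar>x - z\<bar> < \<eta> / N\<^sup>2" for x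
      using that z_near D_split by linarith
    have small: "\<bar>legendre_sol \<rho> N (pi * x)\<bar> < \<delta> / N powr (\<rho> + 1)" if x: "\<bar>x - z\<bar> < \<eta> / N\<^sup>2" for x
    proof -
      have "norm (?g x - ?g z) \<le> (pi * C * N) * norm (x - z)"
      proof (rule field_differentiable_bound[where S = "{a..1 - a}" and f' = "\<lambda>x. N powr \<rho> * (pi * legendre_sol_deriv \<rho> N (pi * x))"])
        fix y assume y: "y \<in> {a..1 - a}"
        then have "y \<in> {0<..<1}"
          using a by auto
        then show "(?g has_field_derivative N powr \<rho> * (pi * legendre_sol_deriv \<rho> N (pi * y))) (at y within {a..1 - a})"
          by (intro has_field_derivative_at_within[OF DERIV_cmult[OF scaled_legendre_has_derivative]])
        have "\<bar>N powr \<rho> * legendre_sol_deriv \<rho> N (pi * y)\<bar> \<le> C' * N"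
          using asym'(2)[OF N(1) y] .
        also have "\<dots> \<le> C * N"
          using C N by (intro mult_right_mono) auto
        finally have "pi * \<bar>N powr \<rho> * legendre_sol_deriv \<rho> N (pi * y)\<bar> \<le> pi * (C * N)"
          by simp
        then show "norm (N powr \<rho> * (pi * legendre_sol_deriv \<rho> N (pi * y))) \<le> pi * C * N"
          by (simp add: abs_mult mult_ac)
      next
        show "x \<in> {a..1 - a}"
          by (rule inside[OF less_imp_le[OF near[OF x]]])
        show "z \<in> {a..1 - a}"
          using \<eta> N by (intro inside[OF less_imp_le[OF near]]) simp
      qed simp
      also have "\<dots> \<le> (pi * C * N) * (\<eta> / N\<^sup>2)"
        using x C N by (intro mult_left_mono) auto
      also have "\<dots> = pi * C * \<eta> / N"
        using N by (simp add: power2_eq_square)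
      also have "\<dots> < \<delta> / N"
        using \<eta> N by (intro divide_strict_right_mono) auto
      finally have "N powr \<rho> * \<bar>legendre_sol \<rho> N (pi * x)\<bar> < \<delta> / N"
        using z(3) by (simp add: abs_mult)
      then show ?thesis
        using N by (simp add: powr_add field_simps)
    qed
    show "\<exists>y. ball y (\<eta> / D * (D / N\<^sup>2)) \<subseteq> ball \<beta> (D / N\<^sup>2) \<and>
          (\<forall>x\<in>ball y (\<eta> / D * (D / N\<^sup>2)). \<bar>legendre_sol \<rho> N (pi * x)\<bar> < \<delta> / N powr (\<rho> + 1))"
      unfolding qD using near small
      by (intro exI[of _ z]) (auto simp: dist_real_def abs_minus_commute)
  qed
qed

text \<open>
  Apart from the null set of zeros, the exceptional set is covered by countably many sets \<open>B m\<close>, each porous at its irrational points: the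
  inhomogeneous approximation theorem provides infinitely many \<open>j\<close> whose small interval is a hole near
  the given point.
\<close>

theorem AE_legendre_small_values:
  fixes \<rho> h :: real
  assumes c: "\<And>k::nat. \<rho> + 1/2 + real k \<noteq> 0" and h: "h > 0"
  shows "AE \<beta> in lebesgue. \<beta> \<in> {0<..<1} \<and> \<beta> \<notin> \<rat> \<longrightarrow>
    (\<forall>j::nat. legendre_sol \<rho> (real j + h) (pi * \<beta>) \<noteq> 0) \<and>
    (\<forall>\<delta>>0. \<forall>J. \<exists>j\<ge>J. \<bar>legendre_sol \<rho> (real j + h) (pi * \<beta>)\<bar> < \<delta> / (real j + h) powr (\<rho> + 1))"
proof -
  let ?Z = "\<lambda>j::nat. {\<beta> \<in> {0<..<1}. legendre_sol \<rho> (real j + h) (pi * \<beta>) = 0}"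
  define a where "a m = 1 / (2 * (real m + 3))" for m :: nat
  have a: "0 < a m" "a m < 1/2" for m
    by (auto simp: a_def field_simps)
  \<comment> \<open>the index \<open>m\<close> serves as constant, as starting degree and as distance from the end points at once\<close>
  define B where "B m = {\<beta> \<in> {2 * a m..1 - 2 * a m}. \<forall>j\<ge>m.
      (1 / real (Suc m)) / (real j + h) powr (\<rho> + 1) \<le> \<bar>legendre_sol \<rho> (real j + h) (pi * \<beta>)\<bar>}" for m
  have sub: "{2 * a m..1 - 2 * a m} \<subseteq> {0<..<1}" for m
    using a[of m] by auto
  have B_closed: "closed (B m)" for m
  proof -
    have "B m = (\<Inter>j\<in>{m..}. {\<beta> \<in> {2 * a m..1 - 2 * a m}.
      (1 / real (Suc m)) / (real j + h) powr (\<rho> + 1) \<le> \<bar>legendre_sol \<rho> (real j + h) (pi * \<beta>)\<bar>})"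
      by (auto simp: B_def)
    also have "closed \<dots>"
      by (intro closed_INT ballI continuous_on_closed_Collect_le continuous_intros
          continuous_on_subset[OF continuous_on_scaled_legendre sub])
    finally show ?thesis .
  qed
  have B_null: "negligible (B m - \<rat>)" for m
  proof -
    have pos: "0 < 1 / real (Suc m)"
      by simp
    obtain \<gamma> q D N0 where q: "q > 0" and D: "D > 0" and N0: "N0 \<ge> 1"
      and hole: "\<And>N k \<beta>. \<lbrakk>N \<ge> N0; \<beta> \<in> {2 * a m..1 - 2 * a m}; \<bar>N * \<beta> - of_int k - \<gamma>\<bar> \<le> 10 / N\<rbrakk> \<Longrightarrow>
        \<exists>y. ball y (q * (D / N\<^sup>2)) \<subseteq> ball \<beta> (D / N\<^sup>2) \<and>
          (\<forall>x\<in>ball y (q * (D / N\<^sup>2)). \<bar>legendre_sol \<rho> N (pi * x)\<bar> < (1 / real (Suc m)) / N powr (\<rho> + 1))"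
      by (rule scaled_legendre_small_interval[OF c a[of m] pos]) (rule that)
    show ?thesis
    proof (rule proportional_holes_imp_negligible[OF _ q])
      have "\<rat> \<in> sets (lebesgue :: real measure)"
        by (rule sets.countable[OF _ countable_rat]) auto
      then show "B m - \<rat> \<in> sets lebesgue"
        using B_closed[of m] by (intro sets.Diff) auto
      fix \<beta> d :: real assume \<beta>: "\<beta> \<in> B m - \<rat>" and d: "0 < d"
      obtain M :: nat where M: "max (max N0 h) (max (real m) (D / d + 1)) \<le> real M"
        using real_arch_simple by blast
      \<comment> \<open>for fixed \<open>\<beta>\<close> the shift \<open>h\<close> of the degree is absorbed into the inhomogeneous term\<close>
      obtain j k where jk: "M \<le> j" "\<bar>real j * \<beta> - of_int k - (\<gamma> - h * \<beta>)\<bar> \<le> 5 / real j"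
        using inhomogeneous_approximation[of \<beta> M "\<gamma> - h * \<beta>"] \<beta> by auto
      let ?N = "real j + h"
      have j: "N0 \<le> ?N" "h \<le> real j" "m \<le> j" "D / d + 1 \<le> real j" "1 \<le> real j"
        using M jk(1) N0 h by auto
      have "\<bar>?N * \<beta> - of_int k - \<gamma>\<bar> \<le> 5 / real j"
        using jk(2) by (simp add: algebra_simps)
      also have "\<dots> \<le> 10 / ?N"
        using j h by (simp add: field_simps)
      finally obtain y where y: "ball y (q * (D / ?N\<^sup>2)) \<subseteq> ball \<beta> (D / ?N\<^sup>2)"
        "\<forall>x\<in>ball y (q * (D / ?N\<^sup>2)). \<bar>legendre_sol \<rho> ?N (pi * x)\<bar> < (1 / real (Suc m)) / ?N powr (\<rho> + 1)"
        using hole[of ?N \<beta> k] \<beta> j by (auto simp: B_def)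
      have "D / ?N\<^sup>2 < d"
      proof -
        have "D / d < ?N"
          using j h by linarith
        also have "\<dots> \<le> ?N\<^sup>2"
          using j(5) h by (intro self_le_power) linarith+
        finally show ?thesis
          using d j h by (simp add: field_simps)
      qed
      moreover have "ball y (q * (D / ?N\<^sup>2)) \<inter> (B m - \<rat>) = {}"
        using y(2) j(3) by (fastforce simp: B_def)
      moreover have "0 < D / ?N\<^sup>2"
        using D j h by simp
      ultimately show "\<exists>r y. 0 < r \<and> r < d \<and> ball y (q * r) \<subseteq> ball \<beta> r \<and> ball y (q * r) \<inter> (B m - \<rat>) = {}"
        using y(1) by blast
    qed
  qed
  have "AE \<beta> in lebesgue. \<forall>j. \<beta> \<notin> ?Z j"
    unfolding AE_all_countable
  proof
    fix j :: nat
    have "negligible (?Z j)"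
      using h by (intro negligible_legendre_zeros[OF c]) auto
    then show "AE \<beta> in lebesgue. \<beta> \<notin> ?Z j"
      unfolding negligible_iff_null_sets by (rule AE_not_in)
  qed
  moreover have "AE \<beta> in lebesgue. \<forall>m. \<beta> \<notin> B m - \<rat>"
    using B_null unfolding AE_all_countable negligible_iff_null_sets by (intro allI AE_not_in)
  ultimately show ?thesis
  proof eventually_elim
    case (elim \<beta>)
    show ?case
    proof (intro impI conjI allI)
      assume \<beta>: "\<beta> \<in> {0<..<1} \<and> \<beta> \<notin> \<rat>"
      show "legendre_sol \<rho> (real j + h) (pi * \<beta>) \<noteq> 0" for j
        using elim(1) \<beta> by auto
      fix \<delta> :: real and J :: nat assume "\<delta> > 0"
      show "\<exists>j\<ge>J. \<bar>legendre_sol \<rho> (real j + h) (pi * \<beta>)\<bar> < \<delta> / (real j + h) powr (\<rho> + 1)"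
      proof (rule ccontr)
        assume contra: "\<not> ?thesis"
        obtain M :: nat where "max (max (1 / \<delta>) (real J)) (max (1 / \<beta>) (1 / (1 - \<beta>))) \<le> real M"
          using real_arch_simple by blast
        then have M: "1 / \<delta> \<le> real M" "J \<le> M" "1 / \<beta> \<le> real M" "1 / (1 - \<beta>) \<le> real M"
          by auto
        have "1 / real (Suc M) \<le> \<delta>"
          using M(1) \<open>\<delta> > 0\<close> by (simp add: field_simps)
        have le: "(1 / real (Suc M)) / (real j + h) powr (\<rho> + 1) \<le> \<bar>legendre_sol \<rho> (real j + h) (pi * \<beta>)\<bar>" if "j \<ge> M" for j
        proof -
          have "(1 / real (Suc M)) / (real j + h) powr (\<rho> + 1) \<le> \<delta> / (real j + h) powr (\<rho> + 1)"
            using \<open>1 / real (Suc M) \<le> \<delta>\<close> by (intro divide_right_mono) auto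
          also have "\<dots> \<le> \<bar>legendre_sol \<rho> (real j + h) (pi * \<beta>)\<bar>"
            using contra that M(2) by (auto simp: not_less)
          finally show ?thesis .
        qed
        have two_a: "2 * a M = 1 / (real M + 3)"
          by (simp add: a_def field_simps)
        have "1 \<le> \<beta> * (real M + 3)" "1 \<le> (1 - \<beta>) * (real M + 3)"
          using M(3,4) \<beta> by (auto simp: field_simps)
        then have "\<beta> \<in> {2 * a M..1 - 2 * a M}"
          unfolding two_a by (auto simp: field_simps)
        with le have "\<beta> \<in> B M"
          by (auto simp: B_def)
        with elim(2) \<beta> show False
          by auto
      qed
    qed
  qed
qed

section \<open>Green's identity for harmonic polynomials\<close>

text \<open>
  Directional derivatives of polynomials are again polynomials, so they can be differentiated
  repeatedly.
\<close>

lemma real_polynomial_function_has_derivative: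
  fixes p :: "'a::euclidean_space \<Rightarrow> real"
  assumes "real_polynomial_function p"
  shows "\<exists>p'. (\<forall>x. (p has_derivative p' x) (at x)) \<and> (\<forall>b. real_polynomial_function (\<lambda>x. p' x b))"
  using assms
proof (induction p rule: real_polynomial_function.induct)
  case (linear h)
  then show ?case
    by (intro exI[of _ "\<lambda>_. h"]) (auto intro: bounded_linear_imp_has_derivative)
next
  case (const c)
  show ?case
    by (intro exI[of _ "\<lambda>_ _. 0"]) auto
next
  case (add f g)
  then obtain f' g' where "\<And>x. (f has_derivative f' x) (at x)" "\<And>b. real_polynomial_function (\<lambda>x. f' x b)"
    "\<And>x. (g has_derivative g' x) (at x)" "\<And>b. real_polynomial_function (\<lambda>x. g' x b)"
    by blast
  then show ?case
    by (intro exI[of _ "\<lambda>x b. f' x b + g' x b"]) (auto intro: has_derivative_add)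
next
  case (mult f g)
  then obtain f' g' where "\<And>x. (f has_derivative f' x) (at x)" "\<And>b. real_polynomial_function (\<lambda>x. f' x b)"
    "\<And>x. (g has_derivative g' x) (at x)" "\<And>b. real_polynomial_function (\<lambda>x. g' x b)"
    by blast
  then show ?case
    using mult.hyps
    by (intro exI[of _ "\<lambda>x b. f x * g' x b + f' x b * g x"] conjI allI has_derivative_mult
        real_polynomial_function.intros(3,4)) auto
qed

lemma polynomial_function_complex_iff:
  fixes p :: "'a::euclidean_space \<Rightarrow> complex"
  shows "polynomial_function p \<longleftrightarrow> real_polynomial_function (\<lambda>x. Re (p x)) \<and> real_polynomial_function (\<lambda>x. Im (p x))"
  unfolding polynomial_function_iff_Basis_inner by (simp add: Basis_complex_def inner_complex_def)

lemma polynomial_function_complex_mult: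
  fixes p q :: "'a::euclidean_space \<Rightarrow> complex"
  assumes "polynomial_function p" "polynomial_function q"
  shows "polynomial_function (\<lambda>x. p x * q x)"
  using assms unfolding polynomial_function_complex_iff by auto

lemma polynomial_function_cnj:
  fixes p :: "'a::euclidean_space \<Rightarrow> complex"
  assumes "polynomial_function p"
  shows "polynomial_function (\<lambda>x. cnj (p x))"
  using assms unfolding polynomial_function_complex_iff by auto

lemma polynomial_function_frechet_derivative:
  fixes p :: "'a::euclidean_space \<Rightarrow> complex"
  assumes "polynomial_function p"
  shows "(p has_derivative frechet_derivative p (at x)) (at x)"
    and "polynomial_function (\<lambda>x. frechet_derivative p (at x) b)"
proof -
  have re: "real_polynomial_function (\<lambda>x. Re (p x))" and im: "real_polynomial_function (\<lambda>x. Im (p x))"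
    using assms unfolding polynomial_function_complex_iff by auto
  obtain r' where r: "\<And>x. ((\<lambda>x. Re (p x)) has_derivative r' x) (at x)" "\<And>b. real_polynomial_function (\<lambda>x. r' x b)"
    using real_polynomial_function_has_derivative[OF re] by blast
  obtain i' where i: "\<And>x. ((\<lambda>x. Im (p x)) has_derivative i' x) (at x)" "\<And>b. real_polynomial_function (\<lambda>x. i' x b)"
    using real_polynomial_function_has_derivative[OF im] by blast
  have D: "(p has_derivative (\<lambda>b. of_real (r' x b) + \<i> * of_real (i' x b))) (at x)" for x
  proof -
    have "((\<lambda>x. of_real (Re (p x)) + \<i> * of_real (Im (p x))) has_derivative (\<lambda>b. of_real (r' x b) + \<i> * of_real (i' x b))) (at x)"
      by (intro has_derivative_add has_derivative_mult_right has_derivative_of_real r i)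
    then show ?thesis
      by (simp flip: complex_eq)
  qed
  have eq: "frechet_derivative p (at x) = (\<lambda>b. of_real (r' x b) + \<i> * of_real (i' x b))" for x
    using frechet_derivative_at[OF D] by simp
  show "(p has_derivative frechet_derivative p (at x)) (at x)"
    unfolding eq by (rule D)
  show "polynomial_function (\<lambda>x. frechet_derivative p (at x) b)"
    unfolding eq polynomial_function_complex_iff using r(2) i(2) by simp
qed

lemma polynomial_function_line_derivative:
  fixes p :: "'a::euclidean_space \<Rightarrow> complex"
  assumes "polynomial_function p"
  shows "((\<lambda>t. p (x + t *\<^sub>R b)) has_vector_derivative frechet_derivative p (at (x + t *\<^sub>R b)) b) (at t)"
proof -
  have "((\<lambda>t. x + t *\<^sub>R b) has_derivative (\<lambda>h. h *\<^sub>R b)) (at t)"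
    by (auto intro!: derivative_eq_intros)
  from has_derivative_compose[OF this polynomial_function_frechet_derivative(1)[OF assms]]
  have "((\<lambda>t. p (x + t *\<^sub>R b)) has_derivative (\<lambda>h. frechet_derivative p (at (x + t *\<^sub>R b)) (h *\<^sub>R b))) (at t)" .
  moreover have "linear (frechet_derivative p (at (x + t *\<^sub>R b)))"
    using polynomial_function_frechet_derivative(1)[OF assms] has_derivative_linear by blast
  ultimately show ?thesis
    by (simp add: has_vector_derivative_def linear_cmul)
qed

lemma continuous_on_ball_bound:
  fixes f :: "'a::euclidean_space \<Rightarrow> complex"
  assumes "continuous_on (cball 0 1) f"
  obtains K where "K > 0" "\<And>x. norm x \<le> 1 \<Longrightarrow> norm (f x) \<le> K"
proof -
  have "bounded (f ` cball 0 1)"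
    using assms by (intro compact_imp_bounded compact_continuous_image) auto
  then obtain K where "K > 0" "\<forall>y\<in>f ` cball 0 1. norm y \<le> K"
    unfolding bounded_pos by blast
  then show thesis
    by (intro that[of K]) auto
qed

lemma emeasure_lborel_cball_less_top: "emeasure lborel (cball (c::'a::euclidean_space) r) < top"
  using emeasure_bounded_finite[OF bounded_cball, of c r] by simp

text \<open>
  The difference quotients of \<open>F\<close> in the direction \<open>b\<close> have integral \<open>0\<close> by translation invariance.  By
  the mean value inequality they are dominated by a multiple of the indicator of a ball.
\<close>

lemma integral_directional_derivative_eq_0:
  fixes F F' :: "'a::euclidean_space \<Rightarrow> complex"
  assumes deriv: "\<And>x t. ((\<lambda>t. F (x + t *\<^sub>R b)) has_vector_derivative F' (x + t *\<^sub>R b)) (at t)"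
    and contF: "continuous_on UNIV F" and contF': "continuous_on UNIV F'"
    and supp: "\<And>x. norm x > 1 \<Longrightarrow> F x = 0" "\<And>x. norm x > 1 \<Longrightarrow> F' x = 0"
  shows "(LINT x|lborel. F' x) = 0"
proof -
  obtain M where M: "\<And>x. norm (F' x) \<le> M" "M > 0"
  proof -
    obtain K where K: "K > 0" "\<And>x. norm x \<le> 1 \<Longrightarrow> norm (F' x) \<le> K"
      using continuous_on_ball_bound[OF continuous_on_subset[OF contF' subset_UNIV]] by blast
    then have "norm (F' x) \<le> K" for x
      using supp(2)[of x] by (cases "norm x \<le> 1") auto
    then show thesis using that K(1) by blast
  qed
  have F_int: "integrable lborel F"
  proof -
    have "integrable lborel (\<lambda>x. indicator (cball 0 1) x *\<^sub>R F x)"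
      using borel_integrable_compact[OF compact_cball continuous_on_subset[OF contF]] by auto
    also have "(\<lambda>x. indicator (cball 0 1) x *\<^sub>R F x) = F"
      using supp(1) by (auto simp: fun_eq_iff indicator_def not_le)
    finally show ?thesis .
  qed
  define h where "h n = 1 / real (Suc n)" for n
  have h: "h n > 0" "h n \<le> 1" for n
    by (auto simp: h_def)
  define G where "G n x = (F (x + h n *\<^sub>R b) - F x) /\<^sub>R h n" for n x
  have shift_int: "integrable lborel (\<lambda>x. F (x + c))" "(LINT x|lborel. F (x + c)) = (LINT x|lborel. F x)" for c
  proof -
    have dist: "distr lborel borel (\<lambda>x. x + c) = (lborel :: 'a measure)"
    proof -
      have "(\<lambda>x. x + c) = (+) c"
        by (auto simp: fun_eq_iff add.commute)
      then show ?thesis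
        by (simp add: lborel_distr_plus)
    qed
    have meas: "F \<in> borel_measurable borel"
      using contF by (rule borel_measurable_continuous_onI)
    show "integrable lborel (\<lambda>x. F (x + c))"
      using F_int integrable_distr_eq[of "\<lambda>x. x + c" lborel borel F] meas by (simp add: dist)
    show "(LINT x|lborel. F (x + c)) = (LINT x|lborel. F x)"
      using integral_distr[of "\<lambda>x. x + c" lborel borel F] meas by (simp add: dist)
  qed
  have G_int: "(LINT x|lborel. G n x) = 0" for n
    unfolding G_def using shift_int F_int by simp
  have "(\<lambda>n. LINT x|lborel. G n x) \<longlonglongrightarrow> (LINT x|lborel. F' x)"
  proof (rule integral_dominated_convergence[where w = "\<lambda>x. M * indicator (cball 0 (1 + norm b)) x"])
    show "F' \<in> borel_measurable lborel"
      using contF' by (simp add: borel_measurable_continuous_onI)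
    show "G n \<in> borel_measurable lborel" for n
      unfolding G_def[abs_def] using shift_int(1) F_int by (intro borel_measurable_integrable) auto
    show "integrable lborel (\<lambda>x. M * indicator (cball 0 (1 + norm b)) x)"
      by (intro integrable_mult_right integrable_real_indicator) (auto simp: emeasure_lborel_cball_less_top)
    show "AE x in lborel. (\<lambda>n. G n x) \<longlonglongrightarrow> F' x"
    proof (rule AE_I2)
      fix x
      have "((\<lambda>t. (F (x + t *\<^sub>R b) - F x) /\<^sub>R t) \<longlongrightarrow> F' x) (at 0)"
      proof -
        have "((\<lambda>t. norm (F (x + t *\<^sub>R b) - F x - t *\<^sub>R F' x) / norm t) \<longlongrightarrow> 0) (at 0)"
          using deriv[of x 0] unfolding has_vector_derivative_def has_derivative_at by simp
        moreover have "eventually (\<lambda>t. norm (F (x + t *\<^sub>R b) - F x - t *\<^sub>R F' x) / norm t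
            = norm ((F (x + t *\<^sub>R b) - F x) /\<^sub>R t - F' x)) (at 0)"
        proof (rule eventually_mono[OF eventually_neq_at_within[of 0]])
          fix t :: real assume "t \<noteq> 0"
          then have "(F (x + t *\<^sub>R b) - F x) /\<^sub>R t - F' x = (F (x + t *\<^sub>R b) - F x - t *\<^sub>R F' x) /\<^sub>R t"
            by (simp add: scaleR_diff_right)
          then show "norm (F (x + t *\<^sub>R b) - F x - t *\<^sub>R F' x) / norm t
            = norm ((F (x + t *\<^sub>R b) - F x) /\<^sub>R t - F' x)"
            by (simp add: divide_inverse_commute)
        qed
        ultimately have "((\<lambda>t. norm ((F (x + t *\<^sub>R b) - F x) /\<^sub>R t - F' x)) \<longlongrightarrow> 0) (at 0)"
          by (rule Lim_transform_eventually)
        then show ?thesis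
          using Lim_null tendsto_norm_zero_iff by blast
      qed
      moreover have "filterlim h (at 0) sequentially"
        unfolding h_def by real_asymp
      ultimately show "(\<lambda>n. G n x) \<longlonglongrightarrow> F' x"
        unfolding G_def by (rule filterlim_compose)
    qed
    show "AE x in lborel. norm (G n x) \<le> M * indicator (cball 0 (1 + norm b)) x" for n
    proof (rule AE_I2)
      fix x
      show "norm (G n x) \<le> M * indicator (cball 0 (1 + norm b)) x"
      proof (cases "x \<in> cball 0 (1 + norm b)")
        case True
        have "norm (F (x + h n *\<^sub>R b) - F (x + 0 *\<^sub>R b)) \<le> M * h n - M * 0"
        proof (rule differentiable_bound_general[where f' = "\<lambda>t. F' (x + t *\<^sub>R b)" and \<phi>' = "\<lambda>_. M"])
          show "continuous_on {0..h n} (\<lambda>t. F (x + t *\<^sub>R b))"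
            by (intro continuous_on_compose2[OF contF] continuous_intros) auto
          show "((\<lambda>t. M * t) has_vector_derivative M) (at t)" for t
            by (auto intro!: derivative_eq_intros)
        qed (use h M deriv in \<open>auto intro!: continuous_intros\<close>)
        then have "norm (F (x + h n *\<^sub>R b) - F x) \<le> M * h n"
          by simp
        then show ?thesis
        proof -
          have "norm (G n x) = norm (F (x + h n *\<^sub>R b) - F x) / h n"
            using h[of n] by (simp add: G_def divide_inverse_commute)
          also have "\<dots> \<le> M"
            using \<open>norm (F (x + h n *\<^sub>R b) - F x) \<le> M * h n\<close> h[of n] by (simp add: divide_le_eq)
          finally show ?thesis
            using True by simp
        qed
      next
        case False
        then have nx: "norm x > 1 + norm b"
          by simp
        have "norm (h n *\<^sub>R b) \<le> norm b"
          using h[of n] by (simp add: mult_left_le_one_le)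
        then have "norm (x + h n *\<^sub>R b) > 1"
          using nx norm_diff_ineq[of x "h n *\<^sub>R b"] by linarith
        moreover have "norm x > 1"
          using nx norm_ge_zero[of b] by linarith
        ultimately show ?thesis
          using False by (simp add: G_def supp)
      qed
    qed
  qed
  then show ?thesis
    using G_int LIMSEQ_unique[of "\<lambda>n. 0" 0] by (simp add: LIMSEQ_const_iff)
qed

lemma max_0_square_has_derivative:
  fixes u :: real
  shows "((\<lambda>u. (max 0 u)\<^sup>2) has_real_derivative 2 * max 0 u) (at u)"
proof -
  consider "u > 0" | "u < 0" | "u = 0" by linarith
  then show ?thesis
  proof cases
    case 1
    have "((\<lambda>u. u\<^sup>2) has_real_derivative 2 * max 0 u) (at u)"
      using 1 by (auto intro!: derivative_eq_intros)
    moreover have "eventually (\<lambda>u. u\<^sup>2 = (max 0 u)\<^sup>2) (nhds u)"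
      using eventually_nhds_in_open[of "{0<..}" u] 1 by (auto elim: eventually_mono)
    ultimately show ?thesis
      by (subst DERIV_cong_ev[OF refl _ refl, symmetric]) auto
  next
    case 2
    have "((\<lambda>u. 0) has_real_derivative 2 * max 0 u) (at u)"
      using 2 by (auto intro!: derivative_eq_intros)
    moreover have "eventually (\<lambda>u. 0 = (max 0 u)\<^sup>2) (nhds u)"
      using eventually_nhds_in_open[of "{..<0}" u] 2 by (auto elim: eventually_mono)
    ultimately show ?thesis
      by (subst DERIV_cong_ev[OF refl _ refl, symmetric]) auto
  next
    case 3
    have "((\<lambda>h. (max 0 h)\<^sup>2 / h) \<longlongrightarrow> 0) (at (0::real))"
    proof (rule Lim_null_comparison)
      show "eventually (\<lambda>h::real. norm ((max 0 h)\<^sup>2 / h) \<le> \<bar>h\<bar>) (at 0)"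
        by (intro always_eventually allI) (auto simp: max_def power2_eq_square)
      show "((\<lambda>h::real. \<bar>h\<bar>) \<longlongrightarrow> 0) (at 0)"
        by (rule tendsto_eq_intros) auto
    qed
    then show ?thesis
      using 3 by (simp add: DERIV_def)
  qed
qed

text \<open>
  A compactly supported weight that is continuously differentiable, as one integration by parts requires,
  and whose gradient is again a multiple of \<open>cutoff\<close>.
\<close>

definition cutoff_sq :: "'a::euclidean_space \<Rightarrow> real" where
  "cutoff_sq x = (max 0 (1 - x \<bullet> x))\<^sup>2"

definition cutoff :: "'a::euclidean_space \<Rightarrow> real" where
  "cutoff x = max 0 (1 - x \<bullet> x)"

lemma continuous_on_cutoff: "continuous_on A cutoff_sq" "continuous_on A cutoff"
  unfolding cutoff_sq_def[abs_def] cutoff_def[abs_def] by (intro continuous_intros)+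

lemma cutoff_eq_0: "norm x > 1 \<Longrightarrow> cutoff_sq x = 0" "norm x > 1 \<Longrightarrow> cutoff x = 0"
proof -
  assume "norm x > 1"
  then have "x \<bullet> x > 1"
    by (simp add: norm_eq_sqrt_inner)
  then show "cutoff_sq x = 0" "cutoff x = 0"
    by (simp_all add: cutoff_sq_def cutoff_def)
qed

lemma cutoff_sq_line_derivative:
  "((\<lambda>t. cutoff_sq (x + t *\<^sub>R b)) has_real_derivative - 4 * (b \<bullet> (x + t *\<^sub>R b)) * cutoff (x + t *\<^sub>R b)) (at t)"
proof -
  have "((\<lambda>t. 1 - (x + t *\<^sub>R b) \<bullet> (x + t *\<^sub>R b)) has_real_derivative - 2 * (b \<bullet> (x + t *\<^sub>R b))) (at t)"
    by (auto intro!: derivative_eq_intros simp: has_field_derivative_def inner_commute algebra_simps)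
  from DERIV_chain2[OF max_0_square_has_derivative this] show ?thesis
    by (simp add: cutoff_sq_def cutoff_def mult_ac)
qed

lemma solid_harmonicsD:
  assumes "p \<in> solid_harmonics j"
  shows "polynomial_function p" "p (c *\<^sub>R x) = c ^ j *\<^sub>R p x" "laplacian p x = 0"
  using assms by (auto simp: solid_harmonics_def)

lemma continuous_on_solid_harmonic:
  assumes "p \<in> solid_harmonics j"
  shows "continuous_on A p"
  using solid_harmonicsD(1)[OF assms] by (rule continuous_on_polymonial_function)

text \<open>
  Differentiate \<open>p (t x) = t ^ j * p x\<close> in \<open>t\<close> at \<open>1\<close>.
\<close>

lemma euler_homogeneous:
  fixes p :: "'a::euclidean_space \<Rightarrow> complex"
  assumes p: "polynomial_function p" and hom: "\<And>c x. p (c *\<^sub>R x) = c ^ j *\<^sub>R p x"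
  shows "(\<Sum>b\<in>Basis. (x \<bullet> b) *\<^sub>R frechet_derivative p (at x) b) = real j *\<^sub>R p x"
proof -
  let ?D = "frechet_derivative p (at x)"
  have lin: "linear ?D"
    using polynomial_function_frechet_derivative(1)[OF p] has_derivative_linear by blast
  have "((\<lambda>t. p (0 + t *\<^sub>R x)) has_vector_derivative frechet_derivative p (at (0 + 1 *\<^sub>R x)) x) (at 1)"
    by (rule polynomial_function_line_derivative[OF p])
  then have 1: "((\<lambda>t. t ^ j *\<^sub>R p x) has_vector_derivative ?D x) (at 1)"
    by (simp add: hom)
  have "((\<lambda>t::real. t ^ j) has_real_derivative real j) (at 1)"
    by (auto intro!: derivative_eq_intros)
  then have 2: "((\<lambda>t. t ^ j *\<^sub>R p x) has_vector_derivative real j *\<^sub>R p x) (at 1)"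
    by (intro has_vector_derivative_scaleR[where g' = 0, simplified]) auto
  have "?D x = real j *\<^sub>R p x"
    using vector_derivative_unique_at[OF 1 2] .
  moreover have "?D x = ?D (\<Sum>b\<in>Basis. (x \<bullet> b) *\<^sub>R b)"
    by (simp add: euclidean_representation)
  then have "?D x = (\<Sum>b\<in>Basis. (x \<bullet> b) *\<^sub>R ?D b)"
    by (simp add: linear_sum[OF lin] linear_cmul[OF lin])
  ultimately show ?thesis
    by simp
qed

lemma integrable_cutoff:
  fixes f :: "'a::euclidean_space \<Rightarrow> complex"
  assumes "continuous_on UNIV f"
  shows "integrable lborel (\<lambda>x. cutoff_sq x *\<^sub>R f x)" "integrable lborel (\<lambda>x. cutoff x *\<^sub>R f x)"
proof -
  have "integrable lborel (\<lambda>x. w x *\<^sub>R f x)"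
    if "continuous_on UNIV w" and supp: "\<And>x. norm x > 1 \<Longrightarrow> w x = 0" for w :: "'a \<Rightarrow> real"
  proof -
    have "continuous_on (cball 0 1) (\<lambda>x. w x *\<^sub>R f x)"
      by (intro continuous_intros continuous_on_subset[OF assms] continuous_on_subset[OF that(1)]) auto
    then have "integrable lborel (\<lambda>x. indicator (cball 0 1) x *\<^sub>R (w x *\<^sub>R f x))"
      by (intro borel_integrable_compact) auto
    also have "(\<lambda>x. indicator (cball 0 1) x *\<^sub>R (w x *\<^sub>R f x)) = (\<lambda>x. w x *\<^sub>R f x)"
    proof
      fix x
      show "indicator (cball 0 1) x *\<^sub>R (w x *\<^sub>R f x) = w x *\<^sub>R f x"
        using supp[of x] by (cases "norm x \<le> 1") auto
    qed
    finally show ?thesis .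
  qed
  then show "integrable lborel (\<lambda>x. cutoff_sq x *\<^sub>R f x)" "integrable lborel (\<lambda>x. cutoff x *\<^sub>R f x)"
    using continuous_on_cutoff cutoff_eq_0 by blast+
qed

text \<open>
  Green's identity with the weight \<open>cutoff_sq\<close>: the divergence of \<open>cutoff_sq * q * \<nabla>p\<close> has integral \<open>0\<close>, the
  term with \<open>\<Delta>p\<close> vanishes, and the gradient \<open>- 4 * cutoff * x\<close> of the radial weight meets \<open>\<nabla>p\<close> in the
  radial derivative, which is \<open>j * p\<close> by homogeneity.
\<close>

lemma dirichlet_form_harmonic:
  fixes p q :: "'a::euclidean_space \<Rightarrow> complex"
  assumes p: "p \<in> solid_harmonics j" and q: "polynomial_function q"
  shows "(LINT x|lborel. cutoff_sq x *\<^sub>R (\<Sum>b\<in>Basis. frechet_derivative p (at x) b * frechet_derivative q (at x) b))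
    = 4 * real j * (LINT x|lborel. cutoff x *\<^sub>R (p x * q x))"
proof -
  note pp = solid_harmonicsD(1)[OF p]
  let ?D = "\<lambda>p b x. frechet_derivative p (at x) b"
  have poly: "polynomial_function (?D p b)" "polynomial_function (?D q b)" for b
    using polynomial_function_frechet_derivative(2) pp q by auto
  have cont: "continuous_on UNIV p" "continuous_on UNIV q" "continuous_on UNIV (?D p b)" "continuous_on UNIV (?D q b)"
    "continuous_on UNIV (?D (?D p b) b)" for b
    using pp q poly polynomial_function_frechet_derivative(2) continuous_on_polymonial_function by blast+
  let ?F' = "\<lambda>b x. cutoff_sq x *\<^sub>R (?D p b x * ?D q b x + ?D (?D p b) b x * q x)
      + cutoff x *\<^sub>R ((- 4 * (b \<bullet> x)) *\<^sub>R (?D p b x * q x))"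
  have int1: "integrable lborel (\<lambda>x. cutoff_sq x *\<^sub>R (?D p b x * ?D q b x + ?D (?D p b) b x * q x))" for b
    by (intro integrable_cutoff continuous_intros cont)
  have int2: "integrable lborel (\<lambda>x. cutoff x *\<^sub>R ((- 4 * (b \<bullet> x)) *\<^sub>R (?D p b x * q x)))" for b
    by (intro integrable_cutoff continuous_intros cont)
  have zero: "(LINT x|lborel. ?F' b x) = 0" for b
  proof (rule integral_directional_derivative_eq_0[where F = "\<lambda>x. cutoff_sq x *\<^sub>R (?D p b x * q x)" and b = b])
    fix x t
    show "((\<lambda>t. cutoff_sq (x + t *\<^sub>R b) *\<^sub>R (?D p b (x + t *\<^sub>R b) * q (x + t *\<^sub>R b))) has_vector_derivative ?F' b (x + t *\<^sub>R b)) (at t)"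
      by (rule has_vector_derivative_eq_rhs[OF has_vector_derivative_scaleR[OF cutoff_sq_line_derivative
            has_vector_derivative_mult[OF polynomial_function_line_derivative[OF poly(1)] polynomial_function_line_derivative[OF q]]]])
        (simp add: algebra_simps)
    show "continuous_on UNIV (\<lambda>x. cutoff_sq x *\<^sub>R (?D p b x * q x))"
      by (intro continuous_intros cont continuous_on_cutoff)
    show "continuous_on UNIV (?F' b)"
      by (intro continuous_intros cont continuous_on_cutoff)
  qed (simp_all add: cutoff_eq_0)
  have "0 = (\<Sum>b\<in>Basis. LINT x|lborel. ?F' b x)"
    by (simp only: zero sum.neutral_const)
  also have "\<dots> = (LINT x|lborel. (\<Sum>b\<in>Basis. ?F' b x))"
    using int1 int2 by (intro Bochner_Integration.integral_sum[symmetric] Bochner_Integration.integrable_add) auto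
  also have "\<dots> = (LINT x|lborel. cutoff_sq x *\<^sub>R (\<Sum>b\<in>Basis. ?D p b x * ?D q b x)
      - (4 * real j) *\<^sub>R (cutoff x *\<^sub>R (p x * q x)))"
  proof (rule Bochner_Integration.integral_cong[OF refl])
    fix x
    have "(\<Sum>b\<in>Basis. ?D (?D p b) b x) = 0"
      using solid_harmonicsD(3)[OF p, of x] by (simp add: laplacian_def)
    then have l: "(\<Sum>b\<in>Basis. ?D (?D p b) b x * q x) = 0"
      by (simp flip: sum_distrib_right)
    have e: "(\<Sum>b\<in>Basis. (- 4 * (b \<bullet> x)) *\<^sub>R (?D p b x * q x)) = - (4 * real j) *\<^sub>R (p x * q x)"
    proof -
      have "(\<Sum>b\<in>Basis. (- 4 * (b \<bullet> x)) *\<^sub>R (?D p b x * q x)) = - 4 *\<^sub>R ((\<Sum>b\<in>Basis. (x \<bullet> b) *\<^sub>R ?D p b x) * q x)"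
        by (simp add: sum_distrib_right scaleR_sum_right inner_commute)
      also have "\<dots> = - (4 * real j) *\<^sub>R (p x * q x)"
        by (simp add: euler_homogeneous[OF pp solid_harmonicsD(2)[OF p]])
      finally show ?thesis .
    qed
    have "(\<Sum>b\<in>Basis. ?F' b x) = cutoff_sq x *\<^sub>R ((\<Sum>b\<in>Basis. ?D p b x * ?D q b x) + (\<Sum>b\<in>Basis. ?D (?D p b) b x * q x))
        + cutoff x *\<^sub>R (\<Sum>b\<in>Basis. (- 4 * (b \<bullet> x)) *\<^sub>R (?D p b x * q x))"
      by (simp only: sum.distrib scaleR_sum_right scaleR_add_right)
    then show "(\<Sum>b\<in>Basis. ?F' b x) = cutoff_sq x *\<^sub>R (\<Sum>b\<in>Basis. ?D p b x * ?D q b x)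
      - (4 * real j) *\<^sub>R (cutoff x *\<^sub>R (p x * q x))"
      unfolding l e by simp
  qed
  also have "\<dots> = (LINT x|lborel. cutoff_sq x *\<^sub>R (\<Sum>b\<in>Basis. ?D p b x * ?D q b x))
      - (4 * real j) *\<^sub>R (LINT x|lborel. cutoff x *\<^sub>R (p x * q x))"
  proof -
    have "integrable lborel (\<lambda>x. cutoff_sq x *\<^sub>R (\<Sum>b\<in>Basis. ?D p b x * ?D q b x))"
      by (intro integrable_cutoff continuous_intros cont)
    moreover have "integrable lborel (\<lambda>x. (4 * real j) *\<^sub>R (cutoff x *\<^sub>R (p x * q x)))"
      by (intro integrable_scaleR_right integrable_cutoff continuous_intros cont)
    ultimately show ?thesis
      by (simp only: Bochner_Integration.integral_diff integral_scaleR_right)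
  qed
  finally show ?thesis
    by (simp add: scaleR_conv_of_real)
qed

lemma frechet_derivative_cnj:
  fixes p :: "'a::euclidean_space \<Rightarrow> complex"
  assumes "polynomial_function p"
  shows "frechet_derivative (\<lambda>x. cnj (p x)) (at x) b = cnj (frechet_derivative p (at x) b)"
proof -
  have "((\<lambda>x. cnj (p x)) has_derivative (\<lambda>b. cnj (frechet_derivative p (at x) b))) (at x)"
    using polynomial_function_frechet_derivative(1)[OF assms] by (rule has_derivative_cnj)
  then show ?thesis
    by (metis frechet_derivative_at)
qed

text \<open>
  The Dirichlet form of \<open>p\<close> and \<open>q\<close> can be evaluated from either side, with the factor \<open>j\<close> or the factor \<open>i\<close>
  in front of the same integral.
\<close>

lemma solid_harmonics_orthogonal_weighted:
  fixes p q :: "'a::euclidean_space \<Rightarrow> complex"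
  assumes p: "p \<in> solid_harmonics j" and q: "q \<in> solid_harmonics i" and "i \<noteq> j"
  shows "(LINT x|lborel. cutoff x *\<^sub>R (p x * cnj (q x))) = 0"
proof -
  note pp = solid_harmonicsD(1)[OF p] and qq = solid_harmonicsD(1)[OF q]
  let ?I = "LINT x|lborel. cutoff x *\<^sub>R (p x * cnj (q x))"
  let ?E = "LINT x|lborel. cutoff_sq x *\<^sub>R (\<Sum>b\<in>Basis. frechet_derivative p (at x) b * cnj (frechet_derivative q (at x) b))"
  have 1: "?E = 4 * real j * ?I"
    using dirichlet_form_harmonic[OF p polynomial_function_cnj[OF qq]] by (simp add: frechet_derivative_cnj[OF qq])
  have "cnj ?E = (LINT x|lborel. cutoff_sq x *\<^sub>R (\<Sum>b\<in>Basis. frechet_derivative q (at x) b * cnj (frechet_derivative p (at x) b)))"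
    by (subst Bochner_Integration.integral_cnj[symmetric]) (simp add: mult.commute del: Bochner_Integration.integral_cnj)
  also have "\<dots> = 4 * real i * (LINT x|lborel. cutoff x *\<^sub>R (q x * cnj (p x)))"
    using dirichlet_form_harmonic[OF q polynomial_function_cnj[OF pp]] by (simp add: frechet_derivative_cnj[OF pp])
  also have "(LINT x|lborel. cutoff x *\<^sub>R (q x * cnj (p x))) = cnj ?I"
    by (subst Bochner_Integration.integral_cnj[symmetric]) (simp add: mult.commute del: Bochner_Integration.integral_cnj)
  finally have "cnj ?E = cnj (4 * real i * ?I)"
    by simp
  then have 2: "?E = 4 * real i * ?I"
    by (simp only: complex_cnj_cancel_iff)
  from trans[OF 1[symmetric] 2] show ?thesis
    using \<open>i \<noteq> j\<close> by simp
qed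

lemma lborel_integral_scale:
  fixes f :: "'a::euclidean_space \<Rightarrow> 'b::{banach, second_countable_topology}"
  assumes f: "f \<in> borel_measurable borel" and "r > 0"
  shows "(LINT x|lborel. f x) = r ^ DIM('a) *\<^sub>R (LINT x|lborel. f (r *\<^sub>R x))"
proof -
  have "(LINT x|lborel. f x) = (LINT x|density (distr lborel borel (\<lambda>x. 0 + r *\<^sub>R x)) (\<lambda>_. \<bar>r\<bar> ^ DIM('a)). f x)"
    using lborel_affine[of r "0::'a"] \<open>r > 0\<close> by (intro arg_cong2[where f = "integral\<^sup>L"]) auto
  also have "\<dots> = (LINT x|distr lborel borel (\<lambda>x. r *\<^sub>R x). r ^ DIM('a) *\<^sub>R f x)"
    using f \<open>r > 0\<close> by (subst integral_density) auto
  also have "\<dots> = (LINT x|lborel. r ^ DIM('a) *\<^sub>R f (r *\<^sub>R x))"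
    using f by (subst integral_distr) auto
  finally show ?thesis by simp
qed

lemma borel_measurable_sgn: "(sgn :: 'a::euclidean_space \<Rightarrow> 'a) \<in> borel_measurable borel"
  unfolding sgn_div_norm[abs_def] by measurable

text \<open>
  Write \<open>1 - norm x ^ m\<close> as the integral of \<open>m * r ^ (m - 1)\<close> over \<open>norm x \<le> r \<le> 1\<close> and exchange the
  integrals.  The integral of a function of \<open>sgn x\<close> over the ball of radius \<open>r\<close> is \<open>r ^ DIM('a)\<close> times
  that over the unit ball.
\<close>

lemma radial_moment:
  fixes H :: "'a::euclidean_space \<Rightarrow> complex"
  assumes H: "H \<in> borel_measurable borel" and bound: "\<And>x. norm x \<le> 1 \<Longrightarrow> norm (H x) \<le> K"
  shows "(LINT x|lborel. indicator (cball 0 1) x *\<^sub>R (norm x ^ m *\<^sub>R H (sgn x)))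
    = (real DIM('a) / (real DIM('a) + real m)) *\<^sub>R (LINT x|lborel. indicator (cball 0 1) x *\<^sub>R H (sgn x))"
    (is "?J m = _ *\<^sub>R ?I")
proof (cases "m = 0")
  case True
  then show ?thesis by simp
next
  case False
  have [measurable]: "(\<lambda>x::'a. H (sgn x)) \<in> borel_measurable borel"
    by (rule measurable_compose[OF borel_measurable_sgn H])
  have [measurable]: "cball (0::'a) 1 \<in> sets borel"
    by simp
  have Hs: "norm (H (sgn x)) \<le> K" for x :: 'a
    by (intro bound) (simp add: norm_sgn)
  have K: "K \<ge> 0"
    using Hs[of 0] norm_ge_zero order_trans by blast
  have ball_int: "integrable lborel (\<lambda>x. indicator (cball 0 1) x *\<^sub>R (norm x ^ n *\<^sub>R H (sgn x)))" for n
  proof (rule Bochner_Integration.integrable_bound)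
    show "integrable lborel (\<lambda>x::'a. K * indicator (cball 0 1) x)"
      by (intro integrable_mult_right integrable_real_indicator) (auto simp: emeasure_lborel_cball_less_top)
    show "AE x in lborel. norm (indicator (cball 0 1) x *\<^sub>R (norm x ^ n *\<^sub>R H (sgn x))) \<le> norm (K * indicator (cball 0 1) x)"
    proof (rule AE_I2)
      fix x :: 'a
      have "norm x ^ n * norm (H (sgn x)) \<le> 1 * K" if "norm x \<le> 1"
        using that Hs by (intro mult_mono power_le_one) auto
      then show "norm (indicator (cball 0 1) x *\<^sub>R (norm x ^ n *\<^sub>R H (sgn x))) \<le> norm (K * indicator (cball 0 1) x)"
        using K by (auto simp: indicator_def)
    qed
  qed measurable
  let ?d = "DIM('a)"
  \<comment> \<open>the point \<open>0\<close> is left out so that \<open>sgn (r *\<^sub>R x) = sgn x\<close> on the support of \<open>g\<close>\<close>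
  define g where "g r = indicator {0<..1} r * (real m * r ^ (m - 1))" for r :: real
  have [measurable]: "g \<in> borel_measurable borel"
    unfolding g_def[abs_def] by measurable
  have g_bound: "\<bar>g r\<bar> \<le> real m * indicator {0<..1} r" for r
    unfolding g_def by (auto simp: indicator_def abs_mult intro!: mult_left_le power_le_one)
  let ?f = "\<lambda>(r::real) x. (g r * indicator {0..} (r - norm x) * indicator (cball 0 1) x) *\<^sub>R H (sgn x)"
  have f_int: "integrable (lborel \<Otimes>\<^sub>M lborel) (case_prod ?f)"
  proof (rule Bochner_Integration.integrable_bound)
    have "emeasure (lborel \<Otimes>\<^sub>M lborel) ({0<..1::real} \<times> cball (0::'a) 1) < top"
      by (subst lborel.emeasure_pair_measure_Times)
        (auto simp: emeasure_lborel_cball_less_top ennreal_mult_less_top)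
    then show "integrable (lborel \<Otimes>\<^sub>M lborel) (\<lambda>z. (real m * K) * indicator ({0<..1::real} \<times> cball (0::'a) 1) z)"
      by (intro integrable_mult_right integrable_real_indicator) auto
    show "case_prod ?f \<in> borel_measurable (lborel \<Otimes>\<^sub>M lborel)"
      by measurable
    show "AE z in lborel \<Otimes>\<^sub>M lborel. norm (case_prod ?f z) \<le> norm ((real m * K) * indicator ({0<..1::real} \<times> cball (0::'a) 1) z)"
    proof (intro AE_I2)
      fix z :: "real \<times> 'a"
      obtain r x where z: "z = (r, x)" by (cases z)
      have "norm (?f r x) = \<bar>g r\<bar> * (indicator {0..} (r - norm x) * (indicator (cball 0 1) x * norm (H (sgn x))))"
        by (simp add: abs_mult)
      also have "\<dots> \<le> (real m * indicator {0<..1} r) * (1 * (indicator (cball 0 1) x * K))"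
        using Hs by (intro mult_mono g_bound) (auto simp: indicator_def K)
      also have "\<dots> = norm ((real m * K) * indicator ({0<..1::real} \<times> cball (0::'a) 1) z)"
        using K by (simp add: z indicator_def)
      finally show "norm (case_prod ?f z) \<le> norm ((real m * K) * indicator ({0<..1::real} \<times> cball (0::'a) 1) z)"
        by (simp add: z)
    qed
  qed
  have inner_x: "(LINT x|lborel. ?f r x) = (g r * r ^ ?d) *\<^sub>R ?I" for r
  proof (cases "r \<in> {0<..1}")
    case True
    have "(LINT x|lborel. ?f r x) = (LINT x|lborel. g r *\<^sub>R (indicator (cball 0 r) x *\<^sub>R H (sgn x)))"
      using True by (intro Bochner_Integration.integral_cong) (auto simp: indicator_def)
    also have "\<dots> = g r *\<^sub>R (LINT x|lborel. indicator (cball 0 r) x *\<^sub>R H (sgn x))"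
      by (rule integral_scaleR_right)
    also have "(LINT x|lborel. indicator (cball 0 r) x *\<^sub>R H (sgn x))
        = r ^ ?d *\<^sub>R (LINT x|lborel. indicator (cball 0 r) (r *\<^sub>R x) *\<^sub>R H (sgn (r *\<^sub>R x)))"
    proof (rule lborel_integral_scale)
      have [measurable]: "cball (0::'a) r \<in> sets borel"
        by simp
      show "(\<lambda>x. indicator (cball 0 r) x *\<^sub>R H (sgn x)) \<in> borel_measurable borel"
        by measurable
    qed (use True in simp)
    also have "(LINT x|lborel. indicator (cball 0 r) (r *\<^sub>R x) *\<^sub>R H (sgn (r *\<^sub>R x))) = ?I"
      using True by (intro Bochner_Integration.integral_cong) (auto simp: indicator_def sgn_scaleR)
    finally show ?thesis by simp
  next
    case False
    then have "g r = 0"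
      by (auto simp: g_def)
    then show ?thesis by simp
  qed
  have g_moment: "(LINT r|lborel. g r * r ^ ?d) = real m / (real m + real ?d)"
  proof -
    have "(LINT r|lborel. g r * r ^ ?d) = (LINT r|lborel. (real m * r ^ (m - 1 + ?d)) * indicator {0..1} r)"
      by (intro Bochner_Integration.integral_cong) (auto simp: g_def indicator_def power_add)
    also have "\<dots> = real m / (real m + real ?d) * 1 ^ (m + ?d) - real m / (real m + real ?d) * 0 ^ (m + ?d)"
    proof (rule integral_FTC_Icc_real)
      fix r :: real
      have "((\<lambda>r. real m / (real m + real ?d) * r ^ (m + ?d)) has_real_derivative
          real m / (real m + real ?d) * (real (m + ?d) * r ^ (m + ?d - 1))) (at r)"
        by (auto intro!: derivative_eq_intros)
      moreover have "m + ?d - 1 = m - 1 + ?d"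
        using False by simp
      moreover have "real m / (real m + real ?d) * (real (m + ?d) * y) = real m * y" for y
        using False by simp
      ultimately show "((\<lambda>r. real m / (real m + real ?d) * r ^ (m + ?d)) has_real_derivative real m * r ^ (m - 1 + ?d)) (at r)"
        by (simp only:)
      show "isCont (\<lambda>r. real m * r ^ (m - 1 + ?d)) r"
        by (intro continuous_intros)
    qed simp
    finally show ?thesis
      using False by simp
  qed
  have inner_r: "(LINT r|lborel. ?f r x) = indicator (cball 0 1) x *\<^sub>R ((1 - norm x ^ m) *\<^sub>R H (sgn x))" if "x \<noteq> 0" for x
  proof (cases "norm x \<le> 1")
    case True
    have "(LINT r|lborel. g r * indicator {0..} (r - norm x)) = (LINT r|lborel. (real m * r ^ (m - 1)) * indicator {norm x..1} r)"
    proof (rule Bochner_Integration.integral_cong[OF refl])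
      fix r :: real
      have "norm x \<le> r \<Longrightarrow> r > 0"
        using that by (metis less_le_trans zero_less_norm_iff)
      then show "g r * indicator {0..} (r - norm x) = (real m * r ^ (m - 1)) * indicator {norm x..1} r"
        by (cases "norm x \<le> r") (auto simp: g_def indicator_def)
    qed
    also have "\<dots> = 1 ^ m - norm x ^ m"
    proof (rule integral_FTC_Icc_real[OF True])
      fix r :: real
      show "((\<lambda>r. r ^ m) has_real_derivative real m * r ^ (m - 1)) (at r)"
        by (auto intro!: derivative_eq_intros)
      show "isCont (\<lambda>r. real m * r ^ (m - 1)) r"
        by (intro continuous_intros)
    qed
    finally have *: "(LINT r|lborel. g r * indicator {0..} (r - norm x)) = 1 - norm x ^ m"
      by simp
    have "integrable lborel (\<lambda>r. g r * indicator {0..} (r - norm x))"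
    proof (rule Bochner_Integration.integrable_bound)
      show "integrable lborel (\<lambda>r::real. real m * indicator {0<..1} r)"
        by (intro integrable_mult_right integrable_real_indicator) auto
      show "AE r in lborel. norm (g r * indicator {0..} (r - norm x)) \<le> norm (real m * indicator {0<..1} r)"
      proof (intro AE_I2)
        fix r :: real
        show "norm (g r * indicator {0..} (r - norm x)) \<le> norm (real m * indicator {0<..1} r)"
          using g_bound[of r] by (auto simp: indicator_def abs_mult)
      qed
    qed measurable
    then have "(LINT r|lborel. ?f r x) = (LINT r|lborel. g r * indicator {0..} (r - norm x)) *\<^sub>R H (sgn x)"
      using True by (simp add: integral_scaleR_left)
    with * True show ?thesis
      by simp
  qed simp
  have "?I - ?J m = (LINT x|lborel. indicator (cball 0 1) x *\<^sub>R ((1 - norm x ^ m) *\<^sub>R H (sgn x)))"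
    using ball_int[of 0] ball_int[of m]
    by (simp add: scaleR_diff_left scaleR_diff_right flip: Bochner_Integration.integral_diff)
  also have "\<dots> = (LINT x|lborel. LINT r|lborel. ?f r x)"
  proof (rule integral_cong_AE)
    show "AE x in lborel. indicator (cball 0 1) x *\<^sub>R ((1 - norm x ^ m) *\<^sub>R H (sgn x)) = (LINT r|lborel. ?f r x)"
      using AE_lborel_singleton[of "0::'a"] by eventually_elim (use inner_r in auto)
  qed measurable
  also have "\<dots> = (LINT r|lborel. LINT x|lborel. ?f r x)"
    by (rule lborel_pair.Fubini_integral[OF f_int])
  also have "\<dots> = (LINT r|lborel. (g r * r ^ ?d) *\<^sub>R ?I)"
    by (simp only: inner_x)
  also have "\<dots> = (real m / (real m + real ?d)) *\<^sub>R ?I"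
  proof -
    have "integrable lborel (\<lambda>r. g r * r ^ ?d)"
    proof (rule Bochner_Integration.integrable_bound)
      show "integrable lborel (\<lambda>r::real. real m * indicator {0<..1} r)"
        by (intro integrable_mult_right integrable_real_indicator) auto
      show "AE r in lborel. norm (g r * r ^ ?d) \<le> norm (real m * indicator {0<..1} r)"
      proof (intro AE_I2)
        fix r :: real
        have "\<bar>g r\<bar> * \<bar>r\<bar> ^ ?d \<le> real m * 1" if "r \<in> {0<..1}"
          using that g_bound[of r] by (intro mult_mono power_le_one) auto
        then show "norm (g r * r ^ ?d) \<le> norm (real m * indicator {0<..1} r)"
          by (cases "r \<in> {0<..1}") (auto simp: abs_mult power_abs g_def)
      qed
    qed measurable
    then show ?thesis
      by (simp add: integral_scaleR_left g_moment)
  qed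
  finally have diff: "?I - ?J m = (real m / (real m + real ?d)) *\<^sub>R ?I" .
  have "b = a - e" if "a - b = e" for a b e :: complex
    using that by auto
  from this[OF diff] have "?J m = ?I - (real m / (real m + real ?d)) *\<^sub>R ?I" .
  also have "\<dots> = (1 - real m / (real m + real ?d)) *\<^sub>R ?I"
    by (simp add: scaleR_diff_left)
  also have "1 - real m / (real m + real ?d) = real ?d / (real ?d + real m)"
    using False by (simp add: field_simps)
  finally show ?thesis .
qed

section \<open>Spherical harmonics on the sphere\<close>

lemma space_sphere_measure [simp]: "space sphere_measure = UNIV"
  and sets_sphere_measure [measurable_cong, simp]: "sets sphere_measure = sets borel"
  by (simp_all add: sphere_measure_def space_scale_measure)

lemma sgn_measurable_restrict: "(sgn :: 'a::euclidean_space \<Rightarrow> 'a) \<in> restrict_space lborel (cball 0 1) \<rightarrow>\<^sub>M borel"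
  using borel_measurable_sgn by (intro measurable_restrict_space1) simp

lemma sphere_integral:
  fixes f :: "'a::euclidean_space \<Rightarrow> 'b::{banach, second_countable_topology}"
  assumes f: "f \<in> borel_measurable borel"
  shows "(LINT x|sphere_measure. f x) = real DIM('a) *\<^sub>R (LINT x|lborel. indicator (cball 0 1) x *\<^sub>R f (sgn x))"
proof -
  let ?N = "distr (restrict_space lborel (cball 0 1)) borel sgn :: 'a measure"
  have scale: "sphere_measure = density ?N (\<lambda>_. ennreal (real DIM('a)))"
  proof (rule measure_eqI)
    fix A :: "'a set" assume "A \<in> sets sphere_measure"
    then have "A \<in> sets ?N"
      by simp
    then show "emeasure sphere_measure A = emeasure (density ?N (\<lambda>_. ennreal (real DIM('a)))) A"
      by (simp add: sphere_measure_def emeasure_density_const)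
  qed simp
  have "(LINT x|sphere_measure. f x) = (LINT x|?N. real DIM('a) *\<^sub>R f x)"
    unfolding scale using f by (subst integral_density) auto
  also have "\<dots> = real DIM('a) *\<^sub>R (LINT x|?N. f x)"
    by (rule integral_scaleR_right)
  also have "(LINT x|?N. f x) = (LINT x|restrict_space lborel (cball 0 1). f (sgn x))"
    using f by (intro integral_distr sgn_measurable_restrict)
  also have "\<dots> = (LINT x|lborel. indicator (cball 0 1) x *\<^sub>R f (sgn x))"
    by (subst integral_restrict_space) (auto simp: set_lebesgue_integral_def)
  finally show ?thesis .
qed

lemma finite_sphere_measure: "finite_measure (sphere_measure :: 'a::euclidean_space measure)"
proof
  have "emeasure (restrict_space lborel (cball 0 1)) (space (restrict_space lborel (cball (0::'a) 1))) \<noteq> top"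
    using emeasure_lborel_cball_less_top[of "0::'a" 1]
    by (subst emeasure_restrict_space) (auto simp: space_restrict_space)
  then show "emeasure (sphere_measure :: 'a measure) (space sphere_measure) \<noteq> \<infinity>"
    using sgn_measurable_restrict[where 'a='a]
    by (simp add: sphere_measure_def emeasure_distr space_scale_measure ennreal_mult_eq_top_iff space_restrict_space)
qed

lemma scaleR_norm_sgn: "norm x *\<^sub>R sgn x = (x :: 'a::real_normed_vector)"
  by (cases "x = 0") (auto simp: sgn_div_norm)

definition sphere_restrict :: "('a::euclidean_space \<Rightarrow> complex) \<Rightarrow> 'a \<Rightarrow> complex" where
  "sphere_restrict p x = (if x \<in> sphere 0 1 then p x else 0)"

lemma spherical_harmonics_iff: "Y \<in> spherical_harmonics j \<longleftrightarrow> (\<exists>p\<in>solid_harmonics j. Y = sphere_restrict p)"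
  by (auto simp: spherical_harmonics_def sphere_restrict_def[abs_def])

lemma sphere_restrict_borel:
  assumes "polynomial_function p"
  shows "sphere_restrict p \<in> borel_measurable borel"
proof -
  have p: "p \<in> borel_measurable borel"
    using continuous_on_polymonial_function[OF assms] by (rule borel_measurable_continuous_onI)
  have "sphere_restrict p = (\<lambda>x. indicator (sphere 0 1) x *\<^sub>R p x)"
    by (auto simp: sphere_restrict_def fun_eq_iff indicator_def)
  also have "\<dots> \<in> borel_measurable borel"
    using p by (intro borel_measurable_scaleR borel_measurable_indicator) auto
  finally show ?thesis .
qed

lemma borel_measurable_cnj [measurable]: "cnj \<in> borel_measurable borel"
  by (intro borel_measurable_continuous_onI continuous_intros)

lemma spherical_harmonic_borel: "Y \<in> spherical_harmonics j \<Longrightarrow> Y \<in> borel_measurable borel"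
  using sphere_restrict_borel solid_harmonicsD(1) by (auto simp: spherical_harmonics_iff)

lemma spherical_harmonic_bounded:
  assumes "Y \<in> spherical_harmonics j"
  obtains K where "\<And>x. norm (Y x) \<le> K"
proof -
  obtain p where p: "p \<in> solid_harmonics j" "Y = sphere_restrict p"
    using assms by (auto simp: spherical_harmonics_iff)
  obtain K where K: "K > 0" "\<And>x. norm x \<le> 1 \<Longrightarrow> norm (p x) \<le> K"
    using continuous_on_ball_bound[OF continuous_on_solid_harmonic[OF p(1)]] by blast
  have "norm (Y x) \<le> K" for x
    using K by (auto simp: p(2) sphere_restrict_def)
  then show thesis by (rule that)
qed

lemma integrable_harmonic_product:
  assumes "Y \<in> spherical_harmonics i" "Z \<in> spherical_harmonics j"
  shows "integrable sphere_measure (\<lambda>x. Y x * cnj (Z x))"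
proof -
  interpret finite_measure "sphere_measure :: 'a measure" by (rule finite_sphere_measure)
  obtain K L where K: "\<And>x. norm (Y x) \<le> K" and L: "\<And>x. norm (Z x) \<le> L"
    using assms spherical_harmonic_bounded by metis
  show ?thesis
  proof (rule integrable_const_bound)
    have "norm (Y x * cnj (Z x)) \<le> K * L" for x
      unfolding norm_mult complex_mod_cnj using K L norm_ge_zero order_trans
      by (intro mult_mono) (auto intro: order_trans[OF norm_ge_zero K])
    then show "AE x in sphere_measure. norm (Y x * cnj (Z x)) \<le> K * L"
      by simp
    show "(\<lambda>x. Y x * cnj (Z x)) \<in> borel_measurable sphere_measure"
      using assms[THEN spherical_harmonic_borel] by measurable
  qed
qed

lemma sphere_inner_eq_ball_integral:
  assumes p: "p \<in> solid_harmonics i" and q: "q \<in> solid_harmonics j"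
  shows "sphere_inner (sphere_restrict p) (sphere_restrict (q :: 'a::euclidean_space \<Rightarrow> complex)) =
    real DIM('a) *\<^sub>R (LINT x|lborel. indicator (cball 0 1) x *\<^sub>R (p (sgn x) * cnj (q (sgn x))))"
proof -
  have meas: "sphere_restrict p \<in> borel_measurable borel" "sphere_restrict q \<in> borel_measurable borel"
    using p q sphere_restrict_borel solid_harmonicsD(1) by blast+
  have pq: "p \<in> borel_measurable borel" "q \<in> borel_measurable borel"
    using continuous_on_solid_harmonic[OF p] continuous_on_solid_harmonic[OF q] by (auto intro: borel_measurable_continuous_onI)
  note [measurable] = meas pq
  have [measurable]: "(\<lambda>x::'a. p (sgn x)) \<in> borel_measurable borel" "(\<lambda>x::'a. q (sgn x)) \<in> borel_measurable borel"
    "(\<lambda>x::'a. sphere_restrict p (sgn x)) \<in> borel_measurable borel" "(\<lambda>x::'a. sphere_restrict q (sgn x)) \<in> borel_measurable borel"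
    "cball (0::'a) 1 \<in> sets borel"
    by (auto intro: measurable_compose[OF borel_measurable_sgn] meas pq)
  have "sphere_inner (sphere_restrict p) (sphere_restrict q) =
      real DIM('a) *\<^sub>R (LINT x|lborel. indicator (cball 0 1) x *\<^sub>R (sphere_restrict p (sgn x) * cnj (sphere_restrict q (sgn x))))"
    unfolding sphere_inner_def by (rule sphere_integral) measurable
  also have "(LINT x|lborel. indicator (cball 0 1) x *\<^sub>R (sphere_restrict p (sgn x) * cnj (sphere_restrict q (sgn x))))
      = (LINT x|lborel. indicator (cball 0 1) x *\<^sub>R (p (sgn x) * cnj (q (sgn x))))"
  proof (rule integral_cong_AE)
    show "AE x in lborel. indicator (cball 0 1) x *\<^sub>R (sphere_restrict p (sgn x) * cnj (sphere_restrict q (sgn x)))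
        = indicator (cball 0 1) x *\<^sub>R (p (sgn x) * cnj (q (sgn x)))"
      using AE_lborel_singleton[of "0::'a"] by eventually_elim (simp add: sphere_restrict_def norm_sgn)
  qed measurable
  finally show ?thesis .
qed

text \<open>
  The product \<open>p * cnj q\<close> is homogeneous and \<open>cutoff x = 1 - (norm x)\<^sup>2\<close> on the unit ball, so the weighted
  integral that vanishes is a difference of two radial moments, a positive multiple of the integral
  over the sphere.
\<close>

lemma spherical_harmonics_orthogonal:
  fixes Y Z :: "'a::euclidean_space \<Rightarrow> complex"
  assumes "Y \<in> spherical_harmonics i" "Z \<in> spherical_harmonics j" "i \<noteq> j"
  shows "sphere_inner Y Z = 0"
proof -
  obtain p q where p: "p \<in> solid_harmonics i" "Y = sphere_restrict p" and q: "q \<in> solid_harmonics j" "Z = sphere_restrict q"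
    using assms by (auto simp: spherical_harmonics_iff)
  let ?H = "\<lambda>x. p x * cnj (q x)"
  let ?I = "LINT x|lborel. indicator (cball 0 1) x *\<^sub>R ?H (sgn x)"
  let ?J = "\<lambda>m. LINT x|lborel. indicator (cball 0 1) x *\<^sub>R (norm x ^ m *\<^sub>R ?H (sgn x))"
  let ?d = "real DIM('a)" and ?k = "i + j"
  have cont: "continuous_on A ?H" for A
    by (intro continuous_intros continuous_on_solid_harmonic[OF p(1)] continuous_on_solid_harmonic[OF q(1)])
  have meas: "?H \<in> borel_measurable borel"
    using cont by (rule borel_measurable_continuous_onI)
  obtain K where "\<And>x. norm x \<le> 1 \<Longrightarrow> norm (?H x) \<le> K"
    using continuous_on_ball_bound[OF cont] by blast
  then have J: "?J m = (?d / (?d + real m)) *\<^sub>R ?I" for m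
    by (rule radial_moment[OF meas])
  \<comment> \<open>also at \<open>x = 0\<close>, where \<open>sgn x = 0\<close>\<close>
  have hom: "?H x = norm x ^ ?k *\<^sub>R ?H (sgn x)" for x
  proof -
    have "p x = norm x ^ i *\<^sub>R p (sgn x)" "q x = norm x ^ j *\<^sub>R q (sgn x)"
      using solid_harmonicsD(2)[OF p(1), of "norm x" "sgn x"] solid_harmonicsD(2)[OF q(1), of "norm x" "sgn x"]
      by (simp_all add: scaleR_norm_sgn)
    then show ?thesis
      by (simp add: power_add scaleR_conv_of_real mult_ac)
  qed
  have int: "integrable lborel (\<lambda>x. indicator (cball 0 1) x *\<^sub>R (norm x ^ m *\<^sub>R ?H x))" for m
    by (intro borel_integrable_compact continuous_intros cont) auto
  have "0 = (LINT x|lborel. cutoff x *\<^sub>R ?H x)"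
    using solid_harmonics_orthogonal_weighted[OF p(1) q(1)] assms(3) by simp
  also have "\<dots> = (LINT x|lborel. indicator (cball 0 1) x *\<^sub>R (norm x ^ 0 *\<^sub>R ?H x) - indicator (cball 0 1) x *\<^sub>R (norm x ^ 2 *\<^sub>R ?H x))"
  proof (rule Bochner_Integration.integral_cong[OF refl])
    fix x :: 'a
    show "cutoff x *\<^sub>R ?H x = indicator (cball 0 1) x *\<^sub>R (norm x ^ 0 *\<^sub>R ?H x) - indicator (cball 0 1) x *\<^sub>R (norm x ^ 2 *\<^sub>R ?H x)"
    proof (cases "norm x \<le> 1")
      case True
      then have "cutoff x = 1 - (norm x)\<^sup>2"
        by (simp add: cutoff_def power2_norm_eq_inner[symmetric] power_le_one)
      then show ?thesis
        using True by (simp add: scaleR_diff_left)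
    next
      case False
      then show ?thesis
        by (simp add: cutoff_eq_0)
    qed
  qed
  also have "\<dots> = (LINT x|lborel. indicator (cball 0 1) x *\<^sub>R (norm x ^ 0 *\<^sub>R ?H x)) - (LINT x|lborel. indicator (cball 0 1) x *\<^sub>R (norm x ^ 2 *\<^sub>R ?H x))"
    by (rule Bochner_Integration.integral_diff[OF int int])
  also have "\<dots> = ?J (0 + ?k) - ?J (2 + ?k)"
  proof -
    have "(LINT x|lborel. indicator (cball 0 1) x *\<^sub>R (norm x ^ m *\<^sub>R ?H x)) = ?J (m + ?k)" for m
      by (subst hom) (simp add: power_add)
    then show ?thesis
      by (simp only:)
  qed
  finally have "0 = (?d / (?d + real (0 + ?k)) - ?d / (?d + real (2 + ?k))) *\<^sub>R ?I"
    by (simp only: J scaleR_diff_left)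
  moreover have "?d / (?d + real (2 + ?k)) < ?d / (?d + real (0 + ?k))"
    by (intro divide_strict_left_mono) (auto intro!: mult_pos_pos add_pos_nonneg)
  ultimately have "?I = 0"
    by simp
  then show ?thesis
    unfolding p(2) q(2) sphere_inner_eq_ball_integral[OF p(1) q(1)] by simp
qed

text \<open>
  The integral over the sphere is one over the ball of \<open>\<lambda>x. p (sgn x)\<close>, so \<open>p\<close> vanishes almost everywhere in the
  ball by homogeneity, hence everywhere there by continuity.
\<close>

lemma spherical_harmonic_eq_0:
  fixes Y :: "'a::euclidean_space \<Rightarrow> complex"
  assumes Y: "Y \<in> spherical_harmonics j" and "sphere_inner Y Y = 0"
  shows "Y = (\<lambda>x. 0)"
proof -
  obtain p where p: "p \<in> solid_harmonics j" "Y = sphere_restrict p"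
    using Y by (auto simp: spherical_harmonics_iff)
  let ?g = "\<lambda>x. indicator (cball 0 1) x * (norm (p (sgn x)))\<^sup>2"
  have cont: "continuous_on A p" for A
    by (rule continuous_on_solid_harmonic[OF p(1)])
  have [measurable]: "p \<in> borel_measurable borel"
    using cont by (rule borel_measurable_continuous_onI)
  note [measurable] = borel_measurable_sgn
  obtain K where K: "K > 0" "\<And>x. norm x \<le> 1 \<Longrightarrow> norm (p x) \<le> K"
    using continuous_on_ball_bound[OF cont] by blast
  have int: "integrable lborel ?g"
  proof (rule Bochner_Integration.integrable_bound)
    show "integrable lborel (\<lambda>x::'a. K\<^sup>2 * indicator (cball 0 1) x)"
      by (intro integrable_mult_right integrable_real_indicator) (auto simp: emeasure_lborel_cball_less_top)
    have "(norm (p (sgn x)))\<^sup>2 \<le> K\<^sup>2" for x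
      using K(2)[of "sgn x"] by (intro power_mono) (auto simp: norm_sgn)
    then show "AE x in lborel. norm (?g x) \<le> norm (K\<^sup>2 * indicator (cball 0 1) x)"
      by (intro AE_I2) (auto simp: indicator_def)
    have [measurable]: "cball (0::'a) 1 \<in> sets borel" by simp
    show "?g \<in> borel_measurable lborel"
      by measurable
  qed
  have "0 = (LINT x|lborel. indicator (cball 0 1) x *\<^sub>R (p (sgn x) * cnj (p (sgn x))))"
    using assms(2) unfolding p(2) sphere_inner_eq_ball_integral[OF p(1) p(1)] by simp
  also have "\<dots> = (LINT x|lborel. complex_of_real (?g x))"
    by (intro Bochner_Integration.integral_cong) (auto simp: complex_norm_square[symmetric] scaleR_conv_of_real indicator_def)
  also have "\<dots> = complex_of_real (LINT x|lborel. ?g x)"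
    by (rule integral_complex_of_real)
  finally have "(LINT x|lborel. ?g x) = 0"
    by simp
  then have ae: "AE x in lborel. ?g x = 0"
    using integral_nonneg_eq_0_iff_AE[OF int] by auto
  have hom: "p x = norm x ^ j *\<^sub>R p (sgn x)" for x
    using solid_harmonicsD(2)[OF p(1), of "norm x" "sgn x"] by (simp add: scaleR_norm_sgn)
  have zero: "p x = 0" if x: "x \<in> ball 0 1" for x
  proof (rule ccontr)
    assume "p x \<noteq> 0"
    let ?U = "{y \<in> ball 0 1. p y \<noteq> 0}"
    have "open ?U"
    proof -
      have "open (ball 0 1 \<inter> p -` (- {0}))"
        using cont by (intro continuous_open_preimage) auto
      also have "ball 0 1 \<inter> p -` (- {0}) = ?U"
        by auto
      finally show ?thesis .
    qed
    moreover have "x \<in> ?U"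
      using x \<open>p x \<noteq> 0\<close> by simp
    moreover have "negligible ?U"
    proof -
      have "AE y in lborel. y \<notin> ?U"
        using ae
      proof eventually_elim
        case (elim y)
        then show ?case
          using hom[of y] by (auto simp: indicator_def)
      qed
      then have "AE y in lebesgue. y \<notin> ?U"
        by (rule AE_completion)
      then show ?thesis
        by (simp add: negligible_iff_null_sets AE_iff_null_sets \<open>open ?U\<close>)
    qed
    ultimately show False
      using open_not_negligible by blast
  qed
  have "p x = 0" if "norm x = 1" for x
    using zero[of "(1/2) *\<^sub>R x"] solid_harmonicsD(2)[OF p(1), of "1/2" x] that by simp
  then show ?thesis
    by (auto simp: p(2) sphere_restrict_def)
qed

lemma solid_harmonics_diff:
  assumes p: "p \<in> solid_harmonics j" and q: "q \<in> solid_harmonics j"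
  shows "(\<lambda>x. p x - q x) \<in> solid_harmonics j"
proof -
  have D: "frechet_derivative (\<lambda>x. f x - g x) (at x) b = frechet_derivative f (at x) b - frechet_derivative g (at x) b"
    if "polynomial_function f" "polynomial_function g" for f g :: "'a \<Rightarrow> complex" and x b
    using frechet_derivative_at[OF has_derivative_diff[OF polynomial_function_frechet_derivative(1)[OF that(1)]
          polynomial_function_frechet_derivative(1)[OF that(2)]]] by metis
  have "laplacian (\<lambda>x. p x - q x) x = laplacian p x - laplacian q x" for x
    unfolding laplacian_def using solid_harmonicsD(1)[OF p] solid_harmonicsD(1)[OF q] 
    by (simp add: D polynomial_function_frechet_derivative(2) sum_subtractf)
  then show ?thesis
    using p q by (auto simp: solid_harmonics_def scaleR_diff_right)
qed

lemma spherical_harmonics_diff: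
  assumes "Y \<in> spherical_harmonics j" "Z \<in> spherical_harmonics j"
  shows "(\<lambda>x. Y x - Z x) \<in> spherical_harmonics j"
proof -
  obtain p q where "p \<in> solid_harmonics j" "Y = sphere_restrict p" "q \<in> solid_harmonics j" "Z = sphere_restrict q"
    using assms by (auto simp: spherical_harmonics_iff)
  then show ?thesis
    unfolding spherical_harmonics_iff
    by (intro bexI[of _ "\<lambda>x. p x - q x"] solid_harmonics_diff) (auto simp: sphere_restrict_def)
qed

lemma zero_spherical_harmonic:
  "(\<lambda>x::'a::euclidean_space. 0) \<in> spherical_harmonics j"
proof -
  have "(\<lambda>x::'a. 0::complex) \<in> solid_harmonics j"
    by (auto simp: solid_harmonics_def laplacian_def)
  then show ?thesis
    unfolding spherical_harmonics_iff by (intro bexI[of _ "\<lambda>_. 0"]) (auto simp: sphere_restrict_def)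
qed

text \<open>
  Any competitor differs from the claimed projection by a harmonic of degree \<open>j\<close> that is orthogonal to
  itself.
\<close>

lemma harmonic_proj_spherical_harmonic:
  fixes Y :: "'a::euclidean_space \<Rightarrow> complex"
  assumes Y: "Y \<in> spherical_harmonics i"
  shows "harmonic_proj j Y = (if i = j then Y else (\<lambda>x. 0))" (is "_ = ?W")
  unfolding harmonic_proj_def
proof (rule the_equality)
  have W: "?W \<in> spherical_harmonics j"
    using Y zero_spherical_harmonic by auto
  have W0: "sphere_inner (\<lambda>x. Y x - ?W x) Z = 0" if "Z \<in> spherical_harmonics j" for Z
    using spherical_harmonics_orthogonal[OF Y that] by (auto simp: sphere_inner_def)
  then show "?W \<in> spherical_harmonics j \<and> (\<forall>Z\<in>spherical_harmonics j. sphere_inner (\<lambda>x. Y x - ?W x) Z = 0)"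
    using W by blast
  fix V assume V: "V \<in> spherical_harmonics j \<and> (\<forall>Z\<in>spherical_harmonics j. sphere_inner (\<lambda>x. Y x - V x) Z = 0)"
  let ?D = "\<lambda>x. V x - ?W x"
  have D: "?D \<in> spherical_harmonics j"
    using V W by (intro spherical_harmonics_diff) auto
  have int: "integrable sphere_measure (\<lambda>x. (Y x - U x) * cnj (?D x))" if "U \<in> spherical_harmonics j" for U
    using integrable_harmonic_product[OF Y D] integrable_harmonic_product[OF that D]
    by (simp only: left_diff_distrib Bochner_Integration.integrable_diff)
  have "sphere_inner ?D ?D = (LINT x|sphere_measure. (Y x - ?W x) * cnj (?D x) - (Y x - V x) * cnj (?D x))"
    unfolding sphere_inner_def by (intro Bochner_Integration.integral_cong) (auto simp: algebra_simps)
  also have "\<dots> = sphere_inner (\<lambda>x. Y x - ?W x) ?D - sphere_inner (\<lambda>x. Y x - V x) ?D"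
    unfolding sphere_inner_def using V W by (intro Bochner_Integration.integral_diff int) auto
  also have "\<dots> = 0"
    using W0[OF D] V D by simp
  finally have "?D = (\<lambda>x. 0)"
    by (rule spherical_harmonic_eq_0[OF D])
  then have "V x - ?W x = 0" for x
    by (rule fun_cong)
  then show "V = ?W"
    by (intro ext) (simp only: right_minus_eq)
qed

text \<open>
  The powers of a linear form \<open>x \<bullet> a + \<i> (x \<bullet> b)\<close> are harmonic because its coefficient vector is
  isotropic: \<open>1\<^sup>2 + \<i>\<^sup>2 = 0\<close>.
\<close>

lemma exists_nonzero_spherical_harmonic:
  assumes "DIM('a::euclidean_space) \<ge> 2"
  obtains Y :: "'a::euclidean_space \<Rightarrow> complex" where "Y \<in> spherical_harmonics j" "sphere_norm Y \<noteq> 0"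
proof -
  obtain a b :: 'a where ab: "a \<in> Basis" "b \<in> Basis" "a \<noteq> b"
    using assms card_le_Suc0_iff_eq[of "Basis :: 'a set"] by fastforce
  define l where "l x = complex_of_real (x \<bullet> a) + \<i> * complex_of_real (x \<bullet> b)" for x :: 'a
  have l_deriv: "(l has_derivative l) (at x)" for x
    unfolding l_def[abs_def] by (auto intro!: derivative_eq_intros)
  have D1: "frechet_derivative (\<lambda>x. c * l x ^ k) (at x) y = c * (of_nat k * l y * l x ^ (k - 1))" for c k x y
  proof -
    have "((\<lambda>x. c * l x ^ k) has_derivative (\<lambda>y. c * (of_nat k * l y * l x ^ (k - 1)))) (at x)"
      by (intro has_derivative_mult_right has_derivative_power l_deriv)
    then show ?thesis
      by (metis frechet_derivative_at)
  qed
  let ?p = "\<lambda>x. 1 * l x ^ j"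
  have "laplacian ?p x = 0" for x
  proof -
    have "laplacian ?p x = (\<Sum>e\<in>Basis. (of_nat j * of_nat (j - 1) * l x ^ (j - 1 - 1)) * (l e)\<^sup>2)"
      unfolding laplacian_def D1
    proof (rule sum.cong[OF refl])
      fix e :: 'a
      have "(\<lambda>y. 1 * (of_nat j * l e * l y ^ (j - 1))) = (\<lambda>y. (of_nat j * l e) * l y ^ (j - 1))"
        by (simp add: fun_eq_iff)
      then show "frechet_derivative (\<lambda>y. 1 * (of_nat j * l e * l y ^ (j - 1))) (at x) e
          = (of_nat j * of_nat (j - 1) * l x ^ (j - 1 - 1)) * (l e)\<^sup>2"
        by (simp only: D1) (simp add: power2_eq_square)
    qed
    also have "\<dots> = (of_nat j * of_nat (j - 1) * l x ^ (j - 1 - 1)) * (\<Sum>e\<in>Basis. (l e)\<^sup>2)"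
      by (rule sum_distrib_left[symmetric])
    also have "(\<Sum>e\<in>Basis. (l e)\<^sup>2) = (\<Sum>e\<in>{a, b}. (l e)\<^sup>2)"
      using ab by (intro sum.mono_neutral_right) (auto simp: l_def inner_Basis)
    also have "\<dots> = 0"
      using ab by (simp add: l_def inner_Basis)
    finally show ?thesis by simp
  qed
  moreover have "polynomial_function ?p"
  proof (induction j)
    case (Suc j)
    have "polynomial_function l"
      unfolding polynomial_function_complex_iff l_def
      by (auto intro!: real_polynomial_function.intros bounded_linear_inner_left)
    then show ?case
      using polynomial_function_complex_mult[OF _ Suc] by simp
  qed simp
  moreover have "?p (c *\<^sub>R x) = c ^ j *\<^sub>R ?p x" for c x
  proof -
    have "l (c *\<^sub>R x) = c *\<^sub>R l x"
      by (simp add: l_def scaleR_conv_of_real algebra_simps)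
    then show ?thesis
      by (simp add: scaleR_conv_of_real power_mult_distrib)
  qed
  ultimately have p: "?p \<in> solid_harmonics j"
    by (simp add: solid_harmonics_def)
  then have Y: "sphere_restrict ?p \<in> spherical_harmonics j"
    unfolding spherical_harmonics_iff by blast
  have "l a = 1" "norm a = 1"
    using ab by (simp_all add: l_def inner_Basis)
  then have "sphere_restrict ?p a \<noteq> 0"
    by (simp add: sphere_restrict_def)
  then have "sphere_inner (sphere_restrict ?p) (sphere_restrict ?p) \<noteq> 0"
    using spherical_harmonic_eq_0[OF Y] by fastforce
  also have "sphere_inner (sphere_restrict ?p) (sphere_restrict ?p)
      = complex_of_real (LINT x|sphere_measure. (norm (sphere_restrict ?p x))\<^sup>2)"
    unfolding sphere_inner_def by (simp only: complex_norm_square[symmetric] integral_complex_of_real)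
  finally have "sphere_norm (sphere_restrict ?p) \<noteq> 0"
    by (simp add: sphere_norm_def)
  with Y show thesis by (rule that)
qed

section \<open>From boundedness to multipliers\<close>

lemma sums_single_index:
  fixes f :: "nat \<Rightarrow> real"
  assumes "\<And>i. i \<noteq> j \<Longrightarrow> f i = 0"
  shows "f sums f j"
  using sums_finite[of "{j}" f] assms by simp

lemma sphere_norm_0: "sphere_norm (\<lambda>x. 0) = 0"
  by (simp add: sphere_norm_def)

lemma sphere_norm_scale: "sphere_norm (\<lambda>x. of_real c * Y x) = \<bar>c\<bar> * sphere_norm Y"
  by (simp add: sphere_norm_def norm_mult power_mult_distrib real_sqrt_mult)

lemma harmonic_expansion_spherical_harmonic:
  assumes "Y \<in> spherical_harmonics j"
  shows "harmonic_expansion Y = (\<lambda>i x. if i = j then Y x else 0)"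
  using harmonic_proj_spherical_harmonic[OF assms] by (auto simp: harmonic_expansion_def fun_eq_iff)

lemma spherical_harmonic_finite_sum:
  assumes "Y \<in> spherical_harmonics j"
  shows "Y \<in> finite_harmonic_sums"
proof -
  let ?Y = "\<lambda>i. if i = j then Y else (\<lambda>x. 0)"
  have "Y = (\<lambda>x. \<Sum>i\<le>j. ?Y i x)"
    by (simp add: if_distrib[of "\<lambda>f. f _"] cong: if_cong)
  moreover have "\<forall>i\<le>j. ?Y i \<in> spherical_harmonics i"
    using assms zero_spherical_harmonic by auto
  ultimately show ?thesis
    unfolding finite_harmonic_sums_def by (intro CollectI exI[of _ j] exI[of _ ?Y] conjI)
qed

lemma sobolev_norm_single:
  fixes Y :: "'a::euclidean_space \<Rightarrow> complex"
  assumes "F j = Y" "\<And>i. i \<noteq> j \<Longrightarrow> F i = (\<lambda>x. 0)"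
  shows "sobolev_norm s F = sqrt (sobolev_weight TYPE('a) j powr s * (sphere_norm Y)\<^sup>2)"
proof -
  have "(\<lambda>i. sobolev_weight TYPE('a) i powr s * (sphere_norm (F i))\<^sup>2) sums (sobolev_weight TYPE('a) j powr s * (sphere_norm (F j))\<^sup>2)"
    by (rule sums_single_index) (simp add: assms sphere_norm_0)
  then show ?thesis
    by (simp add: sobolev_norm_def sums_iff assms(1))
qed

text \<open>
  Since \<open>m j \<noteq> 0\<close>, the functions in the kernel have no component of degree \<open>j\<close>, so a harmonic of degree \<open>j\<close>
  is orthogonal to all of them.
\<close>

lemma spherical_harmonic_in_mf_sobolev:
  fixes Y :: "'a::euclidean_space \<Rightarrow> complex"
  assumes Y: "Y \<in> spherical_harmonics j" and m: "mf_multiplier (DIM('a) - 1) \<alpha> \<kappa> t j \<noteq> 0"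
  shows "harmonic_expansion Y \<in> mf_sobolev \<alpha> \<kappa> t \<sigma>"
proof -
  let ?E = "\<lambda>i x. if i = j then Y x else 0"
  have "(\<lambda>i. sobolev_weight TYPE('a) i powr \<sigma> * (sphere_norm (?E i))\<^sup>2) sums (sobolev_weight TYPE('a) j powr \<sigma> * (sphere_norm (?E j))\<^sup>2)"
    by (rule sums_single_index) (simp add: sphere_norm_0)
  moreover have "?E i \<in> spherical_harmonics i" for i
    using Y zero_spherical_harmonic[of i] by (cases "i = j") auto
  ultimately have sob: "?E \<in> sobolev_space \<sigma>"
    unfolding sobolev_space_def using sums_summable by blast
  have "sphere_inner (?E i) (harmonic_expansion f i) = 0" if "f \<in> mf_kernel \<alpha> \<kappa> t" for f i
  proof (cases "i = j")
    case True
    have "mf_transform \<alpha> \<kappa> t (harmonic_expansion f) j x = 0" for x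
      using that by (simp add: mf_kernel_def)
    then have "harmonic_expansion f j x = 0" for x
      using m by (simp add: mf_transform_def)
    then show ?thesis
      using True by (simp add: sphere_inner_def)
  next
    case False
    then show ?thesis
      by (simp add: sphere_inner_def)
  qed
  then have perp: "?E \<in> mf_kernel_perp \<alpha> \<kappa> t \<sigma>"
    unfolding mf_kernel_perp_def using sob by simp
  have "\<exists>F\<in>mf_kernel_perp \<alpha> \<kappa> t \<sigma>. sobolev_norm \<sigma> (\<lambda>i x. F i x - ?E i x) < \<epsilon>" if "\<epsilon> > 0" for \<epsilon> :: real
    by (rule bexI[OF _ perp]) (simp add: sobolev_norm_def sphere_norm_0 that)
  with sob have "?E \<in> mf_sobolev \<alpha> \<kappa> t \<sigma>"
    by (simp add: mf_sobolev_def)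
  then show ?thesis
    by (simp only: harmonic_expansion_spherical_harmonic[OF Y])
qed

lemma sobolev_weight_pos: "sobolev_weight TYPE('a::euclidean_space) j > 0"
proof -
  have "real j * (real j + (real DIM('a) - 1) - 1) \<ge> 0"
  proof (cases "j = 0")
    case False
    then show ?thesis
      using DIM_positive[where 'a='a] by (intro mult_nonneg_nonneg) linarith+
  qed simp
  then show ?thesis
    by (simp add: sobolev_weight_def)
qed

text \<open>
  For a single harmonic of degree \<open>j\<close> both Sobolev norms reduce to one term.
\<close>

lemma mf_inverse_bounded_imp_multiplier_bound:
  assumes bounded: "mf_inverse_bounded TYPE('a::euclidean_space) \<alpha> \<kappa> t \<sigma> s" and dim: "DIM('a) \<ge> 2"
  obtains C where "C > 0"
    "\<And>j. mf_multiplier (DIM('a) - 1) \<alpha> \<kappa> t j \<noteq> 0 \<Longrightarrow>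
      1 \<le> C\<^sup>2 * (sobolev_weight TYPE('a) j powr (\<sigma> - s) * (mf_multiplier (DIM('a) - 1) \<alpha> \<kappa> t j)\<^sup>2)"
proof -
  obtain C where C: "C > 0" and le: "\<And>g. \<lbrakk>g \<in> (finite_harmonic_sums :: ('a \<Rightarrow> complex) set);
      harmonic_expansion g \<in> mf_sobolev \<alpha> \<kappa> t \<sigma>\<rbrakk> \<Longrightarrow>
      sobolev_norm s (mf_inverse \<alpha> \<kappa> t (harmonic_expansion g)) \<le> C * sobolev_norm \<sigma> (harmonic_expansion g)"
    using bounded unfolding mf_inverse_bounded_def by blast
  have main: "1 \<le> C\<^sup>2 * (sobolev_weight TYPE('a) j powr (\<sigma> - s) * (mf_multiplier (DIM('a) - 1) \<alpha> \<kappa> t j)\<^sup>2)"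
    if nz: "mf_multiplier (DIM('a) - 1) \<alpha> \<kappa> t j \<noteq> 0" for j
  proof -
    let ?m = "mf_multiplier (DIM('a) - 1) \<alpha> \<kappa> t j" and ?w = "sobolev_weight TYPE('a) j"
    obtain Y :: "'a \<Rightarrow> complex" where Y: "Y \<in> spherical_harmonics j" "sphere_norm Y \<noteq> 0"
      using exists_nonzero_spherical_harmonic[OF dim] by blast
    let ?y = "(sphere_norm Y)\<^sup>2"
    have y: "?y > 0"
      using Y(2) by simp
    note exp = harmonic_expansion_spherical_harmonic[OF Y(1)]
    have "sobolev_norm s (mf_inverse \<alpha> \<kappa> t (harmonic_expansion Y)) \<le> C * sobolev_norm \<sigma> (harmonic_expansion Y)"
      by (intro le spherical_harmonic_finite_sum[OF Y(1)] spherical_harmonic_in_mf_sobolev[OF Y(1) nz])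
    moreover have "sobolev_norm \<sigma> (harmonic_expansion Y) = sqrt (?w powr \<sigma> * ?y)"
      by (rule sobolev_norm_single) (auto simp: exp)
    moreover have "sobolev_norm s (mf_inverse \<alpha> \<kappa> t (harmonic_expansion Y))
        = sqrt (?w powr s * (sphere_norm (\<lambda>x. of_real (inverse ?m) * Y x))\<^sup>2)"
      by (rule sobolev_norm_single) (auto simp: exp mf_inverse_def fun_eq_iff nz Let_def)
    ultimately have "sqrt (?w powr s * (\<bar>inverse ?m\<bar> * sphere_norm Y)\<^sup>2) \<le> C * sqrt (?w powr \<sigma> * ?y)"
      by (simp only: sphere_norm_scale)
    then have "(sqrt (?w powr s * (\<bar>inverse ?m\<bar> * sphere_norm Y)\<^sup>2))\<^sup>2 \<le> (C * sqrt (?w powr \<sigma> * ?y))\<^sup>2"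
      by (intro power_mono) auto
    then have "?w powr s * ((inverse ?m)\<^sup>2 * ?y) \<le> C\<^sup>2 * (?w powr \<sigma> * ?y)"
      by (simp add: power_mult_distrib power_inverse)
    then have 1: "?w powr s * (inverse ?m)\<^sup>2 \<le> C\<^sup>2 * ?w powr \<sigma>"
      using y by (simp add: mult.assoc[symmetric])
    have ws: "?w powr s > 0" "?w powr \<sigma> = ?w powr (\<sigma> - s) * ?w powr s"
      using sobolev_weight_pos[where 'a='a, of j] by (simp_all flip: powr_add)
    have "?w powr s * (inverse ?m)\<^sup>2 \<le> ?w powr s * (C\<^sup>2 * ?w powr (\<sigma> - s))"
      using 1 unfolding ws(2) by (simp add: mult_ac)
    then have "(inverse ?m)\<^sup>2 \<le> C\<^sup>2 * ?w powr (\<sigma> - s)"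
      using ws(1) by simp
    then have "(inverse ?m)\<^sup>2 * ?m\<^sup>2 \<le> C\<^sup>2 * ?w powr (\<sigma> - s) * ?m\<^sup>2"
      by (intro mult_right_mono) auto
    moreover have "(inverse ?m)\<^sup>2 * ?m\<^sup>2 = 1"
      using nz by (simp add: power_inverse)
    ultimately show ?thesis
      by (simp add: mult.assoc)
  qed
  show thesis
    by (rule that[OF C main])
qed

text \<open>
  The prefactor is positive and does not depend on \<open>j\<close>, so it cannot affect the decay in \<open>j\<close>.
\<close>

lemma mf_multiplier_eq_legendre:
  assumes "n \<ge> 1" and \<rho>: "\<rho> = \<alpha> + (real n - 1) / 2" and \<beta>: "\<beta> \<in> {0<..<1}"
  shows "(sin (pi * \<beta> / 2) powr \<rho> * cos (pi * \<beta> / 2) powr (1 - \<rho>)) * mf_multiplier n \<alpha> \<kappa> (cos (\<beta> * pi)) j =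
    \<kappa> * legendre_sol \<rho> (real j + (real n - 1) / 2) (pi * \<beta>)"
proof -
  let ?N = "real j + (real n - 1) / 2"
  have "real j + real n / 2 = 1/2 + ?N" "1 - real n / 2 - real j = 1/2 - ?N" "\<alpha> + real n / 2 = \<rho> + 1/2"
    using \<rho> by (simp_all add: field_simps)
  moreover have "(1 - cos (\<beta> * pi)) / 2 = (sin (pi * \<beta> / 2))\<^sup>2"
    using cos_double_sin[of "pi * \<beta> / 2"] by (simp add: mult.commute)
  ultimately show ?thesis
    by (simp only: mf_multiplier_def gauss_hypergeometric_def legendre_sol_def legendre_fps_def mult_ac)
qed

theorem theorem2p6:
  fixes n :: nat and \<alpha> \<rho> s :: real and \<kappa> :: "real \<Rightarrow> real"
  assumes "n \<ge> 2"
    and "DIM('a::euclidean_space) = n + 1"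
    and "\<And>k::nat. \<alpha> \<noteq> - real n / 2 - real k"
    and "\<rho> = \<alpha> + (real n - 1) / 2"
    and "\<rho> \<noteq> 0" and "\<rho> \<noteq> 1"
    and "\<And>t. t \<in> {-1<..<1} \<Longrightarrow> \<kappa> t \<noteq> 0"
  shows "AE \<beta> in lebesgue. \<beta> \<in> {0<..<1} \<and> \<beta> \<notin> \<rat> \<longrightarrow>
           (let t = cos (\<beta> * pi)
            in \<not> mf_inverse_bounded TYPE('a) \<alpha> (\<kappa> t) t (s + \<rho> + 1) s)"
proof -
  let ?h = "(real n - 1) / 2"
  have c: "\<rho> + 1/2 + real k \<noteq> 0" for k :: nat
    using assms(3)[of k] assms(4) by (simp add: field_simps)
  have h: "?h > 0"
    using assms(1) by simp
  show ?thesis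
    using AE_legendre_small_values[OF c h]
  proof eventually_elim
    case (elim \<beta>)
    show ?case
    proof
      assume \<beta>: "\<beta> \<in> {0<..<1} \<and> \<beta> \<notin> \<rat>"
      define t where "t = cos (\<beta> * pi)"
      define L where "L j = legendre_sol \<rho> (real j + ?h) (pi * \<beta>)" for j :: nat
      define m where "m j = mf_multiplier n \<alpha> (\<kappa> t) t j" for j
      define W where "W = sin (pi * \<beta> / 2) powr \<rho> * cos (pi * \<beta> / 2) powr (1 - \<rho>)"
      have L0: "L j \<noteq> 0" for j
        using elim \<beta> by (auto simp: L_def)
      have small: "\<exists>j\<ge>J. \<bar>L j\<bar> < \<delta> / (real j + ?h) powr (\<rho> + 1)" if "\<delta> > 0" for \<delta> J
        using elim \<beta> that by (auto simp: L_def)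
      have "0 < pi * \<beta>" "pi * \<beta> < pi"
        using \<beta> by auto
      then have W: "W > 0"
        using half_angle_pos(1,2)[of "pi * \<beta>"] by (simp add: W_def)
      have "cos pi < cos (\<beta> * pi)" "cos (\<beta> * pi) < cos 0"
        using \<beta> cos_monotone_0_pi[of "\<beta> * pi" pi] cos_monotone_0_pi[of 0 "\<beta> * pi"] by auto
      then have \<kappa>: "\<kappa> t \<noteq> 0"
        using assms(7)[of t] by (simp add: t_def)
      have m: "W * m j = \<kappa> t * L j" for j
        unfolding W_def m_def L_def t_def using assms(1,4) \<beta> by (intro mf_multiplier_eq_legendre) auto
      have m0: "m j \<noteq> 0" for j
        using m[of j] W \<kappa> L0[of j] by auto
      have "\<not> mf_inverse_bounded TYPE('a) \<alpha> (\<kappa> t) t (s + \<rho> + 1) s"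
      proof
        assume "mf_inverse_bounded TYPE('a) \<alpha> (\<kappa> t) t (s + \<rho> + 1) s"
        then obtain C where C: "C > 0"
          and bound: "\<And>j. mf_multiplier (DIM('a) - 1) \<alpha> (\<kappa> t) t j \<noteq> 0 \<Longrightarrow>
            1 \<le> C\<^sup>2 * (sobolev_weight TYPE('a) j powr (s + \<rho> + 1 - s) * (mf_multiplier (DIM('a) - 1) \<alpha> (\<kappa> t) t j)\<^sup>2)"
          using mf_inverse_bounded_imp_multiplier_bound[where 'a='a and \<alpha> = \<alpha> and \<kappa> = "\<kappa> t" and t = t and \<sigma> = "s + \<rho> + 1" and s = s]
            assms(1,2) by auto
        let ?w = "\<lambda>j. 1 + real j * (real j + (real n - 1))"
        have lower: "1 \<le> C\<^sup>2 * (?w j powr (\<rho> + 1) * (m j)\<^sup>2)" for j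
          using bound[of j] m0[of j] assms(2) by (simp add: m_def sobolev_weight_def algebra_simps)
        have "(\<lambda>j. (?w j / (real j + ?h)\<^sup>2) powr (\<rho> + 1)) \<longlonglongrightarrow> 1"
          by real_asymp
        then have "eventually (\<lambda>j. (?w j / (real j + ?h)\<^sup>2) powr (\<rho> + 1) < 2) sequentially"
          by (rule order_tendstoD) simp
        then obtain J where J: "\<And>j. j \<ge> J \<Longrightarrow> (?w j / (real j + ?h)\<^sup>2) powr (\<rho> + 1) < 2"
          by (auto simp: eventually_sequentially)
        \<comment> \<open>then \<open>C * \<bar>m j\<bar> * N powr (\<rho> + 1)\<close> is at most \<open>1/2\<close> at the degree \<open>j\<close> found below, against the factor \<open>2\<close> in \<open>J\<close>\<close>
        define \<delta> where "\<delta> = W / (2 * C * \<bar>\<kappa> t\<bar>)"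
        have \<delta>: "\<delta> > 0"
          using W C \<kappa> by (simp add: \<delta>_def)
        obtain j where j: "j \<ge> J" "\<bar>L j\<bar> < \<delta> / (real j + ?h) powr (\<rho> + 1)"
          using small[OF \<delta>] by blast
        let ?N = "real j + ?h"
        have N: "?N > 0"
          by (rule add_nonneg_pos[OF of_nat_0_le_iff h])
        have w: "?w j > 0"
          using assms(1) by (intro add_pos_nonneg mult_nonneg_nonneg) auto
        have "C * \<bar>m j\<bar> * ?N powr (\<rho> + 1) = C * (\<bar>\<kappa> t\<bar> * \<bar>L j\<bar> / W) * ?N powr (\<rho> + 1)"
        proof -
          have "m j = \<kappa> t * L j / W"
            using m[of j] W by (simp add: field_simps)
          then show ?thesis
            using W by (simp add: abs_mult)
        qed
        also have "\<dots> = C * \<bar>\<kappa> t\<bar> / W * (\<bar>L j\<bar> * ?N powr (\<rho> + 1))"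
          by simp
        also have "\<dots> \<le> C * \<bar>\<kappa> t\<bar> / W * \<delta>"
          using j(2) N C W by (intro mult_left_mono) (simp_all add: field_simps)
        also have "\<dots> = 1/2"
          using W C \<kappa> by (simp add: \<delta>_def)
        finally have "(C * \<bar>m j\<bar> * ?N powr (\<rho> + 1))\<^sup>2 \<le> (1/2)\<^sup>2"
          using C by (intro power_mono) auto
        then have 1: "C\<^sup>2 * (m j)\<^sup>2 * (?N powr (\<rho> + 1))\<^sup>2 \<le> 1/4"
          by (simp add: power_mult_distrib power_divide)
        have split: "?w j powr (\<rho> + 1) = (?w j / ?N\<^sup>2) powr (\<rho> + 1) * (?N powr (\<rho> + 1))\<^sup>2"
        proof -
          have "(?N\<^sup>2) powr (\<rho> + 1) = (?N powr (\<rho> + 1))\<^sup>2"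
            using N by (simp add: power2_eq_square powr_mult)
          then show ?thesis
            using N w by (simp add: powr_divide)
        qed
        have "1 \<le> (?w j / ?N\<^sup>2) powr (\<rho> + 1) * (C\<^sup>2 * (m j)\<^sup>2 * (?N powr (\<rho> + 1))\<^sup>2)"
          using lower[of j] unfolding split by (simp only: mult_ac)
        also have "\<dots> \<le> 2 * (1/4)"
          using J[OF j(1)] 1 by (intro mult_mono) auto
        finally show False
          by simp
      qed
      then show "let t = cos (\<beta> * pi) in \<not> mf_inverse_bounded TYPE('a) \<alpha> (\<kappa> t) t (s + \<rho> + 1) s"
        by (simp add: Let_def t_def)
    qed
  qed
qed

end
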